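(* Let $N_s\ge4$ be even, let $U>0$, $t>0$, and consider the ground state $|\psi_0\rangle$ of the Bose-Hubbard Hamiltonian $\mathcal{H}$ on the periodic ring of $N_s$ sites with $N=N_s$ particles. Put $\varepsilon=\sqrt2\,t/U$. Let $\Lambda=A\sqcup B$ be a bipartition of the sites into two nonempty subsets, with boundary $\partial A$, let $C$ be the associated boundary matrix, and let $c_1,\dots,c_r$ be the nonzero eigenvalues (with multiplicity) of $CC^{\mathsf T}$. Then $\sum_k c_k=2|\partial A|$ and, for fixed $N_s$ and fixed $A$, as $\varepsilon\to0$, $$S_A=\varepsilon^{2}\Big[2|\partial A|\Big(1+\ln\tfrac1{\varepsilon^2}\Big)-\sum_{k=1}^{r}c_k\ln c_k\Big]+O(\varepsilon^3).$$
   Context: The sites are $\Lambda=\{1,\dots,N_s\}$, with indices modulo $N_s$. With bosonic operators $\hat b_i,\hat b_i^\dagger$ and $\hat n_i=\hat b_i^\dagger\hat b_i$, the Hamiltonian is $$\mathcal{H}=-t\sum_{i=1}^{N_s}\left(\hat b_i^\dagger\hat b_{i+1}+\mathrm{H.c.}\right)+\frac U2\sum_{i=1}^{N_s}\hat n_i(\hat n_i-1),$$ restricted to the subspace of total particle number $N$. The bonds are the $N_s$ pairs $\{i,i+1\}$. For a bipartition $\Lambda=A\sqcup B$ the Fock space factorizes as $\mathcal{F}=\mathcal{F}_A\otimes\mathcal{F}_B$. The entanglement entropy is $S_A=-\mathrm{Tr}[\rho^A\ln\rho^A]$ with $\rho^A=\mathrm{Tr}_B|\psi_0\rangle\langle\psi_0|$,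 $|\psi_0\rangle$ the normalized ground state. The boundary $\partial A$ is the set of bonds with one endpoint in $A$ and the other in $B$. Boundary matrix $C$: for a site $i$ let $d_i$ (doublon at $i$) denote the Fock state, of the subsystem ($A$ or $B$) containing $i$, with occupation $2$ at $i$ and $1$ at all other sites of that subsystem; let $h_i$ (hole at $i$) denote the one with occupation $0$ at $i$ and $1$ at all other sites of that subsystem. Rows of $C$ are indexed by the states $d_i,h_i$ with $i\in A$ and columns by the states $d_j,h_j$ with $j\in B$. The entry is $1$ for the pairs $(d_i,h_j)$ and $(h_i,d_j)$ whenever $\{i,j\}\in\partial A$ with $i\in A$, $j\in B$, and $0$ otherwise. Thus each boundary bond contributes two entries equal to $1$, one for each orientation (doublon in $A$ and hole in $B$, or vice versa). *)

theory Defs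
  imports
    "HOL-Library.Countable_Set"
    "HOL-Computational_Algebra.Polynomial"
    "Jordan_Normal_Form.Char_Poly"
    "Jordan_Normal_Form.Schur_Decomposition"
begin

section \<open>Lattice and Fock space\<close>

definition sites :: "nat \<Rightarrow> nat set" where
  "sites Ns = {1..Ns}"

text \<open>The right neighbour on the ring, so that the neighbour of site \<open>Ns\<close> is site \<open>1\<close>.\<close>

definition next_site :: "nat \<Rightarrow> nat \<Rightarrow> nat" where
  "next_site Ns i = i mod Ns + 1"

definition bonds :: "nat \<Rightarrow> nat set set" where
  "bonds Ns = (\<lambda>i. {i, next_site Ns i}) ` sites Ns"

definition boundary :: "nat \<Rightarrow> nat set \<Rightarrow> nat set \<Rightarrow> nat set set" where
  "boundary Ns A B = {e \<in> bonds Ns. \<exists>i\<in>A. \<exists>j\<in>B. e = {i, j}}"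

text \<open>A Fock basis state is given by its occupation numbers, a vector by its amplitudes in the
  occupation basis. The occupation numbers of a subsystem vanish outside the subsystem.\<close>

type_synonym occ = "nat \<Rightarrow> nat"
type_synonym fock_vec = "occ \<Rightarrow> complex"

definition occupations :: "nat set \<Rightarrow> nat \<Rightarrow> occ set" where
  "occupations S N = {n. (\<forall>i. i \<notin> S \<longrightarrow> n i = 0) \<and> (\<Sum>i\<in>S. n i) = N}"

definition sector :: "nat set \<Rightarrow> nat \<Rightarrow> fock_vec set" where
  "sector S N = {\<psi>. \<forall>n. n \<notin> occupations S N \<longrightarrow> \<psi> n = 0}"

text \<open>These are the relations \<open>b\<^sub>i |n\<rangle> = \<surd>n\<^sub>i |n - e\<^sub>i\<rangle>\<close> and \<open>b\<^sub>i\<^sup>\<dagger> |n\<rangle> = \<surd>(n\<^sub>i + 1) |n + e\<^sub>i\<rangle>\<close>,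
  read off on amplitudes.\<close>

definition annihilate :: "nat \<Rightarrow> fock_vec \<Rightarrow> fock_vec" where
  "annihilate i \<psi> = (\<lambda>n. complex_of_real (sqrt (real (n i + 1))) * \<psi> (n(i := n i + 1)))"

definition create :: "nat \<Rightarrow> fock_vec \<Rightarrow> fock_vec" where
  "create i \<psi> = (\<lambda>n. complex_of_real (sqrt (real (n i))) * \<psi> (n(i := n i - 1)))"

definition number :: "nat \<Rightarrow> fock_vec \<Rightarrow> fock_vec" where
  "number i \<psi> = create i (annihilate i \<psi>)"

definition bose_hubbard :: "nat \<Rightarrow> real \<Rightarrow> real \<Rightarrow> fock_vec \<Rightarrow> fock_vec" where
  "bose_hubbard Ns t U \<psi> = (\<lambda>n.
     - complex_of_real t * (\<Sum>i\<in>sites Ns.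
         create i (annihilate (next_site Ns i) \<psi>) n + create (next_site Ns i) (annihilate i \<psi>) n)
     + complex_of_real (U / 2) * (\<Sum>i\<in>sites Ns. number i (\<lambda>m. number i \<psi> m - \<psi> m) n))"

definition energy_eigenstate ::
    "nat \<Rightarrow> nat \<Rightarrow> real \<Rightarrow> real \<Rightarrow> real \<Rightarrow> fock_vec \<Rightarrow> bool" where
  "energy_eigenstate Ns N t U E \<psi> \<longleftrightarrow>
     \<psi> \<in> sector (sites Ns) N \<and> (\<exists>n. \<psi> n \<noteq> 0) \<and>
     (\<forall>n. bose_hubbard Ns t U \<psi> n = complex_of_real E * \<psi> n)"

definition ground_state :: "nat \<Rightarrow> nat \<Rightarrow> real \<Rightarrow> real \<Rightarrow> fock_vec \<Rightarrow> bool" where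
  "ground_state Ns N t U \<psi> \<longleftrightarrow>
     (\<exists>E. energy_eigenstate Ns N t U E \<psi> \<and>
          (\<forall>E' \<phi>. energy_eigenstate Ns N t U E' \<phi> \<longrightarrow> E \<le> E')) \<and>
     (\<Sum>n\<in>occupations (sites Ns) N. (cmod (\<psi> n))\<^sup>2) = 1"


section \<open>Matrices with rows and columns indexed by finite sets\<close>

text \<open>The rows and columns are numbered by an arbitrary enumeration of the index sets; the trace,
  the characteristic polynomial and the functional calculus do not depend on it.\<close>

definition mat_on :: "'a set \<Rightarrow> 'b set \<Rightarrow> ('a \<Rightarrow> 'b \<Rightarrow> 'c) \<Rightarrow> 'c mat" where
  "mat_on I J f =
     mat (card I) (card J) (\<lambda>(p, q). f (from_nat_into I p) (from_nat_into J q))"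

definition mat_trace :: "'a :: comm_monoid_add mat \<Rightarrow> 'a" where
  "mat_trace M = (\<Sum>i<dim_row M. M $$ (i, i))"

text \<open>The functional calculus \<open>f(M) = V diag(f(d)) V\<^sup>\<dagger>\<close> of a Hermitian matrix
  \<open>M = V diag(d) V\<^sup>\<dagger>\<close> with \<open>V\<close> unitary. The result does not depend on the diagonalization.\<close>

definition hermitian_fun :: "(real \<Rightarrow> real) \<Rightarrow> complex mat \<Rightarrow> complex mat" where
  "hermitian_fun f M = (SOME X. \<exists>V d. let n = dim_row M in
     V \<in> carrier_mat n n \<and> V * mat_adjoint V = 1\<^sub>m n \<and> mat_adjoint V * V = 1\<^sub>m n \<and>
     M = V * mat_diag n (\<lambda>i. complex_of_real (d i)) * mat_adjoint V \<and>
     X = V * mat_diag n (\<lambda>i. complex_of_real (f (d i))) * mat_adjoint V)"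


section \<open>Entanglement entropy\<close>

text \<open>For a state with \<open>N\<close> particles in total, only subsystem states with at most \<open>N\<close> particles
  occur, so the finite-dimensional spaces spanned by them replace \<open>\<F>\<^sub>A\<close> and \<open>\<F>\<^sub>B\<close>.\<close>

definition subsystem_basis :: "nat set \<Rightarrow> nat \<Rightarrow> occ set" where
  "subsystem_basis S N = (\<Union>M\<le>N. occupations S M)"

text \<open>The identification of \<open>|a\<rangle> \<otimes> |b\<rangle>\<close> with a Fock state of the whole system, for disjoint
  subsystems.\<close>

definition join :: "occ \<Rightarrow> occ \<Rightarrow> occ" where
  "join a b = (\<lambda>i. a i + b i)"

definition ket_bra :: "fock_vec \<Rightarrow> occ \<Rightarrow> occ \<Rightarrow> complex" where
  "ket_bra \<psi> n n' = \<psi> n * cnj (\<psi> n')"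

definition reduced_density :: "nat set \<Rightarrow> nat set \<Rightarrow> nat \<Rightarrow> fock_vec \<Rightarrow> complex mat" where
  "reduced_density A B N \<psi> =
     mat_on (subsystem_basis A N) (subsystem_basis A N)
       (\<lambda>a a'. \<Sum>b\<in>subsystem_basis B N. ket_bra \<psi> (join a b) (join a' b))"

text \<open>Since \<open>ln 0 = 0\<close> in the library, \<open>\<rho> ln \<rho>\<close> vanishes on the kernel of \<open>\<rho>\<close>, which is the usual
  convention. The trace is real.\<close>

definition entanglement_entropy :: "nat set \<Rightarrow> nat set \<Rightarrow> nat \<Rightarrow> fock_vec \<Rightarrow> real" where
  "entanglement_entropy A B N \<psi> =
     (let \<rho> = reduced_density A B N \<psi> in - Re (mat_trace (\<rho> * hermitian_fun ln \<rho>)))"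


section \<open>Boundary matrix\<close>

definition doublon :: "nat set \<Rightarrow> nat \<Rightarrow> occ" where
  "doublon S i = (\<lambda>k. if k \<in> S then if k = i then 2 else 1 else 0)"

definition hole :: "nat set \<Rightarrow> nat \<Rightarrow> occ" where
  "hole S i = (\<lambda>k. if k \<in> S then if k = i then 0 else 1 else 0)"

definition boundary_matrix :: "nat \<Rightarrow> nat set \<Rightarrow> nat set \<Rightarrow> real mat" where
  "boundary_matrix Ns A B =
     mat_on (doublon A ` A \<union> hole A ` A) (doublon B ` B \<union> hole B ` B)
       (\<lambda>r c. if \<exists>i\<in>A. \<exists>j\<in>B. {i, j} \<in> boundary Ns A B \<and>
                    (r = doublon A i \<and> c = hole B j \<or> r = hole A i \<and> c = doublon B j)
              then 1 else 0)"

text \<open>The nonzero eigenvalues of \<open>C C\<^sup>T\<close> with multiplicity. The matrix is real symmetric, so its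
  characteristic polynomial splits over the reals.\<close>

definition boundary_eigenvalues :: "nat \<Rightarrow> nat set \<Rightarrow> nat set \<Rightarrow> real multiset" where
  "boundary_eigenvalues Ns A B =
     (let C = boundary_matrix Ns A B
      in filter_mset (\<lambda>c. c \<noteq> 0) (proots (char_poly (C * transpose_mat C))))"

end

theory Submission
  imports Defs "HOL-Computational_Algebra.Fundamental_Theorem_Algebra"
begin

text \<open>Numbers of particles in \<open>A\<close> label the blocks of the amplitude matrix \<open>M\<close> of the ground state. The
  block of the filled states is a rank-one matrix up to \<open>O(\<epsilon>\<^sup>2)\<close>; the other blocks are
  \<open>\<epsilon> C + O(\<epsilon>\<^sup>2)\<close>, and where \<open>C\<close> does not vanish the error is even \<open>O(\<epsilon>\<^sup>3)\<close>, because hopping changes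
  the parity of the particle number on the even sublattice. Hence \<open>\<rho> = M M\<^sup>\<dagger>\<close> is nearly diagonal in the
  orthonormal system consisting of the normalized column of the filled state of \<open>B\<close> and of the
  eigenvectors of \<open>C C\<^sup>T\<close> for nonzero eigenvalues. The entropy is read off from this system with the
  tangents of \<open>-x ln x\<close> at \<open>1\<close> and at \<open>\<epsilon>\<^sup>2 c\<^sub>k\<close>. The logarithm multiplies only the total weight outside
  of the filled block, which is \<open>2 |\<partial>A| \<epsilon>\<^sup>2 + O(\<epsilon>\<^sup>4)\<close>.\<close>

section \<open>Diagonalization of Hermitian matrices\<close>

text \<open>An error of order \<open>\<epsilon>^3\<close> in the weight outside of the filled block
  would cost \<open>\<epsilon>^3 ln (1/\<epsilon>)\<close>, too much by a logarithm. Hence the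
  sharper error on the support of C, and hence the logarithm is attached to the total weight instead
  of the single eigenvector weights, which are controlled to order \<open>\<epsilon>^3\<close>. Hops
  inside of A or inside of B also create amplitudes of order \<epsilon>, but one of the two parts
  then stays filled: such entries lie in the row or column of a filled state and belong to the
  rank-one part. Only boundary bonds remain. Minimality of the energy enters as
  \<open>E \<le> 0\<close>. Every other Fock state costs on-site energy at least U, so the
  eigenvalue equation divides by at least U, and each hop away from the filled state gains a factor
  \<epsilon>. The factor sqrt 2 in \<epsilon> is the matrix element of a hop onto a singly occupied
  site, which makes \<epsilon> the first-order amplitude of each pair state. The constants are
  uniform because the c_k come from C alone: finitely many positive numbers, fixed while \<epsilon>
  tends to 0.\<close>

lemma mat_adjoint_carrier [simp]:
  "A \<in> carrier_mat n m \<Longrightarrow> mat_adjoint A \<in> carrier_mat m n"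
  unfolding mat_adjoint_def by (auto intro!: carrier_matI)

lemma mat_adjoint_dim [simp]:
  "dim_row (mat_adjoint A) = dim_col A" "dim_col (mat_adjoint A) = dim_row A"
  unfolding mat_adjoint_def by auto

lemma mat_adjoint_index [simp]:
  fixes A :: "complex mat"
  assumes "i < dim_col A" "j < dim_row A"
  shows "mat_adjoint A $$ (i, j) = cnj (A $$ (j, i))"
  using assms unfolding mat_adjoint_def by (auto simp: mat_of_rows_def)

lemma mat_adjoint_mult:
  fixes A B :: "complex mat"
  assumes "A \<in> carrier_mat n m" "B \<in> carrier_mat m k"
  shows "mat_adjoint (A * B) = mat_adjoint B * mat_adjoint A"
  by (rule eq_matI)
     (use assms in \<open>auto simp: scalar_prod_def cnj_sum mult.commute intro!: sum.cong\<close>)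

definition unitary_mat :: "nat \<Rightarrow> complex mat \<Rightarrow> bool" where
  "unitary_mat n V \<longleftrightarrow>
     V \<in> carrier_mat n n \<and> V * mat_adjoint V = 1\<^sub>m n \<and> mat_adjoint V * V = 1\<^sub>m n"

lemma unitary_mat_mult:
  assumes "unitary_mat n V" "unitary_mat n W"
  shows "unitary_mat n (V * W)"
proof -
  have c: "V \<in> carrier_mat n n" "W \<in> carrier_mat n n"
    and v: "V * mat_adjoint V = 1\<^sub>m n" "mat_adjoint V * V = 1\<^sub>m n"
    and w: "W * mat_adjoint W = 1\<^sub>m n" "mat_adjoint W * W = 1\<^sub>m n"
    using assms unfolding unitary_mat_def by auto
  note a = c[THEN mat_adjoint_carrier]
  note a = a mult_carrier_mat[OF a(2) a(1)] mult_carrier_mat[OF c]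
    mult_carrier_mat[OF a(1) c(1)]
  have "V * W * mat_adjoint (V * W) = V * (W * mat_adjoint W) * mat_adjoint V"
    using c a by (simp add: mat_adjoint_mult[OF c] assoc_mult_mat[of _ n n _ n _ n])
  moreover have "mat_adjoint (V * W) * (V * W) = mat_adjoint W * (mat_adjoint V * V) * W"
    using c a by (simp add: mat_adjoint_mult[OF c] assoc_mult_mat[of _ n n _ n _ n])
  ultimately show ?thesis
    unfolding unitary_mat_def using c a v w by simp
qed

text \<open>Householder reflection \<open>1 - (2/s) z z^*\<close> that sends the first basis vector
  to a multiple of v. It is unitary and self-adjoint, hence its own inverse, which keeps the
  conjugations in the diagonalization short.\<close>

lemma ex_reflection:
  fixes v :: "nat \<Rightarrow> complex"
  assumes n: "0 < n" and v: "(\<Sum>i<n. (cmod (v i))\<^sup>2) = 1"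
  shows "\<exists>W \<alpha>. unitary_mat n W \<and> mat_adjoint W = W \<and> (\<forall>i<n. W $$ (i, 0) = \<alpha> * v i)"
proof -
  \<comment> \<open>The phase makes the first entry of \<open>\<omega> v\<close> nonnegative, so
    that the mirror vector z has squared length \<open>s = 2 + 2 |v 0|\<close> and cannot
    vanish.\<close>
  obtain \<omega> where \<omega>: "cmod \<omega> = 1" "\<omega> * v 0 = of_real (cmod (v 0))"
  proof (cases "v 0 = 0")
    case True
    then show ?thesis using that[of 1] by simp
  next
    case False
    show ?thesis
      by (rule that[of "of_real (cmod (v 0)) / v 0"]) (use False in \<open>auto simp: norm_divide\<close>)
  qed
  define z where "z i = \<omega> * v i + (if i = 0 then 1 else 0)" for i
  define s where "s = 2 + 2 * cmod (v 0)"
  have s0: "s > 0" unfolding s_def by (smt (verit) norm_ge_zero)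
  have z0: "z 0 = of_real (s / 2)" unfolding z_def s_def using \<omega> by simp
  have zz: "(\<Sum>k<n. cnj (z k) * z k) = of_real s"
  proof -
    have "(\<Sum>k<n. cnj (z k) * z k) = (\<Sum>k<n. of_real ((cmod (v k))\<^sup>2) + (if k = 0 then 1 + 2 * of_real (cmod (v 0)) else 0))"
    proof (rule sum.cong[OF refl])
      fix k
      have "cnj (\<omega> * v k) * (\<omega> * v k) = of_real ((cmod (v k))\<^sup>2)"
        by (metis \<omega>(1) complex_norm_square mult.commute mult_1 norm_mult)
      moreover have "cnj \<omega> * cnj (v 0) = of_real (cmod (v 0))"
        by (metis \<omega>(2) complex_cnj_complex_of_real complex_cnj_mult)
      ultimately show "cnj (z k) * z k = of_real ((cmod (v k))\<^sup>2) + (if k = 0 then 1 + 2 * of_real (cmod (v 0)) else 0)"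
        unfolding z_def using \<omega>(2) by (auto simp: distrib_left distrib_right)
    qed
    also have "\<dots> = of_real (\<Sum>i<n. (cmod (v i))\<^sup>2) + (1 + 2 * of_real (cmod (v 0)))"
      using n by (simp add: sum.distrib)
    finally show ?thesis using v by (simp add: s_def)
  qed
  define W where "W = mat n n (\<lambda>(i, j). (if i = j then 1 else 0) - 2 / of_real s * z i * cnj (z j))"
  have W: "W \<in> carrier_mat n n" unfolding W_def by simp
  have adj: "mat_adjoint W = W"
    by (rule eq_matI) (auto simp: W_def)
  have "W * W = 1\<^sub>m n"
  proof (rule eq_matI)
    fix i j assume ij: "i < dim_row (1\<^sub>m n)" "j < dim_col (1\<^sub>m n)"
    let ?c = "2 / complex_of_real s"
    have "(W * W) $$ (i, j) = (\<Sum>k<n. ((if i = k then 1 else 0) - ?c * z i * cnj (z k)) *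
        ((if k = j then 1 else 0) - ?c * z k * cnj (z j)))"
      using ij by (auto simp: W_def scalar_prod_def atLeast0LessThan)
    also have "\<dots> = (\<Sum>k<n. (if i = k then (if i = j then 1 else 0) else 0)
        - (if i = k then ?c * z i * cnj (z j) else 0) - (if k = j then ?c * z i * cnj (z j) else 0)
        + ?c * ?c * z i * cnj (z j) * (cnj (z k) * z k))"
      by (rule sum.cong) (auto simp: algebra_simps)
    also have "\<dots> = (if i = j then 1 else 0) - 2 * ?c * z i * cnj (z j)
        + ?c * ?c * z i * cnj (z j) * (\<Sum>k<n. cnj (z k) * z k)"
      using ij by (simp add: sum.distrib sum_subtractf sum_distrib_left)
    also have "\<dots> = (if i = j then 1 else 0)"
      unfolding zz using s0 by (simp add: field_simps)
    finally show "(W * W) $$ (i, j) = 1\<^sub>m n $$ (i, j)" using ij by simp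
  qed (auto simp: W_def)
  then have "unitary_mat n W" unfolding unitary_mat_def using W adj by simp
  moreover have "W $$ (i, 0) = (- \<omega>) * v i" if "i < n" for i
  proof -
    have "W $$ (i, 0) = (if i = 0 then 1 else 0) - z i * (2 / of_real s * cnj (z 0))"
      using that n unfolding W_def by simp
    also have "2 / of_real s * cnj (z 0) = 1" unfolding z0 using s0 by simp
    finally show ?thesis by (simp add: z_def)
  qed
  ultimately show ?thesis using adj by blast
qed

text \<open>Deflation: a reflection moves one eigenvector to the first coordinate. This clears the
  first column, Hermitian symmetry clears the first row, and the induction hypothesis treats the
  remaining block.\<close>

lemma hermitian_diagonalization:
  fixes A :: "complex mat"
  assumes "A \<in> carrier_mat n n" and "mat_adjoint A = A"
  shows "\<exists>V d. unitary_mat n V \<and>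
    A = V * mat_diag n (\<lambda>i. complex_of_real (d i)) * mat_adjoint V"
  using assms
proof (induction n arbitrary: A)
  case 0
  then show ?case
    by (intro exI[of _ "1\<^sub>m 0"] exI[of _ "\<lambda>_. 0"]) (auto simp: unitary_mat_def intro!: eq_matI)
next
  case (Suc n)
  note A = Suc.prems(1)
  have "degree (char_poly A) = Suc n" using degree_monic_char_poly[OF A] by simp
  then have "\<not> constant (poly (char_poly A))" by (simp add: constant_degree)
  then obtain e where "poly (char_poly A) e = 0"
    using fundamental_theorem_of_algebra by blast
  then obtain u where u: "u \<in> carrier_vec (Suc n)" "u \<noteq> 0\<^sub>v (Suc n)" "A *\<^sub>v u = e \<cdot>\<^sub>v u"
    using eigenvalue_root_char_poly[OF A] A unfolding eigenvalue_def eigenvector_def by auto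
  define N where "N = (\<Sum>i<Suc n. (cmod (u $ i))\<^sup>2)"
  have N: "N > 0"
  proof -
    obtain i where i: "i < Suc n" "u $ i \<noteq> 0"
      using u(1,2) by (metis carrier_vecD eq_vecI index_zero_vec(1) index_zero_vec(2))
    then have "0 < (cmod (u $ i))\<^sup>2" by simp
    also have "\<dots> \<le> N" unfolding N_def
      by (rule member_le_sum) (use i in auto)
    finally show ?thesis .
  qed
  have "(\<Sum>i<Suc n. (cmod (u $ i / of_real (sqrt N)))\<^sup>2) = 1"
    using N by (simp add: norm_divide power_divide sum_divide_distrib[symmetric] N_def[symmetric]
        del: sum.lessThan_Suc)
  from ex_reflection[OF _ this] obtain W \<alpha> where W: "unitary_mat (Suc n) W" "mat_adjoint W = W"
    and W0: "\<And>i. i < Suc n \<Longrightarrow> W $$ (i, 0) = \<alpha> * (u $ i / of_real (sqrt N))" by auto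
  have Wc: "W \<in> carrier_mat (Suc n) (Suc n)" and WW: "W * W = 1\<^sub>m (Suc n)"
    using W unfolding unitary_mat_def by auto
  have colW: "col W 0 = (\<alpha> / of_real (sqrt N)) \<cdot>\<^sub>v u"
    by (rule eq_vecI) (use Wc W0 u(1) in auto)
  have AW0: "A *\<^sub>v col W 0 = e \<cdot>\<^sub>v col W 0"
    unfolding colW using A u(1,3) by (simp add: mult_mat_vec smult_smult_assoc mult.commute)
  define A' where "A' = W * A * W"
  have A'c: "A' \<in> carrier_mat (Suc n) (Suc n)" unfolding A'_def using Wc A by simp
  have A'adj: "mat_adjoint A' = A'"
    unfolding A'_def using Wc A W(2) Suc.prems(2)
    by (simp add: mat_adjoint_mult[of _ "Suc n" "Suc n" _ "Suc n"] assoc_mult_mat[of _ "Suc n" "Suc n" _ "Suc n" _ "Suc n"])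
  have A'sym: "A' $$ (i, j) = cnj (A' $$ (j, i))" if "i < Suc n" "j < Suc n" for i j
    using mat_adjoint_index[of i A' j] A'adj A'c that by simp
  have A'0: "A' $$ (i, 0) = (if i = 0 then e else 0)" if "i < Suc n" for i
  proof -
    have "A' = W * (A * W)" unfolding A'_def using Wc A by (simp add: assoc_mult_mat[of _ "Suc n" "Suc n" _ "Suc n" _ "Suc n"])
    then have "A' $$ (i, 0) = row W i \<bullet> col (A * W) 0"
      using that Wc A by simp
    also have "col (A * W) 0 = e \<cdot>\<^sub>v col W 0"
      unfolding AW0[symmetric] using Wc A by (intro col_mult2[of _ "Suc n" "Suc n" _ "Suc n"]) auto
    also have "row W i \<bullet> (e \<cdot>\<^sub>v col W 0) = e * (W * W) $$ (i, 0)"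
      using that Wc by simp
    finally show ?thesis using that unfolding WW by simp
  qed
  define A3 where "A3 = mat n n (\<lambda>(i, j). A' $$ (Suc i, Suc j))"
  have "mat_adjoint A3 = A3"
    by (rule eq_matI) (auto simp: A3_def A'sym[symmetric])
  with Suc.IH[of A3] obtain P d where P: "unitary_mat n P"
    and A3: "A3 = P * mat_diag n (\<lambda>i. complex_of_real (d i)) * mat_adjoint P"
    by (auto simp: A3_def)
  have Pc: "P \<in> carrier_mat n n" using P unfolding unitary_mat_def by simp
  define Q where "Q = four_block_mat (1\<^sub>m 1) (0\<^sub>m 1 n) (0\<^sub>m n 1) P"
  define Q' where "Q' = four_block_mat (1\<^sub>m 1) (0\<^sub>m 1 n) (0\<^sub>m n 1) (mat_adjoint P)"
  have Qc: "Q \<in> carrier_mat (Suc n) (Suc n)" unfolding Q_def using Pc by auto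
  have Qadj: "mat_adjoint Q = Q'"
    unfolding Q_def Q'_def by (rule eq_matI) (use Pc in auto)
  have QQ: "Q * Q' = 1\<^sub>m (Suc n)" "Q' * Q = 1\<^sub>m (Suc n)"
    unfolding Q_def Q'_def using P Pc
    by (auto simp: unitary_mat_def mult_four_block_mat[of _ 1 1 _ n _ n _ _ 1 _ n])
  have Q: "unitary_mat (Suc n) Q" unfolding unitary_mat_def using Qc Qadj QQ by simp
  define d' where "d' i = (case i of 0 \<Rightarrow> Re e | Suc j \<Rightarrow> d j)" for i
  \<comment> \<open>The eigenvalue is a diagonal entry of the Hermitian matrix \<open>A'\<close>,
    hence real.\<close>
  have eR: "e = of_real (Re e)"
    using A'sym[of 0 0] A'0[of 0] by (simp add: complex_eq_iff)
  have D': "mat_diag (Suc n) (\<lambda>i. complex_of_real (d' i)) =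
      four_block_mat (mat 1 1 (\<lambda>_. e)) (0\<^sub>m 1 n) (0\<^sub>m n 1) (mat_diag n (\<lambda>i. complex_of_real (d i)))"
    by (rule eq_matI) (auto simp: mat_diag_def d'_def eR[symmetric] split: nat.split)
  have "A' = four_block_mat (mat 1 1 (\<lambda>_. e)) (0\<^sub>m 1 n) (0\<^sub>m n 1) A3"
  proof (rule eq_matI)
    fix i j assume "i < dim_row (four_block_mat (mat 1 1 (\<lambda>_. e)) (0\<^sub>m 1 n) (0\<^sub>m n 1) A3)"
      "j < dim_col (four_block_mat (mat 1 1 (\<lambda>_. e)) (0\<^sub>m 1 n) (0\<^sub>m n 1) A3)"
    then have ij: "i < Suc n" "j < Suc n" by (auto simp: A3_def)
    show "A' $$ (i, j) = four_block_mat (mat 1 1 (\<lambda>_. e)) (0\<^sub>m 1 n) (0\<^sub>m n 1) A3 $$ (i, j)"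
      using ij A'0 A'sym[OF ij] by (auto simp: A3_def)
  qed (use A'c in \<open>auto simp: A3_def\<close>)
  also have "\<dots> = Q * mat_diag (Suc n) (\<lambda>i. complex_of_real (d' i)) * Q'"
  proof -
    define D where "D = mat_diag n (\<lambda>i. complex_of_real (d i))"
    have D: "D \<in> carrier_mat n n" unfolding D_def by simp
    note PD = mult_carrier_mat[OF Pc D] mat_adjoint_carrier[OF Pc]
    show ?thesis
      unfolding D' Q_def Q'_def A3 D_def[symmetric] using Pc D PD mult_carrier_mat[OF PD]
      by (simp add: mult_four_block_mat[of _ 1 1 _ n _ n _ _ 1 _ n] del: One_nat_def)
  qed
  finally have A': "A' = Q * mat_diag (Suc n) (\<lambda>i. complex_of_real (d' i)) * Q'" .
  have "A = (W * W) * A * (W * W)" unfolding WW using A by simp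
  also have "\<dots> = W * A' * W" unfolding A'_def using A Wc
    by (simp add: assoc_mult_mat[of _ "Suc n" "Suc n" _ "Suc n" _ "Suc n"])
  also have "\<dots> = (W * Q) * mat_diag (Suc n) (\<lambda>i. complex_of_real (d' i)) * mat_adjoint (W * Q)"
  proof -
    have Dc: "mat_diag (Suc n) (\<lambda>i. complex_of_real (d' i)) \<in> carrier_mat (Suc n) (Suc n)" by simp
    have Q'c: "Q' \<in> carrier_mat (Suc n) (Suc n)" using Qadj Qc by auto
    note m = mult_carrier_mat[OF Dc Q'c] mult_carrier_mat[OF Q'c Wc]
    show ?thesis
      unfolding A' mat_adjoint_mult[OF Wc Qc] W(2) Qadj using Wc Qc Q'c Dc m
      by (simp add: assoc_mult_mat[of _ "Suc n" "Suc n" _ "Suc n" _ "Suc n"] del: mat_diag_dim)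
  qed
  finally show ?case using unitary_mat_mult[OF W(1) Q] by blast
qed

text \<open>Orthonormality, completeness and the spectral decomposition, written over the index set
  itself. The estimates can then use sums over Fock states, free of the enumeration behind
  \<open>mat_on\<close>.\<close>

definition eigenbasis ::
    "'a set \<Rightarrow> ('a \<Rightarrow> 'a \<Rightarrow> complex) \<Rightarrow> (nat \<Rightarrow> 'a \<Rightarrow> complex) \<Rightarrow> (nat \<Rightarrow> real) \<Rightarrow> bool" where
  "eigenbasis I H v d \<longleftrightarrow>
     (\<forall>j<card I. \<forall>k<card I. (\<Sum>a\<in>I. v j a * cnj (v k a)) = (if j = k then 1 else 0)) \<and>
     (\<forall>a\<in>I. \<forall>b\<in>I. (\<Sum>j<card I. v j a * cnj (v j b)) = (if a = b then 1 else 0)) \<and>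
     (\<forall>a\<in>I. \<forall>b\<in>I. H a b = (\<Sum>j<card I. of_real (d j) * v j a * cnj (v j b)))"

lemma mult_diag_adjoint_index:
  fixes V :: "complex mat"
  assumes "V \<in> carrier_mat n n" "i < n" "j < n"
  shows "(V * mat_diag n e * mat_adjoint V) $$ (i, j) = (\<Sum>k<n. e k * V $$ (i, k) * cnj (V $$ (j, k)))"
  using assms
  by (auto simp: mat_diag_mult_right[OF assms(1)] scalar_prod_def atLeast0LessThan intro!: sum.cong)

lemma eigenbasis_of_diagonalization:
  assumes I: "finite I" and V: "unitary_mat (card I) V"
    and M: "mat_on I I H = V * mat_diag (card I) (\<lambda>i. complex_of_real (d i)) * mat_adjoint V"
  shows "eigenbasis I H (\<lambda>j a. V $$ (to_nat_on I a, j)) d"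
proof -
  let ?n = "card I" and ?f = "to_nat_on I"
  have bij: "bij_betw ?f I {..<?n}" by (rule to_nat_on_finite[OF I])
  have lt: "?f a < ?n" if "a \<in> I" for a using bij_betwE[OF bij] that by blast
  have inj: "?f a = ?f b \<longleftrightarrow> a = b" if "a \<in> I" "b \<in> I" for a b
    using inj_on_eq_iff[OF bij_betw_imp_inj_on[OF bij]] that by blast
  have Vc: "V \<in> carrier_mat ?n ?n" and VV: "V * mat_adjoint V = 1\<^sub>m ?n" "mat_adjoint V * V = 1\<^sub>m ?n"
    using V unfolding unitary_mat_def by auto
  have "(\<Sum>a\<in>I. V $$ (?f a, j) * cnj (V $$ (?f a, k))) = (if j = k then 1 else 0)"
    if "j < ?n" "k < ?n" for j k
  proof -
    have "(\<Sum>a\<in>I. V $$ (?f a, j) * cnj (V $$ (?f a, k))) = (\<Sum>p<?n. V $$ (p, j) * cnj (V $$ (p, k)))"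
      using sum.reindex_bij_betw[OF bij, of "\<lambda>p. V $$ (p, j) * cnj (V $$ (p, k))"] .
    also have "\<dots> = (mat_adjoint V * V) $$ (k, j)"
      using Vc that by (auto simp: scalar_prod_def atLeast0LessThan intro!: sum.cong)
    finally show ?thesis using that by (auto simp: VV)
  qed
  moreover have "(\<Sum>j<?n. V $$ (?f a, j) * cnj (V $$ (?f b, j))) = (if a = b then 1 else 0)"
    if "a \<in> I" "b \<in> I" for a b
  proof -
    have "(\<Sum>j<?n. V $$ (?f a, j) * cnj (V $$ (?f b, j))) = (V * mat_adjoint V) $$ (?f a, ?f b)"
      using Vc that lt by (auto simp: scalar_prod_def atLeast0LessThan intro!: sum.cong)
    then show ?thesis using that lt inj by (auto simp: VV)
  qed
  moreover have "H a b = (\<Sum>j<?n. of_real (d j) * V $$ (?f a, j) * cnj (V $$ (?f b, j)))"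
    if "a \<in> I" "b \<in> I" for a b
  proof -
    have "H a b = mat_on I I H $$ (?f a, ?f b)"
      using that lt I by (simp add: mat_on_def countable_finite)
    then show ?thesis
      unfolding M using mult_diag_adjoint_index[OF Vc lt lt] that by simp
  qed
  ultimately show ?thesis unfolding eigenbasis_def by blast
qed

lemma mat_on_hermitian:
  fixes H :: "'a \<Rightarrow> 'a \<Rightarrow> complex"
  assumes I: "finite I" and "\<And>a b. a \<in> I \<Longrightarrow> b \<in> I \<Longrightarrow> H a b = cnj (H b a)"
  shows "mat_adjoint (mat_on I I H) = mat_on I I H"
proof -
  have "from_nat_into I p \<in> I" if "p < card I" for p
    using bij_betwE[OF bij_betw_from_nat_into_finite[OF I]] that by blast
  then show ?thesis
    by (intro eq_matI) (auto simp: mat_on_def assms(2)[symmetric])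
qed

lemma ex_eigenbasis:
  assumes I: "finite I" and "\<And>a b. a \<in> I \<Longrightarrow> b \<in> I \<Longrightarrow> H a b = cnj (H b a)"
  shows "\<exists>v d. eigenbasis I H v d"
proof -
  have "mat_on I I H \<in> carrier_mat (card I) (card I)" by (simp add: mat_on_def)
  from hermitian_diagonalization[OF this mat_on_hermitian[OF assms]]
  show ?thesis using eigenbasis_of_diagonalization[OF I] by blast
qed

section \<open>Trace, entropy and characteristic roots from a diagonalization\<close>

lemma mat_trace_unitary_conj:
  assumes "unitary_mat n V"
  shows "mat_trace (V * mat_diag n e * mat_adjoint V) = (\<Sum>k<n. e k)"
proof -
  have Vc: "V \<in> carrier_mat n n" and VV: "mat_adjoint V * V = 1\<^sub>m n"
    using assms unfolding unitary_mat_def by auto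
  have "mat_trace (V * mat_diag n e * mat_adjoint V) = (\<Sum>i<n. \<Sum>k<n. e k * V $$ (i, k) * cnj (V $$ (i, k)))"
    unfolding mat_trace_def using Vc
    by (auto simp: mult_diag_adjoint_index[OF Vc] simp del: index_mult_mat(1) intro!: sum.cong)
  also have "\<dots> = (\<Sum>k<n. e k * (\<Sum>i<n. V $$ (i, k) * cnj (V $$ (i, k))))"
    by (subst sum.swap) (simp add: sum_distrib_left mult.assoc)
  also have "\<dots> = (\<Sum>k<n. e k * (mat_adjoint V * V) $$ (k, k))"
    using Vc by (auto simp: scalar_prod_def atLeast0LessThan mult.commute intro!: sum.cong)
  finally show ?thesis by (simp add: VV)
qed

text \<open>The matrix chosen by \<open>hermitian_fun\<close> carries its own V and d, which
  diagonalize \<rho> and its logarithm simultaneously. The entropy bounds below hold for every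
  eigenbasis, so they apply to the one obtained here.\<close>

lemma entanglement_entropy_eigenbasis:
  assumes fin: "finite (subsystem_basis A N)"
  shows "\<exists>v d. eigenbasis (subsystem_basis A N)
      (\<lambda>a a'. \<Sum>b\<in>subsystem_basis B N. ket_bra \<psi> (join a b) (join a' b)) v d \<and>
    entanglement_entropy A B N \<psi> = - (\<Sum>j<card (subsystem_basis A N). d j * ln (d j))"
proof -
  let ?I = "subsystem_basis A N"
  let ?n = "card ?I"
  let ?H = "\<lambda>a a'. \<Sum>b\<in>subsystem_basis B N. ket_bra \<psi> (join a b) (join a' b)"
  define \<rho> where "\<rho> = reduced_density A B N \<psi>"
  have \<rho>: "\<rho> = mat_on ?I ?I ?H" unfolding \<rho>_def reduced_density_def ..
  have \<rho>c: "\<rho> \<in> carrier_mat ?n ?n" unfolding \<rho> by (simp add: mat_on_def)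
  have "mat_adjoint \<rho> = \<rho>"
    unfolding \<rho> by (rule mat_on_hermitian[OF fin]) (simp add: ket_bra_def mult.commute)
  from hermitian_diagonalization[OF \<rho>c this] obtain V0 d0 where V0: "unitary_mat ?n V0"
    "\<rho> = V0 * mat_diag ?n (\<lambda>i. complex_of_real (d0 i)) * mat_adjoint V0" by blast
  define Q where "Q X V d \<longleftrightarrow> unitary_mat ?n V \<and>
     \<rho> = V * mat_diag ?n (\<lambda>i. complex_of_real (d i)) * mat_adjoint V \<and>
     X = V * mat_diag ?n (\<lambda>i. complex_of_real (ln (d i))) * mat_adjoint V" for X V d
  have "hermitian_fun ln \<rho> = (SOME X. \<exists>V d. Q X V d)"
    unfolding hermitian_fun_def Q_def unitary_mat_def carrier_matD(1)[OF \<rho>c] Let_def conj_assoc ..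
  moreover have "\<exists>X V d. Q X V d" unfolding Q_def using V0 by blast
  then have "\<exists>V d. Q (SOME X. \<exists>V d. Q X V d) V d" by (rule someI_ex)
  ultimately have "\<exists>V d. Q (hermitian_fun ln \<rho>) V d" by simp
  then obtain V d where V: "unitary_mat ?n V"
    and eq: "\<rho> = V * mat_diag ?n (\<lambda>i. complex_of_real (d i)) * mat_adjoint V"
    and X: "hermitian_fun ln \<rho> = V * mat_diag ?n (\<lambda>i. complex_of_real (ln (d i))) * mat_adjoint V"
    unfolding Q_def by blast
  have Vc: "V \<in> carrier_mat ?n ?n" and VV: "mat_adjoint V * V = 1\<^sub>m ?n"
    using V unfolding unitary_mat_def by auto
  define D where "D = mat_diag ?n (\<lambda>i. complex_of_real (d i))"
  define L where "L = mat_diag ?n (\<lambda>i. complex_of_real (ln (d i)))"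
  have DL: "D \<in> carrier_mat ?n ?n" "L \<in> carrier_mat ?n ?n" unfolding D_def L_def by auto
  note c = Vc mat_adjoint_carrier[OF Vc] DL
  have "\<rho> * hermitian_fun ln \<rho> = (V * D * mat_adjoint V) * (V * L * mat_adjoint V)"
    unfolding X D_def[symmetric] L_def[symmetric] by (subst eq) (simp add: D_def)
  also have "\<dots> = V * D * ((mat_adjoint V * V) * (L * mat_adjoint V))"
    using c mult_carrier_mat[OF c(4) c(2)] mult_carrier_mat[OF c(1) c(3)] mult_carrier_mat[OF c(1) c(4)]
      mult_carrier_mat[OF c(1) mult_carrier_mat[OF c(4) c(2)]]
      mult_carrier_mat[OF c(2) mult_carrier_mat[OF c(1) mult_carrier_mat[OF c(4) c(2)]]]
    by (simp add: assoc_mult_mat[of _ ?n ?n _ ?n _ ?n])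
  also have "\<dots> = V * D * (L * mat_adjoint V)"
    unfolding VV left_mult_one_mat[OF mult_carrier_mat[OF c(4) c(2)]] ..
  also have "\<dots> = V * (D * L) * mat_adjoint V"
    using c mult_carrier_mat[OF c(4) c(2)] mult_carrier_mat[OF c(3) c(4)]
    by (simp add: assoc_mult_mat[of _ ?n ?n _ ?n _ ?n])
  also have "D * L = mat_diag ?n (\<lambda>i. complex_of_real (d i * ln (d i)))"
    unfolding D_def L_def by simp
  finally have "mat_trace (\<rho> * hermitian_fun ln \<rho>) = (\<Sum>k<?n. complex_of_real (d k * ln (d k)))"
    by (simp only: mat_trace_unitary_conj[OF V])
  then have "entanglement_entropy A B N \<psi> = - (\<Sum>j<?n. d j * ln (d j))"
    unfolding entanglement_entropy_def \<rho>_def[symmetric] by (simp add: Let_def)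
  moreover have "eigenbasis ?I ?H (\<lambda>j a. V $$ (to_nat_on ?I a, j)) d"
    by (rule eigenbasis_of_diagonalization[OF fin V]) (use eq in \<open>unfold \<rho>\<close>)
  ultimately show ?thesis by blast
qed

text \<open>The diagonalization is complex while the boundary eigenvalues are roots over the reals.
  Similarity gives equality of the complex characteristic polynomials, and since the diagonal is
  real and \<open>of_real\<close> is injective on coefficients, the equality descends.\<close>

lemma proots_char_poly_real_diagonalization:
  fixes S :: "real mat"
  assumes S: "S \<in> carrier_mat n n" and V: "unitary_mat n V"
    and eq: "map_mat complex_of_real S = V * mat_diag n (\<lambda>i. complex_of_real (d i)) * mat_adjoint V"
  shows "proots (char_poly S) = image_mset d (mset_set {..<n})"
proof -
  let ?D = "mat_diag n (\<lambda>i. complex_of_real (d i))" and ?D' = "mat_diag n d"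
  have "similar_mat (map_mat complex_of_real S) ?D"
    unfolding similar_mat_def using S V eq
    by (intro exI[of _ V] exI[of _ "mat_adjoint V"] similar_mat_witI[of _ _ n]) (auto simp: unitary_mat_def)
  then have "char_poly (map_mat complex_of_real S) = char_poly ?D" by (rule char_poly_similar)
  also have "?D = map_mat complex_of_real ?D'" by (rule eq_matI) (auto simp: mat_diag_def)
  finally have "map_poly complex_of_real (char_poly S) = map_poly complex_of_real (char_poly ?D')"
    by (simp add: of_real_hom.char_poly_hom[OF S] of_real_hom.char_poly_hom[of ?D' n])
  then have "char_poly S = char_poly ?D'"
    by (simp add: poly_eq_iff coeff_map_poly)
  also have "\<dots> = (\<Prod>a\<leftarrow>diag_mat ?D'. [:- a, 1:])"
    by (rule char_poly_upper_triangular[of _ n]) (auto simp: mat_diag_def)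
  also have "diag_mat ?D' = map d [0..<n]"
    by (auto simp: diag_mat_def mat_diag_def)
  also have "(\<Prod>a\<leftarrow>map d [0..<n]. [:- a, 1:]) = (\<Prod>i<n. [:- d i, 1:])"
    by (simp add: prod.distinct_set_conv_list[symmetric] comp_def atLeast0LessThan)
  also have "proots \<dots> = (\<Sum>i<n. {#d i#})"
    by (subst proots_prod) auto
  also have "\<dots> = image_mset d (mset_set {..<n})"
    by (induction n) (auto simp: lessThan_Suc)
  finally show ?thesis .
qed

section \<open>Entropy bounds from an orthonormal system\<close>

lemma neg_xlnx_le_tangent:
  fixes x e :: real
  assumes "0 \<le> x" "0 < e"
  shows "- (x * ln x) \<le> - x * ln e - x + e"
proof (cases "x = 0")
  case False
  then have "ln (e / x) \<le> e / x - 1" using assms by (intro ln_le_minus_one) auto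
  then have "x * ln (e / x) \<le> x * (e / x - 1)" using assms by (intro mult_left_mono) auto
  then show ?thesis using assms False by (simp add: ln_div algebra_simps)
qed (use assms in auto)

text \<open>The inequality \<open>ln y \<le> y - 1\<close> at \<open>y = x / e\<close>; the upper
  tangent uses \<open>y = e / x\<close>. Averaged over the spectrum, the loss
  \<open>(x - e)^2 / e\<close> becomes a second moment that a residual controls. It holds down to x
  = 0, so the kernel of \<rho> is covered.\<close>

lemma neg_xlnx_ge_tangent:
  fixes x e :: real
  assumes "0 \<le> x" "0 < e"
  shows "- x * ln e - x + e - (x - e)\<^sup>2 / e \<le> - (x * ln x)"
proof (cases "x = 0")
  case False
  then have "ln (x / e) \<le> x / e - 1" using assms by (intro ln_le_minus_one) auto
  then have "x * ln (x / e) \<le> x * (x / e - 1)" using assms by (intro mult_left_mono) auto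
  moreover have "x * (x / e - 1) = x - e + (x - e)\<^sup>2 / e"
    using assms by (simp add: field_simps power2_eq_square)
  ultimately show ?thesis using assms False by (simp add: ln_div algebra_simps)
qed (use assms in \<open>auto simp: power2_eq_square\<close>)

section \<open>Inner products and orthonormal systems on finite index sets\<close>

definition ip :: "'a set \<Rightarrow> ('a \<Rightarrow> complex) \<Rightarrow> ('a \<Rightarrow> complex) \<Rightarrow> complex" where
  "ip I f g = (\<Sum>a\<in>I. cnj (f a) * g a)"

definition sqnorm :: "'a set \<Rightarrow> ('a \<Rightarrow> complex) \<Rightarrow> real" where
  "sqnorm I f = (\<Sum>a\<in>I. (cmod (f a))\<^sup>2)"

lemma ip_self: "ip I f f = of_real (sqnorm I f)"
  unfolding ip_def sqnorm_def of_real_sum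
  by (rule sum.cong[OF refl]) (simp only: complex_norm_square mult.commute)

lemma ip_cnj: "cnj (ip I f g) = ip I g f"
  unfolding ip_def by (simp add: cnj_sum mult.commute)

lemma cmod_ip_commute: "cmod (ip I f g) = cmod (ip I g f)"
  by (metis ip_cnj complex_mod_cnj)

lemma ip_diff_right: "ip I f (\<lambda>a. g a - h a) = ip I f g - ip I f h"
  unfolding ip_def by (simp add: right_diff_distrib sum_subtractf)

lemma ip_diff_left: "ip I (\<lambda>a. g a - h a) f = ip I g f - ip I h f"
  unfolding ip_def by (simp add: left_diff_distrib sum_subtractf)

lemma ip_scale_right: "ip I f (\<lambda>a. c * g a) = c * ip I f g"
  unfolding ip_def by (simp add: sum_distrib_left mult.left_commute)

lemma ip_sum_right: "ip I f (\<lambda>a. \<Sum>l\<in>L. \<alpha> l * w l a) = (\<Sum>l\<in>L. \<alpha> l * ip I f (w l))"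
  unfolding ip_def sum_distrib_left
  by (subst sum.swap) (simp add: mult.left_commute)

lemma ip_sum_left: "ip I (\<lambda>a. \<Sum>l\<in>L. \<alpha> l * w l a) f = (\<Sum>l\<in>L. cnj (\<alpha> l) * ip I (w l) f)"
  unfolding ip_cnj[symmetric, of I _ f] ip_sum_right by (simp add: cnj_sum)

lemma sqnorm_nonneg: "0 \<le> sqnorm I f"
  unfolding sqnorm_def by (simp add: sum_nonneg)

definition orthonormal_on :: "'a set \<Rightarrow> 'l set \<Rightarrow> ('l \<Rightarrow> 'a \<Rightarrow> complex) \<Rightarrow> bool" where
  "orthonormal_on I L w \<longleftrightarrow> (\<forall>l\<in>L. \<forall>k\<in>L. ip I (w l) (w k) = (if l = k then 1 else 0))"

text \<open>Completing the square in every coefficient. Dropping the last sum gives best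
  approximation; making it vanish gives Bessel, and Parseval for a complete system.\<close>

lemma sqnorm_minus_combination:
  assumes L: "finite L" and w: "orthonormal_on I L w"
  shows "sqnorm I (\<lambda>a. u a - (\<Sum>l\<in>L. \<alpha> l * w l a)) =
    sqnorm I u - (\<Sum>l\<in>L. (cmod (ip I (w l) u))\<^sup>2) + (\<Sum>l\<in>L. (cmod (\<alpha> l - ip I (w l) u))\<^sup>2)"
proof -
  let ?x = "\<lambda>a. \<Sum>l\<in>L. \<alpha> l * w l a"
  have xx: "ip I ?x ?x = (\<Sum>l\<in>L. cnj (\<alpha> l) * \<alpha> l)"
  proof -
    have "(\<Sum>k\<in>L. \<alpha> k * ip I (w l) (w k)) = \<alpha> l" if "l \<in> L" for l
    proof -
      have "(\<Sum>k\<in>L. \<alpha> k * ip I (w l) (w k)) = (\<Sum>k\<in>L. if l = k then \<alpha> k else 0)"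
        using w that unfolding orthonormal_on_def by (intro sum.cong) auto
      then show ?thesis using L that by simp
    qed
    note inner = this
    show ?thesis unfolding ip_sum_left ip_sum_right by (rule sum.cong) (simp_all only: inner)
  qed
  have "complex_of_real (sqnorm I (\<lambda>a. u a - ?x a)) =
      ip I u u - ip I u ?x - ip I ?x u + ip I ?x ?x"
    unfolding ip_self[symmetric] ip_diff_left ip_diff_right by simp
  also have "\<dots> = ip I u u + (\<Sum>l\<in>L. cnj (\<alpha> l) * \<alpha> l - \<alpha> l * cnj (ip I (w l) u) - cnj (\<alpha> l) * ip I (w l) u)"
    unfolding xx unfolding ip_sum_left ip_sum_right by (simp add: sum_subtractf ip_cnj)
  also have "\<dots> = ip I u u + (\<Sum>l\<in>L. of_real ((cmod (\<alpha> l - ip I (w l) u))\<^sup>2 - (cmod (ip I (w l) u))\<^sup>2))"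
    by (intro arg_cong2[of _ _ _ _ "(+)"] sum.cong refl)
       (simp only: of_real_diff complex_norm_square complex_cnj_diff, simp add: algebra_simps)
  finally have "complex_of_real (sqnorm I (\<lambda>a. u a - ?x a)) = of_real (sqnorm I u +
      (\<Sum>l\<in>L. (cmod (\<alpha> l - ip I (w l) u))\<^sup>2 - (cmod (ip I (w l) u))\<^sup>2))"
    unfolding ip_self by simp
  then show ?thesis unfolding of_real_eq_iff by (simp add: sum_subtractf)
qed

text \<open>Any trial coefficients bound the distance to the span. The deficits below are estimated
  with convenient coefficients instead of the optimal ones.\<close>

lemma best_approximation:
  assumes "finite L" "orthonormal_on I L w"
  shows "sqnorm I u - (\<Sum>l\<in>L. (cmod (ip I (w l) u))\<^sup>2) \<le> sqnorm I (\<lambda>a. u a - (\<Sum>l\<in>L. \<alpha> l * w l a))"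
  unfolding sqnorm_minus_combination[OF assms] by (simp add: sum_nonneg)

lemma bessel:
  assumes "finite L" "orthonormal_on I L w"
  shows "(\<Sum>l\<in>L. (cmod (ip I (w l) u))\<^sup>2) \<le> sqnorm I u"
  using sqnorm_minus_combination[OF assms, of u "\<lambda>l. ip I (w l) u"]
    sqnorm_nonneg[of I "\<lambda>a. u a - (\<Sum>l\<in>L. ip I (w l) u * w l a)"] by simp

lemma eigenbasis_orthonormal:
  assumes "eigenbasis I H v d"
  shows "orthonormal_on I {..<card I} v"
proof -
  have "ip I (v l) (v k) = (\<Sum>a\<in>I. v k a * cnj (v l a))" for l k
    unfolding ip_def by (simp add: mult.commute)
  then show ?thesis using assms unfolding eigenbasis_def orthonormal_on_def by auto
qed

lemma parseval:
  assumes I: "finite I" and v: "eigenbasis I H v d"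
  shows "(\<Sum>j<card I. (cmod (ip I (v j) u))\<^sup>2) = sqnorm I u"
proof -
  have "(\<Sum>j<card I. ip I (v j) u * v j a) = u a" if "a \<in> I" for a
  proof -
    have "(\<Sum>j<card I. ip I (v j) u * v j a) = (\<Sum>b\<in>I. u b * (\<Sum>j<card I. v j a * cnj (v j b)))"
      unfolding ip_def sum_distrib_right sum_distrib_left
      by (subst sum.swap) (simp add: mult_ac)
    also have "\<dots> = (\<Sum>b\<in>I. if a = b then u b else 0)"
      using v that unfolding eigenbasis_def by (intro sum.cong) auto
    finally show ?thesis using I that by simp
  qed
  then have "sqnorm I (\<lambda>a. u a - (\<Sum>j<card I. ip I (v j) u * v j a)) = 0"
    unfolding sqnorm_def by simp
  then show ?thesis
    using sqnorm_minus_combination[OF _ eigenbasis_orthonormal[OF v], of u "\<lambda>j. ip I (v j) u"] by simp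
qed

section \<open>Expectations, second moments and trace in an eigenbasis\<close>

lemma eigenbasis_apply:
  assumes v: "eigenbasis I H v d" and a: "a \<in> I"
  shows "(\<Sum>b\<in>I. H a b * u b) = (\<Sum>j<card I. of_real (d j) * ip I (v j) u * v j a)"
proof -
  have "(\<Sum>b\<in>I. H a b * u b) = (\<Sum>b\<in>I. \<Sum>j<card I. of_real (d j) * v j a * cnj (v j b) * u b)"
    using v a unfolding eigenbasis_def by (intro sum.cong) (auto simp: sum_distrib_right)
  also have "\<dots> = (\<Sum>j<card I. of_real (d j) * ip I (v j) u * v j a)"
    unfolding ip_def sum_distrib_right sum_distrib_left by (subst sum.swap) (simp add: mult_ac)
  finally show ?thesis .
qed

lemma eigenbasis_coefficient:
  assumes v: "eigenbasis I H v d" and j: "j < card I"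
  shows "ip I (v j) (\<lambda>a. \<Sum>b\<in>I. H a b * u b) = of_real (d j) * ip I (v j) u"
proof -
  have "ip I (v j) (\<lambda>a. \<Sum>b\<in>I. H a b * u b) =
      ip I (v j) (\<lambda>a. \<Sum>k<card I. (of_real (d k) * ip I (v k) u) * v k a)"
    unfolding ip_def[of I "v j"] by (intro sum.cong refl) (simp add: eigenbasis_apply[OF v])
  also have "\<dots> = (\<Sum>k<card I. if j = k then of_real (d k) * ip I (v k) u else 0)"
    unfolding ip_sum_right using eigenbasis_orthonormal[OF v] j
    by (intro sum.cong) (auto simp: orthonormal_on_def)
  finally show ?thesis using j by simp
qed

text \<open>The left side is the second moment about e of the eigenvalues under the weights of u. A
  small residual \<open>H u - e u\<close> thus concentrates these weights near e.\<close>

lemma eigenbasis_variance: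
  assumes I: "finite I" and v: "eigenbasis I H v d"
  shows "(\<Sum>j<card I. (cmod (ip I (v j) u))\<^sup>2 * (d j - e)\<^sup>2) =
    sqnorm I (\<lambda>a. (\<Sum>b\<in>I. H a b * u b) - of_real e * u a)"
proof -
  have "(cmod (ip I (v j) (\<lambda>a. (\<Sum>b\<in>I. H a b * u b) - of_real e * u a)))\<^sup>2 =
      (cmod (ip I (v j) u))\<^sup>2 * (d j - e)\<^sup>2" if "j < card I" for j
  proof -
    have "ip I (v j) (\<lambda>a. (\<Sum>b\<in>I. H a b * u b) - of_real e * u a) = of_real (d j - e) * ip I (v j) u"
      unfolding ip_diff_right ip_scale_right eigenbasis_coefficient[OF v that]
      by (simp add: left_diff_distrib)
    then show ?thesis by (simp add: norm_mult power_mult_distrib mult.commute del: of_real_diff)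
  qed
  then show ?thesis unfolding parseval[OF I v, symmetric] by simp
qed

lemma eigenbasis_expectation:
  assumes v: "eigenbasis I H v d"
  shows "ip I u (\<lambda>a. \<Sum>b\<in>I. H a b * u b) = of_real (\<Sum>j<card I. (cmod (ip I (v j) u))\<^sup>2 * d j)"
proof -
  have "ip I u (\<lambda>a. \<Sum>b\<in>I. H a b * u b) =
      ip I u (\<lambda>a. \<Sum>j<card I. (of_real (d j) * ip I (v j) u) * v j a)"
    unfolding ip_def[of I u] by (intro sum.cong refl) (simp add: eigenbasis_apply[OF v])
  also have "\<dots> = (\<Sum>j<card I. of_real (d j) * (ip I (v j) u * cnj (ip I (v j) u)))"
    unfolding ip_sum_right ip_cnj by (simp add: mult.assoc)
  finally show ?thesis unfolding complex_norm_square[symmetric] by (simp add: mult.commute)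
qed

text \<open>For \<open>H = M M^*\<close> the quadratic form is the squared norm of
  \<open>M^* u\<close>. This gives nonnegative eigenvalues and lets expectations be computed column
  by column.\<close>

lemma gram_expectation:
  assumes I: "finite I" and H: "\<And>a b. a \<in> I \<Longrightarrow> b \<in> I \<Longrightarrow> H a b = (\<Sum>c\<in>J. M a c * cnj (M b c))"
  shows "ip I u (\<lambda>a. \<Sum>b\<in>I. H a b * u b) = of_real (\<Sum>c\<in>J. (cmod (ip I u (\<lambda>a. M a c)))\<^sup>2)"
proof -
  have "ip I u (\<lambda>a. \<Sum>b\<in>I. H a b * u b) = ip I u (\<lambda>a. \<Sum>c\<in>J. ip I (\<lambda>a. M a c) u * M a c)"
    unfolding ip_def[of I u]
  proof (intro sum.cong refl arg_cong2[of _ _ _ _ "(*)"])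
    fix a assume a: "a \<in> I"
    have "(\<Sum>b\<in>I. H a b * u b) = (\<Sum>b\<in>I. \<Sum>c\<in>J. M a c * cnj (M b c) * u b)"
      using a by (intro sum.cong) (auto simp: H sum_distrib_right)
    also have "\<dots> = (\<Sum>c\<in>J. ip I (\<lambda>a. M a c) u * M a c)"
      unfolding ip_def sum_distrib_right by (subst sum.swap) (simp add: mult_ac)
    finally show "(\<Sum>b\<in>I. H a b * u b) = (\<Sum>c\<in>J. ip I (\<lambda>a. M a c) u * M a c)" .
  qed
  also have "\<dots> = (\<Sum>c\<in>J. ip I u (\<lambda>a. M a c) * cnj (ip I u (\<lambda>a. M a c)))"
    unfolding ip_sum_right ip_cnj by (simp add: mult.commute)
  finally show ?thesis unfolding complex_norm_square[symmetric] by simp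
qed

lemma eigenbasis_trace:
  assumes v: "eigenbasis I H v d"
  shows "(\<Sum>a\<in>I. H a a) = of_real (\<Sum>j<card I. d j)"
proof -
  have "(\<Sum>a\<in>I. H a a) = (\<Sum>a\<in>I. \<Sum>j<card I. of_real (d j) * v j a * cnj (v j a))"
    using v unfolding eigenbasis_def by (intro sum.cong) auto
  also have "\<dots> = (\<Sum>j<card I. of_real (d j) * (\<Sum>a\<in>I. v j a * cnj (v j a)))"
    by (subst sum.swap) (simp add: sum_distrib_left mult.assoc)
  also have "\<dots> = (\<Sum>j<card I. of_real (d j))"
    using v unfolding eigenbasis_def by (intro sum.cong) auto
  finally show ?thesis by simp
qed

text \<open>No diagonalizing basis has to be found: every orthonormal system \<open>w\<close> bounds the entropy,
  because each \<open>|\<langle>v\<^sub>j, w\<^sub>l\<rangle>|\<^sup>2\<close> is a probability distribution in \<open>j\<close>, to which the tangent of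
  \<open>-x ln x\<close> at \<open>e\<^sub>l\<close> applies. The eigenvalue weight outside of the span of \<open>w\<close> is \<open>R\<close>.\<close>

lemma gram_entropy_bounds:
  fixes M :: "'a \<Rightarrow> 'b \<Rightarrow> complex" and e :: "'l \<Rightarrow> real" and \<tau> :: real
  assumes I: "finite I" and J: "finite J" and v: "eigenbasis I H v d"
    and H: "\<And>a b. a \<in> I \<Longrightarrow> b \<in> I \<Longrightarrow> H a b = (\<Sum>c\<in>J. M a c * cnj (M b c))"
    and M: "(\<Sum>a\<in>I. \<Sum>c\<in>J. (cmod (M a c))\<^sup>2) = 1"
    and L: "finite L" and w: "orthonormal_on I L w"
    and e: "\<And>l. l \<in> L \<Longrightarrow> 0 < e l" and \<tau>: "0 < \<tau>"
  defines "\<mu> \<equiv> \<lambda>l. \<Sum>c\<in>J. (cmod (ip I (w l) (\<lambda>a. M a c)))\<^sup>2"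
  defines "R \<equiv> 1 - sum \<mu> L"
  defines "S \<equiv> - (\<Sum>j<card I. d j * ln (d j))"
  shows "S \<le> (\<Sum>l\<in>L. - \<mu> l * ln (e l) - \<mu> l + e l) + (- R * ln \<tau> - R + card I * \<tau>)"
    and "(\<Sum>l\<in>L. - \<mu> l * ln (e l) - \<mu> l + e l
      - sqnorm I (\<lambda>a. (\<Sum>b\<in>I. H a b * w l b) - of_real (e l) * w l a) / e l) \<le> S"
proof -
  let ?n = "card I"
  let ?\<eta> = "\<lambda>x::real. - (x * ln x)"
  define p where "p l j = (cmod (ip I (v j) (w l)))\<^sup>2" for l j
  \<comment> \<open>The part of the unit vector \<open>v j\<close> that lies outside of the span of
    w; nonnegative by Bessel.\<close>
  define q where "q j = 1 - (\<Sum>l\<in>L. p l j)" for j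
  note on = eigenbasis_orthonormal[OF v]
  have vn: "sqnorm I (v j) = 1" if "j < ?n" for j
  proof -
    have "complex_of_real (sqnorm I (v j)) = of_real 1"
      unfolding ip_self[symmetric] using on that by (auto simp: orthonormal_on_def)
    then show ?thesis unfolding of_real_eq_iff .
  qed
  have wn: "sqnorm I (w l) = 1" if "l \<in> L" for l
  proof -
    have "complex_of_real (sqnorm I (w l)) = of_real 1"
      unfolding ip_self[symmetric] using w that by (auto simp: orthonormal_on_def)
    then show ?thesis unfolding of_real_eq_iff .
  qed
  have p0: "0 \<le> p l j" for l j unfolding p_def by simp
  have p1: "(\<Sum>j<?n. p l j) = 1" if "l \<in> L" for l
    unfolding p_def using parseval[OF I v] wn[OF that] by simp
  have q0: "0 \<le> q j" if "j < ?n" for j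
    using bessel[OF L w, of "v j"] vn[OF that] unfolding q_def p_def by (simp add: cmod_ip_commute)
  have p\<mu>: "(\<Sum>j<?n. p l j * d j) = \<mu> l" for l
  proof -
    have "complex_of_real (\<Sum>j<?n. p l j * d j) = of_real (\<mu> l)"
      unfolding p_def \<mu>_def eigenbasis_expectation[OF v, symmetric]
      by (rule gram_expectation[OF I H])
    then show ?thesis unfolding of_real_eq_iff .
  qed
  have dnn: "0 \<le> d j" if "j < ?n" for j
  proof -
    have "complex_of_real (\<Sum>k<?n. (cmod (ip I (v k) (v j)))\<^sup>2 * d k) =
        of_real (\<Sum>c\<in>J. (cmod (ip I (v j) (\<lambda>a. M a c)))\<^sup>2)"
      unfolding eigenbasis_expectation[OF v, symmetric]
      by (rule gram_expectation[OF I H])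
    moreover have "(\<Sum>k<?n. (cmod (ip I (v k) (v j)))\<^sup>2 * d k) = (\<Sum>k<?n. if k = j then d k else 0)"
      using on that by (intro sum.cong) (auto simp: orthonormal_on_def)
    ultimately have "d j = (\<Sum>c\<in>J. (cmod (ip I (v j) (\<lambda>a. M a c)))\<^sup>2)"
      using that unfolding of_real_eq_iff by simp
    then show ?thesis by (simp add: sum_nonneg)
  qed
  have dsum: "(\<Sum>j<?n. d j) = 1"
  proof -
    have "(\<Sum>a\<in>I. H a a) = of_real (\<Sum>a\<in>I. \<Sum>c\<in>J. (cmod (M a c))\<^sup>2)"
      unfolding of_real_sum complex_norm_square using H by (intro sum.cong) auto
    then have "complex_of_real (\<Sum>j<?n. d j) = of_real 1"
      unfolding eigenbasis_trace[OF v] M .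
    then show ?thesis unfolding of_real_eq_iff .
  qed
  have d1: "d j \<le> 1" if "j < ?n" for j
    unfolding dsum[symmetric] using that dnn by (intro member_le_sum) auto
  have qd: "(\<Sum>j<?n. q j * d j) = R"
  proof -
    have "(\<Sum>j<?n. q j * d j) = (\<Sum>j<?n. d j) - (\<Sum>j<?n. \<Sum>l\<in>L. p l j * d j)"
      unfolding q_def by (simp add: left_diff_distrib sum_subtractf sum_distrib_right)
    also have "(\<Sum>j<?n. \<Sum>l\<in>L. p l j * d j) = sum \<mu> L"
      by (subst sum.swap) (simp add: p\<mu>)
    finally show ?thesis unfolding dsum R_def .
  qed
  have qn: "(\<Sum>j<?n. q j) \<le> ?n"
  proof -
    have "(\<Sum>j<?n. q j) \<le> (\<Sum>j<?n. 1)"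
      unfolding q_def by (intro sum_mono) (simp add: sum_nonneg p0)
    then show ?thesis by simp
  qed
  \<comment> \<open>The entropy of each eigenvalue is shared among the vectors w with weights
    \<open>p l j\<close>, and \<open>q j\<close> takes the rest.\<close>
  have split: "S = (\<Sum>l\<in>L. \<Sum>j<?n. p l j * ?\<eta> (d j)) + (\<Sum>j<?n. q j * ?\<eta> (d j))"
  proof -
    have "(\<Sum>l\<in>L. \<Sum>j<?n. p l j * ?\<eta> (d j)) = (\<Sum>j<?n. (\<Sum>l\<in>L. p l j) * ?\<eta> (d j))"
      by (subst sum.swap) (simp add: sum_distrib_right sum_negf)
    moreover have "(\<Sum>j<?n. q j * ?\<eta> (d j)) = (\<Sum>j<?n. ?\<eta> (d j)) - (\<Sum>j<?n. (\<Sum>l\<in>L. p l j) * ?\<eta> (d j))"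
      unfolding q_def sum_subtractf[symmetric] by (intro sum.cong) (simp_all add: algebra_simps)
    ultimately show ?thesis unfolding S_def by (simp add: sum_negf)
  qed
  have tangent: "(\<Sum>j<?n. p l j * (- d j * ln (e l) - d j + e l)) = - \<mu> l * ln (e l) - \<mu> l + e l"
    if "l \<in> L" for l
  proof -
    have "(\<Sum>j<?n. p l j * (- d j * ln (e l) - d j + e l)) =
        - (\<Sum>j<?n. p l j * d j) * ln (e l) - (\<Sum>j<?n. p l j * d j) + (\<Sum>j<?n. p l j) * e l"
      by (simp add: algebra_simps sum.distrib sum_subtractf sum_distrib_right sum_distrib_left sum_negf)
    then show ?thesis unfolding p\<mu> p1[OF that] by simp
  qed
  have "(\<Sum>j<?n. p l j * ?\<eta> (d j)) \<le> - \<mu> l * ln (e l) - \<mu> l + e l" if "l \<in> L" for l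
    unfolding tangent[OF that, symmetric]
    using neg_xlnx_le_tangent dnn e[OF that] p0 by (intro sum_mono mult_left_mono) auto
  \<comment> \<open>The remainder has no preferred scale, so its tangent point \<tau> is left free.
    The term with \<tau> comes from the sum of all \<open>q j\<close>, which is at most
    \<open>card I\<close>.\<close>
  moreover have "(\<Sum>j<?n. q j * ?\<eta> (d j)) \<le> - R * ln \<tau> - R + ?n * \<tau>"
  proof -
    have "(\<Sum>j<?n. q j * ?\<eta> (d j)) \<le> (\<Sum>j<?n. q j * (- d j * ln \<tau> - d j + \<tau>))"
      using neg_xlnx_le_tangent dnn \<tau> q0 by (intro sum_mono mult_left_mono) auto
    also have "\<dots> = - R * ln \<tau> - R + (\<Sum>j<?n. q j) * \<tau>"
      unfolding qd[symmetric]
      by (simp add: algebra_simps sum.distrib sum_subtractf sum_distrib_right sum_distrib_left sum_negf)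
    also have "\<dots> \<le> - R * ln \<tau> - R + ?n * \<tau>"
      using qn \<tau> by simp
    finally show ?thesis .
  qed
  ultimately show "S \<le> (\<Sum>l\<in>L. - \<mu> l * ln (e l) - \<mu> l + e l) + (- R * ln \<tau> - R + card I * \<tau>)"
    unfolding split by (intro add_mono sum_mono) auto
  have "- \<mu> l * ln (e l) - \<mu> l + e l
      - sqnorm I (\<lambda>a. (\<Sum>b\<in>I. H a b * w l b) - of_real (e l) * w l a) / e l
      \<le> (\<Sum>j<?n. p l j * ?\<eta> (d j))" if "l \<in> L" for l
  proof -
    have "- \<mu> l * ln (e l) - \<mu> l + e l
      - sqnorm I (\<lambda>a. (\<Sum>b\<in>I. H a b * w l b) - of_real (e l) * w l a) / e l =
        (\<Sum>j<?n. p l j * (- d j * ln (e l) - d j + e l)) - (\<Sum>j<?n. p l j * (d j - e l)\<^sup>2) / e l"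
      by (simp only: tangent[OF that] eigenbasis_variance[OF I v, symmetric] p_def[symmetric])
    also have "\<dots> = (\<Sum>j<?n. p l j * (- d j * ln (e l) - d j + e l - (d j - e l)\<^sup>2 / e l))"
      unfolding sum_divide_distrib sum_subtractf[symmetric]
      by (intro sum.cong) (simp_all add: right_diff_distrib)
    also have "(\<Sum>j<?n. p l j * (- d j * ln (e l) - d j + e l - (d j - e l)\<^sup>2 / e l)) \<le> (\<Sum>j<?n. p l j * ?\<eta> (d j))"
      using neg_xlnx_ge_tangent[OF dnn e[OF that]] p0 by (intro sum_mono mult_left_mono) auto
    finally show ?thesis .
  qed
  moreover have "0 \<le> (\<Sum>j<?n. q j * ?\<eta> (d j))"
  proof (intro sum_nonneg mult_nonneg_nonneg)
    fix j assume "j \<in> {..<?n}"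
    then have "0 \<le> d j" "d j \<le> 1" "0 \<le> q j" using q0 dnn d1 by auto
    then show "0 \<le> q j" "0 \<le> ?\<eta> (d j)"
      by (cases "d j = 0"; simp add: mult_le_0_iff)+
  qed
  ultimately show "(\<Sum>l\<in>L. - \<mu> l * ln (e l) - \<mu> l + e l
      - sqnorm I (\<lambda>a. (\<Sum>b\<in>I. H a b * w l b) - of_real (e l) * w l a) / e l) \<le> S"
    unfolding split by (intro add_increasing2 sum_mono)
qed

section \<open>Perturbations of a product state\<close>

lemma ip_supported:
  assumes "finite I" "X \<subseteq> I"
  shows "ip I (\<lambda>a. if a \<in> X then f a else 0) u = ip X f u"
  unfolding ip_def using assms by (intro sum.mono_neutral_cong_right) auto

lemma sqnorm_le:
  fixes r :: real
  assumes "finite I" "0 \<le> r" and "\<And>a. a \<in> I \<Longrightarrow> cmod (f a) \<le> r"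
  shows "sqnorm I f \<le> card I * r\<^sup>2"
  unfolding sqnorm_def using assms by (intro sum_bounded_above) (auto intro: power_mono)

lemma cmod_le_1_if_sqnorm:
  assumes "finite I" "sqnorm I f = 1" "a \<in> I"
  shows "cmod (f a) \<le> 1"
proof -
  have "(cmod (f a))\<^sup>2 \<le> sqnorm I f"
    unfolding sqnorm_def using assms by (intro member_le_sum) auto
  then show ?thesis using assms(2) by (simp add: abs_square_le_1)
qed

lemma sqnorm_orthonormal:
  assumes "orthonormal_on I L w" "l \<in> L"
  shows "sqnorm I (w l) = 1"
proof -
  have "complex_of_real (sqnorm I (w l)) = of_real 1"
    unfolding ip_self[symmetric] using assms by (auto simp: orthonormal_on_def)
  then show ?thesis unfolding of_real_eq_iff .
qed

lemma sum_cmod_le: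
  fixes g :: "'a \<Rightarrow> complex" and r :: real
  assumes "\<And>a. a \<in> A \<Longrightarrow> cmod (g a) \<le> r"
  shows "cmod (sum g A) \<le> card A * r"
  by (rule order_trans[OF norm_sum]) (use assms in \<open>intro sum_bounded_above\<close>)

text \<open>The data that depend on the bipartition only. Separating them from the state and from
  \<epsilon> makes every constant built from \<open>ln (c k)\<close> and \<open>1 / c k\<close>
  uniform in the limit. C is extended by zero to all of I and J, and X contains its nonzero
  rows.\<close>

locale first_order_coupling =
  fixes I I1 X :: "'a set" and J J1 :: "'b set" and a0 :: 'a and b0 :: 'b
    and C :: "'a \<Rightarrow> 'b \<Rightarrow> real" and f :: "nat \<Rightarrow> 'a \<Rightarrow> complex" and c :: "nat \<Rightarrow> real"
  assumes fin: "finite I" "finite J" and sub: "I1 \<subseteq> I" "J1 \<subseteq> J" "X \<subseteq> I - I1"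
    and base: "a0 \<in> I1" "b0 \<in> J1"
    and C_supp: "\<And>a b. a \<in> I \<Longrightarrow> b \<in> J \<Longrightarrow> C a b \<noteq> 0 \<Longrightarrow> a \<in> X \<and> b \<notin> J1"
    and C_le: "\<And>a b. \<bar>C a b\<bar> \<le> 1"
    and f: "eigenbasis X (\<lambda>a a'. of_real (\<Sum>b\<in>J. C a b * C a' b)) f c"
begin

definition \<beta> :: real where "\<beta> = (\<Sum>a\<in>I. \<Sum>b\<in>J. (C a b)\<^sup>2)"

definition kset :: "nat set" where "kset = {k. k < card X \<and> c k \<noteq> 0}"

lemma XI: "X \<subseteq> I" using sub by auto

lemma finX: "finite X" using XI fin(1) by (rule finite_subset)

lemma base': "a0 \<in> I" "b0 \<in> J" using base sub by auto

lemma c_eq: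
  assumes "k < card X"
  shows "c k = (\<Sum>b\<in>J. (cmod (ip X (f k) (\<lambda>a. of_real (C a b))))\<^sup>2)"
proof -
  have "ip X (f k) (\<lambda>a. \<Sum>a'\<in>X. of_real (\<Sum>b\<in>J. C a b * C a' b) * f k a') =
      of_real (\<Sum>b\<in>J. (cmod (ip X (f k) (\<lambda>a. of_real (C a b))))\<^sup>2)"
    by (rule gram_expectation[OF finX]) simp
  moreover have "ip X (f k) (\<lambda>a. \<Sum>a'\<in>X. of_real (\<Sum>b\<in>J. C a b * C a' b) * f k a') = of_real (c k)"
    unfolding eigenbasis_coefficient[OF f assms]
    using eigenbasis_orthonormal[OF f] assms by (simp add: orthonormal_on_def)
  ultimately show ?thesis by (metis of_real_eq_iff)
qed

lemma c_nonneg: "k < card X \<Longrightarrow> 0 \<le> c k"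
  by (simp add: c_eq sum_nonneg)

lemma c_pos: "k \<in> kset \<Longrightarrow> 0 < c k"
  using c_nonneg[of k] unfolding kset_def by auto

text \<open>By \<open>c_eq\<close>, \<open>c k\<close> is the squared norm of
  \<open>C^T f_k\<close>, so an eigenvector for the eigenvalue 0 is orthogonal to every column of
  C.\<close>

lemma c_zero:
  assumes "k < card X" "k \<notin> kset" "b \<in> J"
  shows "ip X (f k) (\<lambda>a. of_real (C a b)) = 0"
proof -
  have "(\<Sum>b\<in>J. (cmod (ip X (f k) (\<lambda>a. of_real (C a b))))\<^sup>2) = 0"
    using assms c_eq[of k] by (simp add: kset_def)
  then show ?thesis using fin assms(3) by (simp add: sum_nonneg_eq_0_iff)
qed

text \<open>The trace of \<open>C C^T\<close>, once from the eigenvalues and once from the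
  entries.\<close>

lemma c_sum: "(\<Sum>k\<in>kset. c k) = \<beta>"
proof -
  have "(\<Sum>a\<in>X. complex_of_real (\<Sum>b\<in>J. C a b * C a b)) = of_real (\<Sum>k<card X. c k)"
    by (rule eigenbasis_trace[OF f])
  then have "(\<Sum>k<card X. c k) = (\<Sum>a\<in>X. \<Sum>b\<in>J. (C a b)\<^sup>2)"
    unfolding of_real_sum[symmetric] of_real_eq_iff by (simp add: power2_eq_square)
  also have "\<dots> = \<beta>" unfolding \<beta>_def
    using fin XI by (intro sum.mono_neutral_left) (auto intro!: sum.neutral dest: C_supp)
  finally show ?thesis
    unfolding kset_def by (subst sum.mono_neutral_left[of "{..<card X}"]) auto
qed

end

text \<open>\<open>M\<close> is the amplitude matrix of a state close to the product state \<open>(a0, b0)\<close>, and \<open>I1\<close>, \<open>J1\<close>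
  are the states in the particle number sectors of \<open>a0\<close> and \<open>b0\<close>, so that \<open>M\<close> is block diagonal.
  The first-order amplitudes outside of these sectors are given by \<open>C\<close>.\<close>

locale perturbed_product_state = first_order_coupling I I1 X J J1 a0 b0 C f c
  for I I1 X :: "'a set" and J J1 :: "'b set" and a0 :: 'a and b0 :: 'b
    and C :: "'a \<Rightarrow> 'b \<Rightarrow> real" and f :: "nat \<Rightarrow> 'a \<Rightarrow> complex" and c :: "nat \<Rightarrow> real" +
  fixes K \<epsilon> :: real and M :: "'a \<Rightarrow> 'b \<Rightarrow> complex"
  assumes K: "1 \<le> K" and \<epsilon>: "0 < \<epsilon>" "\<epsilon> < 1"
    and M_norm: "(\<Sum>a\<in>I. \<Sum>b\<in>J. (cmod (M a b))\<^sup>2) = 1"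
    and M_block: "\<And>a b. a \<in> I \<Longrightarrow> b \<in> J \<Longrightarrow> (a \<in> I1) \<noteq> (b \<in> J1) \<Longrightarrow> M a b = 0"
    and M_base: "1 / 2 \<le> cmod (M a0 b0)"
    and M_small: "\<And>a b. a \<in> I \<Longrightarrow> b \<in> J \<Longrightarrow> (a, b) \<noteq> (a0, b0) \<Longrightarrow> cmod (M a b) \<le> K * \<epsilon>"
    and M_inner: "\<And>a b. a \<in> I1 \<Longrightarrow> b \<in> J1 \<Longrightarrow> a \<noteq> a0 \<Longrightarrow> b \<noteq> b0 \<Longrightarrow> cmod (M a b) \<le> K * \<epsilon>\<^sup>2"
    and M_outer: "\<And>a b. a \<in> I - I1 \<Longrightarrow> b \<in> J - J1 \<Longrightarrow> cmod (M a b - of_real (\<epsilon> * C a b)) \<le> K * \<epsilon>\<^sup>2"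
    and M_first: "\<And>a b. a \<in> I \<Longrightarrow> b \<in> J \<Longrightarrow> C a b \<noteq> 0 \<Longrightarrow> cmod (M a b - of_real (\<epsilon> * C a b)) \<le> K * \<epsilon> ^ 3"
begin

abbreviation "n \<equiv> real (card I)"
abbreviation "m \<equiv> real (card J)"

definition H :: "'a \<Rightarrow> 'a \<Rightarrow> complex" where
  "H a a' = (\<Sum>b\<in>J. M a b * cnj (M a' b))"

definition s :: real where "s = sqnorm I (\<lambda>a. M a b0)"

text \<open>\<open>None\<close> labels the vector of the filled block, \<open>Some k\<close> an
  eigenvector of \<open>C C^T\<close>. Zero eigenvalues are left out because the tangent points must
  be positive; the weight in those directions is part of the remainder R.\<close>

definition L :: "nat option set" where "L = insert None (Some ` kset)"

definition w :: "nat option \<Rightarrow> 'a \<Rightarrow> complex" where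
  "w l a = (case l of None \<Rightarrow> of_real (1 / sqrt s) * M a b0
    | Some k \<Rightarrow> if a \<in> X then f k a else 0)"

definition \<mu> :: "nat option \<Rightarrow> real" where
  "\<mu> l = (\<Sum>b\<in>J. (cmod (ip I (w l) (\<lambda>a. M a b)))\<^sup>2)"

definition e :: "nat option \<Rightarrow> real" where
  "e l = (case l of None \<Rightarrow> 1 | Some k \<Rightarrow> \<epsilon>\<^sup>2 * c k)"

definition residual :: "nat option \<Rightarrow> 'a \<Rightarrow> complex" where
  "residual l a = (\<Sum>b\<in>I. H a b * w l b) - of_real (e l) * w l a"

lemma K_powers: "1 \<le> K\<^sup>2" "K \<le> K\<^sup>2" "K\<^sup>2 \<le> K ^ 4" "K\<^sup>2 \<ge> 0"
  using K power_increasing[of 1 2 K] power_increasing[of 2 4 K] by auto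

lemma s_ge: "1 / 4 \<le> s"
proof -
  have "(1 / 2)\<^sup>2 \<le> (cmod (M a0 b0))\<^sup>2" using M_base by (intro power_mono) auto
  also have "\<dots> \<le> s" unfolding s_def sqnorm_def using fin base' by (intro member_le_sum) auto
  finally show ?thesis by (simp add: power2_eq_square)
qed

lemma s_pos: "0 < s" using s_ge by simp

lemma finL: "finite kset" "finite L" unfolding L_def kset_def by auto

lemma w_outside: "a \<in> I - I1 \<Longrightarrow> w None a = 0" "a \<notin> X \<Longrightarrow> w (Some k) a = 0"
  using base sub M_block[of a b0] unfolding w_def by auto

lemma ip_Some: "ip I (w (Some k)) u = ip X (f k) u"
  unfolding w_def by (simp add: ip_supported[OF fin(1) XI])

text \<open>The column of b0 is supported in I1 by the block structure, the eigenvectors in X, and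
  these sets are disjoint.\<close>

lemma w_orthonormal: "orthonormal_on I L w"
proof -
  have 1: "ip I (w None) (w None) = 1"
  proof -
    have "sqnorm I (w None) = (1 / s) * sqnorm I (\<lambda>a. M a b0)"
      unfolding w_def sqnorm_def sum_distrib_left using s_pos
      by (intro sum.cong) (auto simp: norm_mult power_mult_distrib power_divide norm_divide)
    then show ?thesis unfolding ip_self s_def[symmetric] using s_pos by simp
  qed
  have "w None a = 0" if "a \<in> X" for a using w_outside(1)[of a] sub that by blast
  then have 2: "ip I (w (Some k)) (w None) = 0" for k
    unfolding ip_Some unfolding ip_def by (intro sum.neutral) simp
  have 3: "ip I (w None) (w (Some k)) = 0" for k
    using 2[of k] ip_cnj[of I "w (Some k)" "w None"] by simp
  have 4: "ip I (w (Some k)) (w (Some j)) = (if k = j then 1 else 0)" if "k \<in> kset" "j \<in> kset" for k j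
  proof -
    have "ip I (w (Some k)) (w (Some j)) = ip X (f k) (f j)"
      unfolding ip_Some unfolding ip_def by (intro sum.cong) (auto simp: w_def)
    then show ?thesis using eigenbasis_orthonormal[OF f] that by (auto simp: orthonormal_on_def kset_def)
  qed
  show ?thesis unfolding orthonormal_on_def L_def using 1 2 3 4 by auto
qed

lemma w_le_1: "l \<in> L \<Longrightarrow> a \<in> I \<Longrightarrow> cmod (w l a) \<le> 1"
  by (rule cmod_le_1_if_sqnorm[OF fin(1) sqnorm_orthonormal[OF w_orthonormal]])

text \<open>The squared distance from column b of M to the span of w; summed over b it is R.\<close>

definition deficit :: "'b \<Rightarrow> real" where
  "deficit b = sqnorm I (\<lambda>a. M a b) - (\<Sum>l\<in>L. (cmod (ip I (w l) (\<lambda>a. M a b)))\<^sup>2)"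

lemma deficit_nonneg: "0 \<le> deficit b"
  unfolding deficit_def using bessel[OF finL(2) w_orthonormal] by simp

lemma sum_L: "(\<Sum>l\<in>L. g l) = g None + (\<Sum>k\<in>kset. g (Some k))"
  unfolding L_def using finL by (simp add: sum.reindex comp_def)

text \<open>Each column of C is a combination of eigenvectors for nonzero eigenvalues, since it is
  orthogonal to the others. Outside of X both sides vanish.\<close>

lemma C_expansion:
  assumes "a \<in> I" "b \<in> J"
  shows "(\<Sum>k\<in>kset. ip X (f k) (\<lambda>a. of_real (C a b)) * w (Some k) a) = of_real (C a b)"
proof (cases "a \<in> X")
  case True
  have "(\<Sum>k\<in>kset. ip X (f k) (\<lambda>a. of_real (C a b)) * w (Some k) a) =
      (\<Sum>k<card X. ip X (f k) (\<lambda>a. of_real (C a b)) * f k a)"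
    using True assms by (intro sum.mono_neutral_cong_left) (auto simp: kset_def c_zero w_def)
  also have "\<dots> = (\<Sum>a'\<in>X. of_real (C a' b) * (\<Sum>k<card X. f k a * cnj (f k a')))"
    unfolding ip_def sum_distrib_right sum_distrib_left by (subst sum.swap) (simp add: mult_ac)
  also have "\<dots> = (\<Sum>a'\<in>X. if a = a' then of_real (C a' b) else 0)"
    using f True unfolding eigenbasis_def by (intro sum.cong) auto
  finally show ?thesis using finX True by simp
next
  case False
  then have "C a b = 0" using C_supp[OF assms] by blast
  then show ?thesis using False by (simp add: w_def)
qed

text \<open>In the filled block, subtracting a multiple of the column of b0 leaves an inner entry of
  order \<open>\<epsilon>^2\<close> and a product of two entries of order \<epsilon> divided by a
  base entry of modulus at least 1/2: together \<open>K + 2 K^2 \<le> 3 K^2\<close>. In the other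
  columns, the columns of \<open>\<epsilon> C\<close> are subtracted.\<close>

lemma deficit_le:
  assumes b: "b \<in> J"
  shows "deficit b \<le> n * (3 * K\<^sup>2 * \<epsilon>\<^sup>2)\<^sup>2"
proof (cases "b \<in> J1")
  case True
  \<comment> \<open>The multiple that agrees with column b in row a0; the factor
    \<open>sqrt s\<close> undoes the normalization of \<open>w None\<close>.\<close>
  define \<alpha> where "\<alpha> l = (case l of None \<Rightarrow> M a0 b / M a0 b0 * of_real (sqrt s) | Some k \<Rightarrow> 0)"
    for l :: "nat option"
  have nz: "M a0 b0 \<noteq> 0" using M_base by auto
  have x: "(\<Sum>l\<in>L. \<alpha> l * w l a) = M a0 b / M a0 b0 * M a b0" for a
    unfolding sum_L using s_pos by (simp add: \<alpha>_def w_def)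
  have "cmod (M a b - (\<Sum>l\<in>L. \<alpha> l * w l a)) \<le> 3 * K\<^sup>2 * \<epsilon>\<^sup>2" if a: "a \<in> I" for a
  proof -
    have pos: "0 \<le> 3 * K\<^sup>2 * \<epsilon>\<^sup>2" by simp
    consider "a \<notin> I1" | "a = a0" | "b = b0" | "a \<in> I1" "a \<noteq> a0" "b \<noteq> b0" by blast
    then show ?thesis
    proof cases
      case 1
      then show ?thesis unfolding x using M_block[OF a b] M_block[OF a base'(2)] True base pos by auto
    next
      case 2
      then show ?thesis unfolding x using nz pos by simp
    next
      case 3
      then show ?thesis unfolding x using nz pos by simp
    next
      case 4
      have "cmod (M a b - M a0 b / M a0 b0 * M a b0) \<le>
          cmod (M a b) + cmod (M a0 b) * cmod (M a b0) / cmod (M a0 b0)"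
        by (rule order_trans[OF norm_triangle_ineq4]) (simp add: norm_mult norm_divide)
      also have "cmod (M a b) \<le> K * \<epsilon>\<^sup>2" using M_inner 4 True by blast
      also have "cmod (M a0 b) * cmod (M a b0) / cmod (M a0 b0) \<le> (K * \<epsilon>) * (K * \<epsilon>) / (1 / 2)"
        using M_small[OF base'(1) b] M_small[OF a base'(2)] 4 M_base K \<epsilon>
        by (intro frac_le mult_mono mult_nonneg_nonneg) auto
      also have "K * \<epsilon>\<^sup>2 + (K * \<epsilon>) * (K * \<epsilon>) / (1 / 2) \<le> K\<^sup>2 * \<epsilon>\<^sup>2 + 2 * (K\<^sup>2 * \<epsilon>\<^sup>2)"
        using K_powers(2) by (intro add_mono mult_right_mono) (auto simp: power2_eq_square)
      finally show ?thesis unfolding x by simp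
    qed
  qed
  then show ?thesis
    unfolding deficit_def
    by (intro order_trans[OF best_approximation[OF finL(2) w_orthonormal, of _ \<alpha>]] sqnorm_le fin) auto
next
  case False
  define \<alpha> where "\<alpha> l = (case l of None \<Rightarrow> 0 | Some k \<Rightarrow> of_real \<epsilon> * ip X (f k) (\<lambda>a. of_real (C a b)))"
    for l :: "nat option"
  have x: "(\<Sum>l\<in>L. \<alpha> l * w l a) = of_real (\<epsilon> * C a b)" if "a \<in> I" for a
    unfolding sum_L using C_expansion[OF that b]
    by (simp add: \<alpha>_def sum_distrib_left[symmetric] mult.assoc)
  have "cmod (M a b - (\<Sum>l\<in>L. \<alpha> l * w l a)) \<le> 3 * K\<^sup>2 * \<epsilon>\<^sup>2" if a: "a \<in> I" for a
  proof (cases "a \<in> I1")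
    case True
    then have "C a b = 0" using C_supp[OF a b] sub by blast
    then show ?thesis using True M_block[OF a b] False unfolding x[OF a] by simp
  next
    case a1: False
    have "cmod (M a b - of_real (\<epsilon> * C a b)) \<le> K * \<epsilon>\<^sup>2"
      using M_outer a a1 b False by blast
    also have "\<dots> \<le> (3 * K\<^sup>2) * \<epsilon>\<^sup>2" using K_powers by (intro mult_right_mono) auto
    finally show ?thesis unfolding x[OF a] .
  qed
  then show ?thesis
    unfolding deficit_def
    by (intro order_trans[OF best_approximation[OF finL(2) w_orthonormal, of _ \<alpha>]] sqnorm_le fin) auto
qed

lemma deficit_sum_le:
  assumes "J' \<subseteq> J"
  shows "(\<Sum>b\<in>J'. deficit b) \<le> 9 * n * m * K ^ 4 * \<epsilon> ^ 4"
proof -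
  have "(\<Sum>b\<in>J'. deficit b) \<le> (\<Sum>b\<in>J. deficit b)"
    using assms fin deficit_nonneg by (intro sum_mono2) auto
  also have "\<dots> \<le> m * (n * (3 * K\<^sup>2 * \<epsilon>\<^sup>2)\<^sup>2)"
    using deficit_le by (intro sum_bounded_above) auto
  finally show ?thesis by (simp add: power_mult_distrib flip: power_mult) (simp add: mult_ac)
qed

section \<open>Weights inside and outside of the orthonormal system\<close>

definition R :: real where "R = 1 - sum \<mu> L"

lemma R_eq: "R = (\<Sum>b\<in>J. deficit b)"
proof -
  have "(\<Sum>b\<in>J. sqnorm I (\<lambda>a. M a b)) = 1"
    unfolding sqnorm_def M_norm[symmetric] by (rule sum.swap)
  moreover have "(\<Sum>b\<in>J. \<Sum>l\<in>L. (cmod (ip I (w l) (\<lambda>a. M a b)))\<^sup>2) = sum \<mu> L"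
    unfolding \<mu>_def by (rule sum.swap)
  ultimately show ?thesis unfolding R_def deficit_def by (simp add: sum_subtractf)
qed

lemma R_bounds: "0 \<le> R" "R \<le> 9 * n * m * K ^ 4 * \<epsilon> ^ 4"
  unfolding R_eq using deficit_sum_le[of J] by (auto simp: sum_nonneg deficit_nonneg)

text \<open>This weight is what the logarithm of \<epsilon> multiplies in the sum of the tangents,
  so it is needed up to order \<open>\<epsilon>^4\<close>.\<close>

definition Z :: real where "Z = (\<Sum>k\<in>kset. \<mu> (Some k))"

text \<open>Columns in J1 are orthogonal to the eigenvectors of \<open>C C^T\<close>, all other
  columns to \<open>w None\<close>. This expresses Z by column norms and deficits, avoiding the
  cruder bound on each single \<open>\<mu> (Some k)\<close>.\<close>

lemma Z_eq: "Z = (\<Sum>b\<in>J - J1. sqnorm I (\<lambda>a. M a b) - deficit b)"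
proof -
  have "(\<Sum>k\<in>kset. (cmod (ip I (w (Some k)) (\<lambda>a. M a b)))\<^sup>2) =
      (if b \<in> J1 then 0 else sqnorm I (\<lambda>a. M a b) - deficit b)" if b: "b \<in> J" for b
  proof (cases "b \<in> J1")
    case True
    have "ip I (w (Some k)) (\<lambda>a. M a b) = 0" for k
      unfolding ip_Some unfolding ip_def using M_block[OF _ b] True sub by (intro sum.neutral) auto
    then show ?thesis using True by simp
  next
    case False
    have "cnj (w None a) * M a b = 0" if "a \<in> I" for a
      using M_block[OF that b] w_outside(1)[of a] that False by (cases "a \<in> I1") auto
    then have "ip I (w None) (\<lambda>a. M a b) = 0"
      unfolding ip_def by (intro sum.neutral) auto
    then show ?thesis using False unfolding deficit_def sum_L by simp
  qed
  then have "Z = (\<Sum>b\<in>J. if b \<in> J1 then 0 else sqnorm I (\<lambda>a. M a b) - deficit b)"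
    unfolding Z_def \<mu>_def by (subst sum.swap) (rule sum.cong, auto)
  then show ?thesis using fin by (simp add: sum.If_cases Diff_eq)
qed

text \<open>Where C vanishes, M is of order \<open>\<epsilon>^2\<close> and its square of order
  \<open>\<epsilon>^4\<close>. Where C does not vanish, the difference of squares is an error of
  order \<open>\<epsilon>^3\<close> times a sum of order \<epsilon>; an error of order
  \<open>\<epsilon>^2\<close> would leave \<open>\<epsilon>^3\<close> here, and then a
  logarithm.\<close>

lemma outer_weight:
  "\<bar>(\<Sum>b\<in>J - J1. sqnorm I (\<lambda>a. M a b)) - \<epsilon>\<^sup>2 * \<beta>\<bar> \<le> 2 * n * m * K ^ 4 * \<epsilon> ^ 4"
proof -
  have \<beta>: "\<beta> = (\<Sum>b\<in>J - J1. \<Sum>a\<in>I. (C a b)\<^sup>2)"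
    unfolding \<beta>_def using fin C_supp
    by (subst sum.swap, intro sum.mono_neutral_right) (auto intro!: sum.neutral)
  have "(\<Sum>b\<in>J - J1. sqnorm I (\<lambda>a. M a b)) - \<epsilon>\<^sup>2 * \<beta> =
      (\<Sum>b\<in>J - J1. \<Sum>a\<in>I. (cmod (M a b))\<^sup>2 - \<epsilon>\<^sup>2 * (C a b)\<^sup>2)"
    unfolding \<beta> sqnorm_def by (simp add: sum_subtractf sum_distrib_left)
  also have "\<bar>\<dots>\<bar> \<le> (\<Sum>b\<in>J - J1. \<Sum>a\<in>I. \<bar>(cmod (M a b))\<^sup>2 - \<epsilon>\<^sup>2 * (C a b)\<^sup>2\<bar>)"
    by (intro order_trans[OF sum_abs] sum_mono sum_abs)
  also have "\<dots> \<le> (\<Sum>b\<in>J - J1. \<Sum>a\<in>I. 2 * K ^ 4 * \<epsilon> ^ 4)"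
  proof (intro sum_mono)
    fix a b assume b: "b \<in> J - J1" and a: "a \<in> I"
    have "0 \<le> 2 * K ^ 4 * \<epsilon> ^ 4" by simp
    show "\<bar>(cmod (M a b))\<^sup>2 - \<epsilon>\<^sup>2 * (C a b)\<^sup>2\<bar> \<le> 2 * K ^ 4 * \<epsilon> ^ 4"
    proof (cases "a \<in> I1")
      case True
      then have "C a b = 0" "M a b = 0" using C_supp[of a b] M_block[of a b] a b sub by auto
      then show ?thesis by simp
    next
      case a1: False
      show ?thesis
      proof (cases "C a b = 0")
        case True
        then have "cmod (M a b) \<le> K * \<epsilon>\<^sup>2" using M_outer[of a b] a b a1 by simp
        then have "(cmod (M a b))\<^sup>2 \<le> (K * \<epsilon>\<^sup>2)\<^sup>2" by (intro power_mono) auto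
        also have "\<dots> = K\<^sup>2 * \<epsilon> ^ 4" by (simp add: power_mult_distrib flip: power_mult)
        also have "\<dots> \<le> (2 * K ^ 4) * \<epsilon> ^ 4" using K_powers by (intro mult_right_mono) auto
        finally show ?thesis using True by simp
      next
        case False
        let ?x = "\<epsilon> * \<bar>C a b\<bar>"
        have cx: "cmod (of_real (\<epsilon> * C a b)) = ?x" using \<epsilon> by (simp add: norm_mult)
        have "\<bar>cmod (M a b) - ?x\<bar> \<le> K * \<epsilon> ^ 3"
          using M_first[of a b] a b False norm_triangle_ineq3[of "M a b" "of_real (\<epsilon> * C a b)"]
          unfolding cx by simp
        moreover have "cmod (M a b) + ?x \<le> K * \<epsilon> + K * \<epsilon>"
        proof -
          have "?x \<le> \<epsilon> * K" using \<epsilon> K C_le[of a b] by (intro mult_left_mono) auto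
          moreover have "cmod (M a b) \<le> K * \<epsilon>" using M_small[of a b] a b a1 base by auto
          ultimately show ?thesis by (simp add: mult.commute)
        qed
        ultimately have "\<bar>cmod (M a b) - ?x\<bar> * (cmod (M a b) + ?x) \<le> (K * \<epsilon> ^ 3) * (K * \<epsilon> + K * \<epsilon>)"
          using K \<epsilon> by (intro mult_mono) auto
        moreover have "\<bar>cmod (M a b) - ?x\<bar> * (cmod (M a b) + ?x) = \<bar>(cmod (M a b))\<^sup>2 - \<epsilon>\<^sup>2 * (C a b)\<^sup>2\<bar>"
        proof -
          have "(cmod (M a b))\<^sup>2 - \<epsilon>\<^sup>2 * (C a b)\<^sup>2 = (cmod (M a b) - ?x) * (cmod (M a b) + ?x)"
            by (simp add: power2_eq_square algebra_simps abs_mult_self_eq flip: abs_mult)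
          moreover have "0 \<le> cmod (M a b) + ?x" using \<epsilon> by simp
          ultimately show ?thesis by (simp add: abs_mult)
        qed
        moreover have "(K * \<epsilon> ^ 3) * (K * \<epsilon> + K * \<epsilon>) = 2 * K\<^sup>2 * \<epsilon> ^ 4"
          by (simp add: power2_eq_square power3_eq_cube power4_eq_xxxx)
        moreover have "2 * K\<^sup>2 * \<epsilon> ^ 4 \<le> 2 * K ^ 4 * \<epsilon> ^ 4"
          using K_powers by (intro mult_right_mono) auto
        ultimately show ?thesis by simp
      qed
    qed
  qed
  also have "\<dots> = card (J - J1) * n * (2 * K ^ 4 * \<epsilon> ^ 4)" by simp
  also have "\<dots> \<le> m * n * (2 * K ^ 4 * \<epsilon> ^ 4)"
    using fin by (intro mult_right_mono) (auto intro: card_mono)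
  finally show ?thesis by (simp add: mult_ac)
qed

lemma Z_bound: "\<bar>Z - \<epsilon>\<^sup>2 * \<beta>\<bar> \<le> 11 * n * m * K ^ 4 * \<epsilon> ^ 4"
proof -
  have "Z = (\<Sum>b\<in>J - J1. sqnorm I (\<lambda>a. M a b)) - (\<Sum>b\<in>J - J1. deficit b)"
    unfolding Z_eq by (simp add: sum_subtractf)
  moreover have "0 \<le> (\<Sum>b\<in>J - J1. deficit b)" by (simp add: sum_nonneg deficit_nonneg)
  ultimately show ?thesis using outer_weight deficit_sum_le[of "J - J1"] by (auto simp: abs_le_iff)
qed

text \<open>Applying \<open>M M^*\<close> to \<open>w None\<close>, the column of b0 contributes
  exactly \<open>s w\<close>, and each other column a product of two factors of order \<epsilon>.
  The defect \<open>1 - s\<close> is the weight of the other columns, again of order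
  \<open>\<epsilon>^2\<close>.\<close>

lemma residual_None:
  assumes a: "a \<in> I"
  shows "cmod (residual None a) \<le> 2 * n * m * K\<^sup>2 * \<epsilon>\<^sup>2"
proof -
  let ?w = "w None"
  have Mb0: "M a' b0 = of_real (sqrt s) * ?w a'" for a'
    unfolding w_def using s_pos by simp
  have "(\<Sum>b\<in>I. H a b * ?w b) = (\<Sum>b\<in>J. M a b * ip I (\<lambda>a'. M a' b) ?w)"
    unfolding H_def ip_def sum_distrib_left sum_distrib_right
    by (subst sum.swap) (simp add: mult.assoc)
  also have "\<dots> = M a b0 * ip I (\<lambda>a'. M a' b0) ?w + (\<Sum>b\<in>J - {b0}. M a b * ip I (\<lambda>a'. M a' b) ?w)"
    using fin base' by (subst sum.remove[of _ b0]) auto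
  also have "ip I (\<lambda>a'. M a' b0) ?w = of_real (sqrt s)"
  proof -
    have "ip I (\<lambda>a'. M a' b0) ?w = cnj (ip I ?w (\<lambda>a'. of_real (sqrt s) * ?w a'))"
      unfolding ip_cnj Mb0 ..
    also have "\<dots> = of_real (sqrt s)"
      unfolding ip_scale_right ip_self sqnorm_orthonormal[OF w_orthonormal, of None, unfolded L_def, simplified]
      by simp
    finally show ?thesis .
  qed
  also have "M a b0 * of_real (sqrt s) = of_real s * ?w a"
    unfolding Mb0 using s_pos by (simp flip: of_real_mult)
  finally have eq: "residual None a = of_real (s - 1) * ?w a + (\<Sum>b\<in>J - {b0}. M a b * ip I (\<lambda>a'. M a' b) ?w)"
    unfolding residual_def e_def by (simp add: algebra_simps)
  have w1: "cmod (?w a') \<le> 1" if "a' \<in> I" for a' using w_le_1[of None a'] that unfolding L_def by simp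
  have K\<epsilon>: "0 \<le> K * \<epsilon>" using K \<epsilon> by simp
  have small: "cmod (M a' b) \<le> K * \<epsilon>" if "b \<in> J - {b0}" "a' \<in> I" for a' b
    using M_small[of a' b] that by auto
  have "\<bar>s - 1\<bar> \<le> n * m * K\<^sup>2 * \<epsilon>\<^sup>2"
  proof -
    have "(\<Sum>b\<in>J. sqnorm I (\<lambda>a. M a b)) = 1"
      unfolding sqnorm_def M_norm[symmetric] by (rule sum.swap)
    then have "s + (\<Sum>b\<in>J - {b0}. sqnorm I (\<lambda>a. M a b)) = 1"
      unfolding s_def using fin base' by (subst (asm) sum.remove[of _ b0]) auto
    moreover have "0 \<le> (\<Sum>b\<in>J - {b0}. sqnorm I (\<lambda>a. M a b))" by (simp add: sum_nonneg sqnorm_nonneg)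
    moreover have "(\<Sum>b\<in>J - {b0}. sqnorm I (\<lambda>a. M a b)) \<le> card (J - {b0}) * (n * (K * \<epsilon>)\<^sup>2)"
      using small K\<epsilon> fin by (intro sum_bounded_above sqnorm_le) auto
    moreover have "card (J - {b0}) * (n * (K * \<epsilon>)\<^sup>2) \<le> m * (n * (K * \<epsilon>)\<^sup>2)"
      using fin by (intro mult_right_mono) (auto intro: card_mono)
    ultimately show ?thesis by (simp add: power_mult_distrib mult_ac)
  qed
  then have 1: "cmod (of_real (s - 1) * ?w a) \<le> (n * m * K\<^sup>2 * \<epsilon>\<^sup>2) * 1"
    unfolding norm_mult norm_of_real using w1[OF a] by (intro mult_mono) auto
  have "cmod (\<Sum>b\<in>J - {b0}. M a b * ip I (\<lambda>a'. M a' b) ?w) \<le> card (J - {b0}) * ((K * \<epsilon>) * (n * (K * \<epsilon>)))"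
  proof (rule sum_cmod_le)
    fix b assume b: "b \<in> J - {b0}"
    have "cmod (ip I (\<lambda>a'. M a' b) ?w) \<le> n * (K * \<epsilon> * 1)"
      unfolding ip_def
    proof (rule sum_cmod_le)
      fix a' assume "a' \<in> I"
      then show "cmod (cnj (M a' b) * ?w a') \<le> K * \<epsilon> * 1"
        unfolding norm_mult complex_mod_cnj using small[OF b] w1 K\<epsilon> by (intro mult_mono) auto
    qed
    then show "cmod (M a b * ip I (\<lambda>a'. M a' b) ?w) \<le> (K * \<epsilon>) * (n * (K * \<epsilon>))"
      unfolding norm_mult using small[OF b a] K\<epsilon> by (intro mult_mono) auto
  qed
  also have "\<dots> \<le> m * ((K * \<epsilon>) * (n * (K * \<epsilon>)))"
    using fin K \<epsilon> by (intro mult_right_mono mult_nonneg_nonneg) (auto intro: card_mono)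
  finally have 2: "cmod (\<Sum>b\<in>J - {b0}. M a b * ip I (\<lambda>a'. M a' b) ?w) \<le> m * ((K * \<epsilon>) * (n * (K * \<epsilon>)))" .
  show ?thesis
    unfolding eq by (rule order_trans[OF norm_triangle_ineq]) (use 1 2 in \<open>simp add: power2_eq_square mult_ac\<close>)
qed

text \<open>The vector is an exact eigenvector of \<open>\<epsilon>^2 C C^T\<close>, so only
  \<open>M M^* - \<epsilon>^2 C C^T\<close> acts on it. Telescoping each product leaves one factor
  of order \<epsilon> and one error of order \<open>\<epsilon>^2\<close>.\<close>

lemma residual_Some:
  assumes k: "k \<in> kset" and a: "a \<in> I"
  shows "cmod (residual (Some k) a) \<le> 2 * n * m * K\<^sup>2 * \<epsilon> ^ 3"
proof -
  let ?G = "\<lambda>a a'. \<Sum>b\<in>J. C a b * C a' b"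
  have kX: "k < card X" using k unfolding kset_def by simp
  have "(\<Sum>a'\<in>X. of_real (?G a a') * f k a') = of_real (c k) * w (Some k) a"
  proof (cases "a \<in> X")
    case True
    have "(\<Sum>a'\<in>X. of_real (?G a a') * f k a') = (\<Sum>j<card X. of_real (c j) * ip X (f j) (f k) * f j a)"
      by (rule eigenbasis_apply[OF f True])
    also have "\<dots> = (\<Sum>j<card X. if j = k then of_real (c k) * f k a else 0)"
      using eigenbasis_orthonormal[OF f] kX by (intro sum.cong) (auto simp: orthonormal_on_def)
    finally show ?thesis using True kX by (simp add: w_def)
  next
    case False
    then have "C a b = 0" if "b \<in> J" for b using C_supp[OF a that] by blast
    then show ?thesis using False by (simp add: w_def)
  qed
  then have "of_real (e (Some k)) * w (Some k) a = of_real (\<epsilon>\<^sup>2) * (\<Sum>a'\<in>X. of_real (?G a a') * f k a')"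
    by (simp only: e_def option.case of_real_mult mult.assoc)
  also have "\<dots> = (\<Sum>a'\<in>X. of_real (\<epsilon>\<^sup>2 * ?G a a') * f k a')"
    by (subst sum_distrib_left) (simp only: of_real_mult mult.assoc)
  finally have "of_real (e (Some k)) * w (Some k) a = (\<Sum>a'\<in>X. of_real (\<epsilon>\<^sup>2 * ?G a a') * f k a')" .
  moreover have "(\<Sum>a'\<in>I. H a a' * w (Some k) a') = (\<Sum>a'\<in>X. H a a' * f k a')"
    using fin XI by (intro sum.mono_neutral_cong_right) (auto simp: w_def)
  ultimately have eq: "residual (Some k) a = (\<Sum>a'\<in>X. (H a a' - of_real (\<epsilon>\<^sup>2 * ?G a a')) * f k a')"
    unfolding residual_def by (simp add: left_diff_distrib sum_subtractf)
  have "cmod (residual (Some k) a) \<le> card X * (m * (2 * K\<^sup>2 * \<epsilon> ^ 3) * 1)"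
    unfolding eq
  proof (rule sum_cmod_le)
    fix a' assume a': "a' \<in> X"
    have a'I: "a' \<in> I" "a' \<notin> I1" using a' sub by auto
    have f1: "cmod (f k a') \<le> 1"
      using w_le_1[of "Some k" a'] k a' a'I unfolding L_def w_def by simp
    have "H a a' - of_real (\<epsilon>\<^sup>2 * ?G a a') =
        (\<Sum>b\<in>J. M a b * cnj (M a' b) - of_real (\<epsilon> * C a b) * of_real (\<epsilon> * C a' b))"
      unfolding H_def by (simp add: sum_subtractf sum_distrib_left power2_eq_square mult_ac)
    also have "cmod \<dots> \<le> m * (2 * K\<^sup>2 * \<epsilon> ^ 3)"
    proof (rule sum_cmod_le)
      fix b assume b: "b \<in> J"
      have pos: "0 \<le> 2 * K\<^sup>2 * \<epsilon> ^ 3" using \<epsilon> by simp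
      let ?c = "complex_of_real (\<epsilon> * C a b)" and ?c' = "complex_of_real (\<epsilon> * C a' b)"
      consider "b \<in> J1" | "b \<notin> J1" "a \<in> I1" | "b \<notin> J1" "a \<notin> I1" by blast
      then show "cmod (M a b * cnj (M a' b) - ?c * ?c') \<le> 2 * K\<^sup>2 * \<epsilon> ^ 3"
      proof cases
        case 1
        then have "M a' b = 0" "C a b = 0" using M_block[OF a'I(1) b] a'I C_supp[OF a b] by auto
        then show ?thesis using pos by simp
      next
        case 2
        then have "M a b = 0" "C a b = 0" using M_block[OF a b] C_supp[OF a b] sub by auto
        then show ?thesis using pos by simp
      next
        case 3
        have "M a b * cnj (M a' b) - ?c * ?c' = (M a b - ?c) * cnj (M a' b) + ?c * cnj (M a' b - ?c')"
          by (simp add: algebra_simps)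
        also have "cmod \<dots> \<le> cmod (M a b - ?c) * cmod (M a' b) + cmod ?c * cmod (M a' b - ?c')"
          by (rule order_trans[OF norm_triangle_ineq])
             (simp only: norm_mult complex_mod_cnj order_refl)
        also have "\<dots> \<le> (K * \<epsilon>\<^sup>2) * (K * \<epsilon>) + \<epsilon> * (K * \<epsilon>\<^sup>2)"
        proof (intro add_mono mult_mono)
          show "cmod (M a b - ?c) \<le> K * \<epsilon>\<^sup>2" using M_outer a b 3 by blast
          show "cmod (M a' b - ?c') \<le> K * \<epsilon>\<^sup>2" using M_outer a'I b 3 by blast
          show "cmod (M a' b) \<le> K * \<epsilon>" using M_small[OF a'I(1) b] a'I base by auto
          show "cmod ?c \<le> \<epsilon>" using C_le[of a b] \<epsilon> by (simp add: norm_mult mult_left_le)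
        qed (use K \<epsilon> in auto)
        also have "\<dots> \<le> 2 * K\<^sup>2 * \<epsilon> ^ 3"
          using mult_right_mono[OF K_powers(2), of "\<epsilon> ^ 3"] \<epsilon>
          by (simp add: power2_eq_square power3_eq_cube algebra_simps)
        finally show ?thesis .
      qed
    qed
    finally show "cmod ((H a a' - of_real (\<epsilon>\<^sup>2 * ?G a a')) * f k a') \<le> m * (2 * K\<^sup>2 * \<epsilon> ^ 3) * 1"
      unfolding norm_mult using f1 \<epsilon> by (intro mult_mono) auto
  qed
  also have "\<dots> \<le> n * (m * (2 * K\<^sup>2 * \<epsilon> ^ 3) * 1)"
    using fin XI \<epsilon> by (intro mult_right_mono) (auto intro: card_mono)
  finally show ?thesis by (simp add: mult_ac)
qed

text \<open>The difference is the inner product of the unit vector with its residual. The order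
  \<open>\<epsilon>^3\<close> is enough because this bound is only combined with the fixed factor
  \<open>ln (c k)\<close>.\<close>

lemma \<mu>_Some:
  assumes k: "k \<in> kset"
  shows "\<bar>\<mu> (Some k) - \<epsilon>\<^sup>2 * c k\<bar> \<le> 2 * n\<^sup>2 * m * K\<^sup>2 * \<epsilon> ^ 3"
proof -
  let ?w = "w (Some k)"
  have kL: "Some k \<in> L" using k unfolding L_def by simp
  have "ip I ?w (residual (Some k)) = ip I ?w (\<lambda>a. \<Sum>b\<in>I. H a b * ?w b) - of_real (e (Some k)) * ip I ?w ?w"
    unfolding residual_def[abs_def] ip_diff_right ip_scale_right ..
  also have "ip I ?w (\<lambda>a. \<Sum>b\<in>I. H a b * ?w b) = of_real (\<mu> (Some k))"
    unfolding \<mu>_def by (rule gram_expectation[OF fin(1)]) (simp add: H_def)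
  also have "ip I ?w ?w = 1" using w_orthonormal kL unfolding orthonormal_on_def by simp
  finally have "complex_of_real (\<mu> (Some k) - \<epsilon>\<^sup>2 * c k) = ip I ?w (residual (Some k))"
    by (simp add: e_def)
  then have "\<bar>\<mu> (Some k) - \<epsilon>\<^sup>2 * c k\<bar> = cmod (ip I ?w (residual (Some k)))"
    by (metis norm_of_real)
  also have "\<dots> \<le> n * (1 * (2 * n * m * K\<^sup>2 * \<epsilon> ^ 3))"
    unfolding ip_def
  proof (rule sum_cmod_le)
    fix a assume "a \<in> I"
    then show "cmod (cnj (?w a) * residual (Some k) a) \<le> 1 * (2 * n * m * K\<^sup>2 * \<epsilon> ^ 3)"
      unfolding norm_mult complex_mod_cnj
      using w_le_1[OF kL] residual_Some[OF k] by (intro mult_mono) auto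
  qed
  finally show ?thesis by (simp add: power2_eq_square mult_ac)
qed

lemma variance_None: "sqnorm I (residual None) / e None \<le> 4 * n ^ 3 * m\<^sup>2 * K ^ 4 * \<epsilon> ^ 4"
proof -
  have "sqnorm I (residual None) \<le> n * (2 * n * m * K\<^sup>2 * \<epsilon>\<^sup>2)\<^sup>2"
    using residual_None fin by (intro sqnorm_le) auto
  then show ?thesis
    by (simp add: e_def power2_eq_square power3_eq_cube power4_eq_xxxx mult_ac)
qed

text \<open>A squared residual of order \<open>\<epsilon>^6\<close> over the tangent point
  \<open>\<epsilon>^2 c k\<close>, where \<open>c k\<close> does not depend on \<epsilon>.\<close>

lemma variance_Some:
  assumes k: "k \<in> kset"
  shows "sqnorm I (residual (Some k)) / e (Some k) \<le> 4 * n ^ 3 * m\<^sup>2 * K ^ 4 * \<epsilon> ^ 4 * (1 / c k)"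
proof -
  have "sqnorm I (residual (Some k)) \<le> n * (2 * n * m * K\<^sup>2 * \<epsilon> ^ 3)\<^sup>2"
    using residual_Some[OF k] fin \<epsilon> by (intro sqnorm_le) auto
  then have "sqnorm I (residual (Some k)) / e (Some k) \<le> n * (2 * n * m * K\<^sup>2 * \<epsilon> ^ 3)\<^sup>2 / e (Some k)"
    using c_pos[OF k] \<epsilon> by (intro divide_right_mono) (auto simp: e_def)
  also have "\<dots> = 4 * n ^ 3 * m\<^sup>2 * K ^ 4 * \<epsilon> ^ 4 * (1 / c k)"
    using c_pos[OF k] \<epsilon>
    by (simp add: e_def field_simps power2_eq_square power3_eq_cube power4_eq_xxxx)
  finally show ?thesis .
qed

lemma entropy_bound:
  assumes v: "eigenbasis I H v d"
  defines "S \<equiv> - (\<Sum>j<card I. d j * ln (d j))"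
  shows "\<bar>S - \<epsilon>\<^sup>2 * (\<beta> * (1 + ln (1 / \<epsilon>\<^sup>2)) - (\<Sum>k\<in>kset. c k * ln (c k)))\<bar> \<le>
    (49 * n * m * K ^ 4 + n + 2 * n\<^sup>2 * m * K\<^sup>2 * (\<Sum>k\<in>kset. \<bar>ln (c k)\<bar>)
      + 4 * n ^ 3 * m\<^sup>2 * K ^ 4 * (1 + (\<Sum>k\<in>kset. 1 / c k))) * \<epsilon> ^ 3"
proof -
  \<comment> \<open>The inequality \<open>\<epsilon> \<theta> \<le> 1\<close> converts every error
    of order \<open>\<epsilon>^4\<close> with a logarithm into one of order
    \<open>\<epsilon>^3\<close>.\<close>
  define \<theta> where "\<theta> = ln (1 / \<epsilon>)"
  have \<theta>: "0 \<le> \<theta>" "\<epsilon> * \<theta> \<le> 1"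
  proof -
    show "0 \<le> \<theta>" unfolding \<theta>_def using \<epsilon> by simp
    have "\<theta> \<le> 1 / \<epsilon> - 1" unfolding \<theta>_def using \<epsilon> by (intro ln_le_minus_one) auto
    then have "\<epsilon> * \<theta> \<le> \<epsilon> * (1 / \<epsilon> - 1)" using \<epsilon> by (intro mult_left_mono) auto
    also have "\<dots> \<le> 1" using \<epsilon> by (simp add: algebra_simps)
    finally show "\<epsilon> * \<theta> \<le> 1" .
  qed
  have ln\<epsilon>: "ln (1 / \<epsilon>\<^sup>2) = 2 * \<theta>" "ln (\<epsilon>\<^sup>2) = - 2 * \<theta>" "ln (\<epsilon> ^ 3) = - 3 * \<theta>"
    unfolding \<theta>_def using \<epsilon> by (simp_all add: ln_div ln_realpow)
  have \<epsilon>4: "\<epsilon> ^ 4 * \<theta> \<le> \<epsilon> ^ 3" "\<epsilon> ^ 4 \<le> \<epsilon> ^ 3"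
  proof -
    have "\<epsilon> ^ 3 * (\<epsilon> * \<theta>) \<le> \<epsilon> ^ 3 * 1" using \<theta> \<epsilon> by (intro mult_left_mono) auto
    then show "\<epsilon> ^ 4 * \<theta> \<le> \<epsilon> ^ 3" by (simp add: power3_eq_cube power4_eq_xxxx mult_ac)
    show "\<epsilon> ^ 4 \<le> \<epsilon> ^ 3" using \<epsilon> by (intro power_decreasing) auto
  qed
  define T where "T = (\<Sum>k\<in>kset. \<mu> (Some k) * ln (c k))"
  define T0 where "T0 = (\<Sum>k\<in>kset. c k * ln (c k))"
  define V where "V = (\<Sum>l\<in>L. sqnorm I (residual l) / e l)"
  have e_pos: "0 < e l" if "l \<in> L" for l
    using that \<epsilon> c_pos unfolding L_def e_def by auto
  \<comment> \<open>Splitting \<open>ln (\<epsilon>^2 c k)\<close> separates the divergent part,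
    which sees only the total weight Z, from T, where the logarithms are fixed.\<close>
  have sum_tangent: "(\<Sum>l\<in>L. - \<mu> l * ln (e l) - \<mu> l + e l) = R + \<epsilon>\<^sup>2 * \<beta> + 2 * \<theta> * Z - T"
  proof -
    have "(\<Sum>k\<in>kset. - \<mu> (Some k) * ln (e (Some k)) - \<mu> (Some k) + e (Some k)) =
        (\<Sum>k\<in>kset. \<mu> (Some k) * (2 * \<theta>) - \<mu> (Some k) * ln (c k) - \<mu> (Some k) + \<epsilon>\<^sup>2 * c k)"
    proof (intro sum.cong refl)
      fix k assume "k \<in> kset"
      then have "ln (e (Some k)) = - 2 * \<theta> + ln (c k)"
        using c_pos[of k] \<epsilon> unfolding ln\<epsilon>(2)[symmetric] by (simp add: e_def ln_mult)
      then show "- \<mu> (Some k) * ln (e (Some k)) - \<mu> (Some k) + e (Some k) =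
          \<mu> (Some k) * (2 * \<theta>) - \<mu> (Some k) * ln (c k) - \<mu> (Some k) + \<epsilon>\<^sup>2 * c k"
        by (simp only:) (simp add: e_def algebra_simps)
    qed
    also have "\<dots> = 2 * \<theta> * Z - T - Z + \<epsilon>\<^sup>2 * \<beta>"
      unfolding Z_def T_def c_sum[symmetric]
      by (simp add: sum.distrib sum_subtractf sum_distrib_left sum_distrib_right mult_ac)
    finally show ?thesis
      unfolding R_def sum_L Z_def[symmetric] by (simp add: e_def)
  qed
  note bounds = gram_entropy_bounds[where e = e, OF fin v H_def M_norm finL(2) w_orthonormal e_pos, folded \<mu>_def R_def S_def]
  \<comment> \<open>With \<open>\<tau> = \<epsilon>^3\<close> the remainder costs
    \<open>n \<epsilon>^3\<close> plus \<open>3 R \<theta>\<close>, and R is of order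
    \<open>\<epsilon>^4\<close>.\<close>
  have upper: "S \<le> R + \<epsilon>\<^sup>2 * \<beta> + 2 * \<theta> * Z - T + (3 * R * \<theta> - R + n * \<epsilon> ^ 3)"
    using bounds(1)[where \<tau> = "\<epsilon> ^ 3"] \<epsilon> unfolding sum_tangent ln\<epsilon> by simp
  have lower: "R + \<epsilon>\<^sup>2 * \<beta> + 2 * \<theta> * Z - T - V \<le> S"
    using bounds(2)[where \<tau> = 1] sum_tangent unfolding V_def residual_def[abs_def]
    by (simp only: sum_subtractf zero_less_one)
  have T: "\<bar>T - \<epsilon>\<^sup>2 * T0\<bar> \<le> 2 * n\<^sup>2 * m * K\<^sup>2 * (\<Sum>k\<in>kset. \<bar>ln (c k)\<bar>) * \<epsilon> ^ 3"
  proof -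
    have "T - \<epsilon>\<^sup>2 * T0 = (\<Sum>k\<in>kset. (\<mu> (Some k) - \<epsilon>\<^sup>2 * c k) * ln (c k))"
      unfolding T_def T0_def by (simp add: left_diff_distrib sum_subtractf sum_distrib_left mult.assoc)
    also have "\<bar>\<dots>\<bar> \<le> (\<Sum>k\<in>kset. (2 * n\<^sup>2 * m * K\<^sup>2 * \<epsilon> ^ 3) * \<bar>ln (c k)\<bar>)"
      using \<mu>_Some by (intro order_trans[OF sum_abs] sum_mono) (auto simp: abs_mult intro!: mult_right_mono)
    finally show ?thesis by (simp add: sum_distrib_left mult_ac)
  qed
  have V: "V \<le> 4 * n ^ 3 * m\<^sup>2 * K ^ 4 * (1 + (\<Sum>k\<in>kset. 1 / c k)) * \<epsilon> ^ 3"
  proof -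
    have "V \<le> 4 * n ^ 3 * m\<^sup>2 * K ^ 4 * \<epsilon> ^ 4 + (\<Sum>k\<in>kset. 4 * n ^ 3 * m\<^sup>2 * K ^ 4 * \<epsilon> ^ 4 * (1 / c k))"
      unfolding V_def sum_L using variance_None variance_Some by (intro add_mono sum_mono) auto
    also have "\<dots> = 4 * n ^ 3 * m\<^sup>2 * K ^ 4 * (1 + (\<Sum>k\<in>kset. 1 / c k)) * \<epsilon> ^ 4"
      by (simp only: sum_distrib_left[symmetric]) (simp add: algebra_simps)
    also have "\<dots> \<le> 4 * n ^ 3 * m\<^sup>2 * K ^ 4 * (1 + (\<Sum>k\<in>kset. 1 / c k)) * \<epsilon> ^ 3"
      using \<epsilon>4 c_pos K
      by (intro mult_left_mono mult_nonneg_nonneg add_nonneg_nonneg sum_nonneg) (auto intro: less_imp_le)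
    finally show ?thesis .
  qed
  have scale: "x * \<theta> \<le> N * \<epsilon> ^ 3" if "x \<le> N * \<epsilon> ^ 4" "0 \<le> N" for x N
  proof -
    have "x * \<theta> \<le> N * \<epsilon> ^ 4 * \<theta>" using that \<theta> by (intro mult_right_mono) auto
    also have "\<dots> \<le> N * \<epsilon> ^ 3" using mult_left_mono[OF \<epsilon>4(1) that(2)] by (simp add: mult.assoc)
    finally show ?thesis .
  qed
  have Z: "\<bar>2 * \<theta> * Z - 2 * \<theta> * (\<epsilon>\<^sup>2 * \<beta>)\<bar> \<le> 22 * n * m * K ^ 4 * \<epsilon> ^ 3"
  proof -
    have "\<bar>2 * \<theta> * Z - 2 * \<theta> * (\<epsilon>\<^sup>2 * \<beta>)\<bar> = 2 * (\<bar>Z - \<epsilon>\<^sup>2 * \<beta>\<bar> * \<theta>)"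
      using \<theta> by (simp add: abs_mult flip: right_diff_distrib)
    also have "\<dots> \<le> 2 * (11 * n * m * K ^ 4 * \<epsilon> ^ 3)"
      using scale[OF Z_bound] K by (intro mult_left_mono) auto
    finally show ?thesis by simp
  qed
  have R: "R * \<theta> \<le> 9 * n * m * K ^ 4 * \<epsilon> ^ 3"
    using scale[OF R_bounds(2)] K by simp
  define A1 where "A1 = n * m * K ^ 4 * \<epsilon> ^ 3"
  define A2 where "A2 = 2 * n\<^sup>2 * m * K\<^sup>2 * (\<Sum>k\<in>kset. \<bar>ln (c k)\<bar>) * \<epsilon> ^ 3"
  define A3 where "A3 = 4 * n ^ 3 * m\<^sup>2 * K ^ 4 * (1 + (\<Sum>k\<in>kset. 1 / c k)) * \<epsilon> ^ 3"
  have nn: "0 \<le> A1" "0 \<le> n * \<epsilon> ^ 3" "0 \<le> A3" "0 \<le> R"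
    unfolding A1_def A3_def using \<epsilon> K c_pos R_bounds(1)
    by (auto intro!: mult_nonneg_nonneg add_nonneg_nonneg sum_nonneg intro: less_imp_le)
  have target: "\<epsilon>\<^sup>2 * (\<beta> * (1 + ln (1 / \<epsilon>\<^sup>2)) - T0) = \<epsilon>\<^sup>2 * \<beta> + 2 * \<theta> * (\<epsilon>\<^sup>2 * \<beta>) - \<epsilon>\<^sup>2 * T0"
    unfolding ln\<epsilon> by (simp add: algebra_simps)
  \<comment> \<open>The factor 49 is 22 from the error of Z plus 3 times 9 from
    \<open>3 R \<theta>\<close>.\<close>
  have rhs: "(49 * n * m * K ^ 4 + n + 2 * n\<^sup>2 * m * K\<^sup>2 * (\<Sum>k\<in>kset. \<bar>ln (c k)\<bar>)
      + 4 * n ^ 3 * m\<^sup>2 * K ^ 4 * (1 + (\<Sum>k\<in>kset. 1 / c k))) * \<epsilon> ^ 3 = 49 * A1 + n * \<epsilon> ^ 3 + A2 + A3"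
    unfolding A1_def A2_def A3_def by (simp add: distrib_right)
  have "R * \<theta> \<le> 9 * A1" "V \<le> A3" "\<bar>T - \<epsilon>\<^sup>2 * T0\<bar> \<le> A2"
    "\<bar>2 * \<theta> * Z - 2 * \<theta> * (\<epsilon>\<^sup>2 * \<beta>)\<bar> \<le> 22 * A1"
    using R V T Z unfolding A1_def A2_def A3_def by (simp_all add: mult.assoc)
  then show ?thesis
    unfolding T0_def[symmetric] target rhs using upper lower nn
    by (simp only: abs_le_iff mult.assoc) linarith
qed

end

section \<open>Hopping on the ring\<close>

definition filled :: "nat set \<Rightarrow> occ" where
  "filled S = (\<lambda>i. if i \<in> S then 1 else 0)"

text \<open>On amplitudes the operators act backwards: the operator that moves a particle from j to
  i reads \<psi> at the state where one particle of n is moved from i to j. If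
  \<open>n i = 0\<close>, the truncated subtraction does no harm because \<open>hop_coeff\<close> is
  0.\<close>

definition hop :: "nat \<Rightarrow> nat \<Rightarrow> occ \<Rightarrow> occ" where
  "hop i j n = n(i := n i - 1, j := n j + 1)"

definition hop_coeff :: "nat \<Rightarrow> nat \<Rightarrow> occ \<Rightarrow> real" where
  "hop_coeff i j n = sqrt (real (n i)) * sqrt (real (n j + 1))"

definition links :: "nat \<Rightarrow> (nat \<times> nat) set" where
  "links Ns = (\<lambda>i. (i, next_site Ns i)) ` sites Ns \<union> (\<lambda>i. (next_site Ns i, i)) ` sites Ns"

definition onsite :: "nat \<Rightarrow> real \<Rightarrow> occ \<Rightarrow> real" where
  "onsite Ns U n = U / 2 * (\<Sum>i\<in>sites Ns. real (n i) * (real (n i) - 1))"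

definition pair_state :: "nat \<Rightarrow> nat \<Rightarrow> nat \<Rightarrow> occ" where
  "pair_state Ns i j = (filled (sites Ns))(i := 2, j := 0)"

section \<open>Occupation numbers and oriented links of the ring\<close>

lemma finite_sites [simp]: "finite (sites Ns)" "card (sites Ns) = Ns"
  unfolding sites_def by auto

lemma finite_occupations:
  assumes "finite S"
  shows "finite (occupations S N)"
proof (rule finite_subset)
  show "occupations S N \<subseteq> {n. \<forall>i. (i \<in> S \<longrightarrow> n i \<in> {..N}) \<and> (i \<notin> S \<longrightarrow> n i = 0)}"
    unfolding occupations_def using member_le_sum[of _ S] assms by fastforce
  show "finite {n. \<forall>i. (i \<in> S \<longrightarrow> n i \<in> {..N}) \<and> (i \<notin> S \<longrightarrow> n i = (0::nat))}"
    using assms by (intro finite_set_of_finite_funs) auto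
qed

lemma occupations_le:
  assumes "n \<in> occupations S N" "finite S"
  shows "n i \<le> N"
  using assms member_le_sum[of i S n] unfolding occupations_def by (cases "i \<in> S") auto

lemma filled_occupations: "finite S \<Longrightarrow> filled S \<in> occupations S (card S)"
  unfolding occupations_def filled_def by auto

lemma next_site_cases:
  assumes "i \<in> sites Ns"
  obtains "i < Ns" "next_site Ns i = i + 1" | "i = Ns" "next_site Ns i = 1"
  using assms unfolding sites_def next_site_def by (cases "i < Ns") auto

lemma next_site_in:
  assumes "i \<in> sites Ns"
  shows "next_site Ns i \<in> sites Ns"
  by (rule next_site_cases[OF assms]) (use assms in \<open>auto simp: sites_def\<close>)

lemma next_next_site:
  assumes "i \<in> sites Ns" "3 \<le> Ns"
  shows "next_site Ns (next_site Ns i) \<noteq> i"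
  by (rule next_site_cases[OF assms(1)]; rule next_site_cases[OF next_site_in[OF assms(1)]])
    (use assms in \<open>auto simp: sites_def\<close>)

lemma links_sites:
  assumes "(i, j) \<in> links Ns" "2 \<le> Ns"
  shows "i \<in> sites Ns" "j \<in> sites Ns" "i \<noteq> j"
proof -
  have "next_site Ns k \<noteq> k" if "k \<in> sites Ns" for k
    by (rule next_site_cases[OF that]) (use assms(2) in auto)
  then show "i \<in> sites Ns" "j \<in> sites Ns" "i \<noteq> j"
    using assms(1) next_site_in unfolding links_def by fastforce+
qed

lemma links_sym: "(i, j) \<in> links Ns \<longleftrightarrow> (j, i) \<in> links Ns"
  unfolding links_def by auto

lemma links_parity:
  assumes "(i, j) \<in> links Ns" "even Ns"
  shows "even i \<longleftrightarrow> odd j"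
proof -
  have "even k \<longleftrightarrow> odd (next_site Ns k)" if "k \<in> sites Ns" for k
    by (rule next_site_cases[OF that]) (use assms(2) in auto)
  then show ?thesis using assms(1) unfolding links_def by auto
qed

lemma finite_links [simp]: "finite (links Ns)"
  unfolding links_def by auto

lemma card_links: "card (links Ns) \<le> 2 * Ns"
proof -
  have "card (g ` sites Ns) \<le> Ns" for g :: "nat \<Rightarrow> nat \<times> nat"
    using card_image_le[of "sites Ns" g] by simp
  then show ?thesis
    unfolding links_def mult_2 by (intro order_trans[OF card_Un_le] add_mono)
qed

text \<open>From three sites on, no ordered pair arises from both orientations, so the oriented
  links match the hopping terms and their Hermitian conjugates one to one.\<close>

lemma sum_links:
  assumes "3 \<le> Ns"
  shows "(\<Sum>(i, j)\<in>links Ns. g i j) = (\<Sum>i\<in>sites Ns. g i (next_site Ns i) + g (next_site Ns i) i)"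
proof -
  have "(\<Sum>(i, j)\<in>links Ns. g i j) =
      (\<Sum>(i, j)\<in>(\<lambda>i. (i, next_site Ns i)) ` sites Ns. g i j) + (\<Sum>(i, j)\<in>(\<lambda>i. (next_site Ns i, i)) ` sites Ns. g i j)"
    unfolding links_def using next_next_site[OF _ assms] by (intro sum.union_disjoint) auto
  also have "\<dots> = (\<Sum>i\<in>sites Ns. g i (next_site Ns i)) + (\<Sum>i\<in>sites Ns. g (next_site Ns i) i)"
    by (subst (1 2) sum.reindex) (auto intro: inj_onI)
  finally show ?thesis by (simp add: sum.distrib)
qed

lemma create_annihilate:
  "i \<noteq> j \<Longrightarrow> create i (annihilate j \<psi>) n = of_real (hop_coeff i j n) * \<psi> (hop i j n)"
  unfolding create_def annihilate_def hop_coeff_def hop_def by simp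

lemma number_eq: "number i \<psi> n = of_nat (n i) * \<psi> n"
proof (cases "n i = 0")
  case False
  then have "complex_of_real (sqrt (real (n i))) * complex_of_real (sqrt (real (n i))) = of_nat (n i)"
    by (simp flip: of_real_mult)
  then show ?thesis
    using False unfolding number_def create_def annihilate_def by (simp flip: mult.assoc)
qed (simp add: number_def create_def)

lemma bose_hubbard_eq:
  assumes "3 \<le> Ns"
  shows "bose_hubbard Ns t U \<psi> n =
    - of_real t * (\<Sum>(i, j)\<in>links Ns. of_real (hop_coeff i j n) * \<psi> (hop i j n)) + of_real (onsite Ns U n) * \<psi> n"
proof -
  have "(\<Sum>(i, j)\<in>links Ns. of_real (hop_coeff i j n) * \<psi> (hop i j n)) =
      (\<Sum>(i, j)\<in>links Ns. create i (annihilate j \<psi>) n)"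
    using links_sites assms by (intro sum.cong) (auto simp: create_annihilate)
  moreover have "complex_of_real (U / 2) * (\<Sum>i\<in>sites Ns. number i (\<lambda>m. number i \<psi> m - \<psi> m) n) =
      of_real (onsite Ns U n) * \<psi> n"
    unfolding onsite_def number_eq by (simp add: sum_distrib_right sum_distrib_left algebra_simps)
  ultimately show ?thesis unfolding bose_hubbard_def sum_links[OF assms] by simp
qed

lemma hop_hop:
  assumes "i \<noteq> j" "1 \<le> n i"
  shows "hop j i (hop i j n) = n" "hop_coeff j i (hop i j n) = hop_coeff i j n" "1 \<le> hop i j n j"
  using assms unfolding hop_def hop_coeff_def by auto

lemma hop_coeff_zero: "n i = 0 \<Longrightarrow> hop_coeff i j n = 0"
  unfolding hop_coeff_def by simp

lemma hop_occupations:
  assumes "i \<in> S" "j \<in> S" "i \<noteq> j" "1 \<le> n i" "finite S"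
  shows "hop i j n \<in> occupations S N \<longleftrightarrow> n \<in> occupations S N"
proof -
  have *: "hop i j n \<in> occupations S N"
    if "n \<in> occupations S N" "i \<in> S" "j \<in> S" "i \<noteq> j" "1 \<le> n i" for i j n
  proof -
    have split: "sum m S = m i + (m j + sum m (S - {i} - {j}))" for m :: occ
      using that assms(5) sum.remove[of S i m] sum.remove[of "S - {i}" j m] by auto
    have "(\<Sum>k\<in>S. hop i j n k) = hop i j n i + (hop i j n j + (\<Sum>k\<in>S - {i} - {j}. hop i j n k))"
      by (rule split)
    also have "\<dots> = n i + (n j + (\<Sum>k\<in>S - {i} - {j}. n k))"
      using that by (simp add: hop_def)
    also have "\<dots> = (\<Sum>k\<in>S. n k)" by (rule split[symmetric])
    finally show ?thesis using that unfolding occupations_def by (auto simp: hop_def)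
  qed
  show ?thesis
    using *[of n i j] *[of "hop i j n" j i] hop_hop[of i j n] assms by auto
qed

section \<open>On-site energies and the states one hop away from the filled state\<close>

lemma onsite_filled: "onsite Ns U (filled (sites Ns)) = 0"
  unfolding onsite_def filled_def by simp

text \<open>Pigeonhole: with as many particles as sites, a state other than the filled one has a
  site with at least two particles, which contributes at least U, and no site contributes a negative
  energy. This gap is the denominator of the perturbation argument.\<close>

lemma onsite_ge:
  assumes "n \<in> occupations (sites Ns) Ns" "n \<noteq> filled (sites Ns)" "0 \<le> U"
  shows "U \<le> onsite Ns U n"
proof -
  have "\<exists>i\<in>sites Ns. 2 \<le> n i"
  proof (rule ccontr)
    assume "\<not> ?thesis"
    then have le: "n i \<le> 1" if "i \<in> sites Ns" for i using that by force
    have "n i = 1" if "i \<in> sites Ns" for i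
    proof (rule ccontr)
      assume "n i \<noteq> 1"
      then have "(\<Sum>i\<in>sites Ns. n i) < (\<Sum>i\<in>sites Ns. 1)"
        using le that by (intro sum_strict_mono_ex1) (auto intro!: bexI[of _ i] simp: le_less)
      then show False using assms(1) unfolding occupations_def by simp
    qed
    then show False using assms(1,2) unfolding occupations_def filled_def by auto
  qed
  then obtain i where i: "i \<in> sites Ns" "2 \<le> n i" by blast
  have nn: "0 \<le> real (n i) * (real (n i) - 1)" for i by (cases "n i") auto
  have "2 * 1 \<le> real (n i) * (real (n i) - 1)" using i(2) by (intro mult_mono) auto
  also have "\<dots> \<le> (\<Sum>i\<in>sites Ns. real (n i) * (real (n i) - 1))"
    using i(1) nn by (intro member_le_sum) auto
  finally have "U / 2 * 2 \<le> onsite Ns U n"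
    unfolding onsite_def using assms(3) by (intro mult_left_mono) auto
  then show ?thesis by simp
qed

lemma onsite_pair:
  assumes "i \<in> sites Ns" "i \<noteq> j"
  shows "onsite Ns U (pair_state Ns i j) = U"
proof -
  have "(\<Sum>k\<in>sites Ns. real (pair_state Ns i j k) * (real (pair_state Ns i j k) - 1)) =
      (\<Sum>k\<in>sites Ns. if k = i then 2 else 0)"
    using assms by (intro sum.cong) (auto simp: pair_state_def filled_def)
  then show ?thesis unfolding onsite_def using assms by simp
qed

text \<open>The filled state appears in the hopping sum at n only if n is a pair state on a link;
  this singles out the amplitudes of first order.\<close>

lemma hop_filled_iff:
  assumes "i \<in> sites Ns" "j \<in> sites Ns" "i \<noteq> j" "1 \<le> n i"
  shows "hop i j n = filled (sites Ns) \<longleftrightarrow> n = pair_state Ns i j"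
proof
  assume "hop i j n = filled (sites Ns)"
  then have "hop j i (filled (sites Ns)) = n" using hop_hop(1)[of i j n] assms by simp
  moreover have "hop j i (filled (sites Ns)) = pair_state Ns i j"
    using assms(1-3) unfolding hop_def pair_state_def filled_def by (auto simp: fun_eq_iff)
  ultimately show "n = pair_state Ns i j" by simp
next
  assume "n = pair_state Ns i j"
  then show "hop i j n = filled (sites Ns)"
    using assms(1-3) unfolding hop_def pair_state_def filled_def by (auto simp: fun_eq_iff)
qed

lemma pair_state_inj:
  assumes "pair_state Ns i j = pair_state Ns k l" "i \<noteq> j" "k \<noteq> l" "j \<in> sites Ns" "l \<in> sites Ns"
  shows "i = k" "j = l"
proof -
  have "pair_state Ns i j x = 2 \<longleftrightarrow> x = i" if "i \<noteq> j" for i j x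
    using that unfolding pair_state_def filled_def by auto
  then show "i = k" using assms by metis
  have "x \<in> sites Ns \<Longrightarrow> pair_state Ns i j x = 0 \<longleftrightarrow> x = j" if "i \<noteq> j" for i j x
    using that unfolding pair_state_def filled_def by auto
  then show "j = l" using assms by metis
qed

definition sublattice_number :: "nat \<Rightarrow> occ \<Rightarrow> nat" where
  "sublattice_number Ns n = (\<Sum>i\<in>{i \<in> sites Ns. even i}. n i)"

text \<open>Neighbours have opposite parity, also across the closing bond because Ns is even, so
  every hop moves exactly one particle into or out of the even sites.\<close>

lemma sublattice_number_hop:
  assumes "(i, j) \<in> links Ns" "2 \<le> Ns" "even Ns" "1 \<le> n i"
  shows "even (sublattice_number Ns (hop i j n)) \<longleftrightarrow> odd (sublattice_number Ns n)"
proof -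
  note ij = links_sites[OF assms(1,2)]
  let ?E = "{i \<in> sites Ns. even i}"
  have fin: "finite ?E" by simp
  show ?thesis
  proof (cases "even i")
    case True
    then have "i \<in> ?E" "j \<notin> ?E" using ij links_parity[OF assms(1,3)] by auto
    moreover from this have "(\<Sum>k\<in>?E - {i}. hop i j n k) = (\<Sum>k\<in>?E - {i}. n k)"
      by (intro sum.cong) (auto simp: hop_def)
    ultimately have "sublattice_number Ns n = Suc (sublattice_number Ns (hop i j n))"
      unfolding sublattice_number_def using assms(4) ij(3) by (simp add: sum.remove[OF fin, of i] hop_def)
    then show ?thesis by simp
  next
    case False
    then have "j \<in> ?E" "i \<notin> ?E" using ij links_parity[OF assms(1,3)] by auto
    moreover from this have "(\<Sum>k\<in>?E - {j}. hop i j n k) = (\<Sum>k\<in>?E - {j}. n k)"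
      by (intro sum.cong) (auto simp: hop_def)
    ultimately have "sublattice_number Ns (hop i j n) = Suc (sublattice_number Ns n)"
      unfolding sublattice_number_def using ij(3) by (simp add: sum.remove[OF fin, of j] hop_def)
    then show ?thesis by simp
  qed
qed

text \<open>All pair states on links share one parity, so a single hop never connects two of them.
  This removes the second-order correction from their amplitudes.\<close>

lemma sublattice_number_pair:
  assumes "(i, j) \<in> links Ns" "2 \<le> Ns" "even Ns"
  shows "even (sublattice_number Ns (pair_state Ns i j)) \<longleftrightarrow> odd (sublattice_number Ns (filled (sites Ns)))"
proof -
  note ij = links_sites[OF assms(1,2)]
  have 1: "1 \<le> pair_state Ns i j i" using ij unfolding pair_state_def by simp
  show ?thesis
    using sublattice_number_hop[OF assms, of "pair_state Ns i j"] 1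
      hop_filled_iff[OF ij, of "pair_state Ns i j"] by auto
qed

lemma pair_state_occupations:
  assumes "(i, j) \<in> links Ns" "2 \<le> Ns"
  shows "pair_state Ns i j \<in> occupations (sites Ns) Ns"
proof -
  note ij = links_sites[OF assms]
  have 1: "1 \<le> pair_state Ns i j i" using ij unfolding pair_state_def by simp
  show ?thesis
    using hop_occupations[OF ij, of "pair_state Ns i j" Ns] 1
      hop_filled_iff[OF ij, of "pair_state Ns i j"] filled_occupations[of "sites Ns"] by simp
qed

text \<open>The filled state has energy expectation \<open>0\<close>, which is an average of eigenvalues.\<close>

lemma ex_nonpos_energy:
  assumes Ns: "3 \<le> Ns"
  shows "\<exists>E \<phi>. energy_eigenstate Ns Ns t U E \<phi> \<and> E \<le> 0"
proof -
  let ?O = "occupations (sites Ns) Ns" and ?one = "filled (sites Ns)"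
  have fin: "finite ?O" by (rule finite_occupations) simp
  have one: "?one \<in> ?O" using filled_occupations[of "sites Ns"] by simp
  define g where "g a b = (\<lambda>(i, j). if hop i j a = b then hop_coeff i j a else 0)" for a b
  define h where "h a b = complex_of_real (- t * (\<Sum>p\<in>links Ns. g a b p) + (if a = b then onsite Ns U a else 0))" for a b
  \<comment> \<open>Reversing a link reverses the hop with the same coefficient if the source is
    occupied; otherwise the coefficient is zero.\<close>
  have g_sym: "g a b (i, j) = g b a (j, i)" if "(i, j) \<in> links Ns" for a b i j
  proof -
    have ne: "i \<noteq> j" using links_sites[OF that] Ns by simp
    have *: "g a b (i, j) = g b a (j, i)" if "hop i j a = b" "1 \<le> a i" "i \<noteq> j" for a b i j
      using hop_hop[OF that(3), of a] that unfolding g_def by auto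
    show ?thesis
    proof (cases "hop i j a = b \<and> 1 \<le> a i")
      case False
      then have 0: "g a b (i, j) = 0" unfolding g_def by (auto simp: hop_coeff_zero)
      show ?thesis
      proof (cases "hop j i b = a \<and> 1 \<le> b j")
        case True
        then show ?thesis using *[of j i b a] ne by simp
      next
        case False
        then show ?thesis unfolding 0 by (auto simp: g_def hop_coeff_zero)
      qed
    qed (use * ne in auto)
  qed
  have "(\<Sum>p\<in>links Ns. g a b p) = (\<Sum>p\<in>links Ns. g b a p)" for a b
    by (rule sum.reindex_bij_witness[of _ prod.swap prod.swap]) (auto simp: g_sym links_sym)
  then have "h a b = cnj (h b a)" for a b unfolding h_def by auto
  then obtain v d where v: "eigenbasis ?O h v d" using ex_eigenbasis[OF fin, of h] by blast
  have happ: "(\<Sum>b\<in>?O. h a b * \<phi> b) = bose_hubbard Ns t U \<phi> a" if "\<phi> \<in> sector (sites Ns) Ns" "a \<in> ?O" for a \<phi>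
  proof -
    have out: "\<phi> b = 0" if "b \<notin> ?O" for b using that \<open>\<phi> \<in> _\<close> unfolding sector_def by auto
    have "(\<Sum>b\<in>?O. of_real (\<Sum>p\<in>links Ns. g a b p) * \<phi> b) = (\<Sum>p\<in>links Ns. \<Sum>b\<in>?O. of_real (g a b p) * \<phi> b)"
      by (subst sum.swap) (simp add: sum_distrib_right)
    also have "\<dots> = (\<Sum>(i, j)\<in>links Ns. of_real (hop_coeff i j a) * \<phi> (hop i j a))"
    proof (intro sum.cong refl)
      fix p assume "p \<in> links Ns"
      obtain i j where p: "p = (i, j)" by fastforce
      have "(\<Sum>b\<in>?O. of_real (g a b p) * \<phi> b) = (\<Sum>b\<in>?O. if hop i j a = b then of_real (hop_coeff i j a) * \<phi> b else 0)"
        unfolding g_def p by (intro sum.cong) auto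
      also have "\<dots> = of_real (hop_coeff i j a) * \<phi> (hop i j a)"
        using fin out by simp
      finally show "(\<Sum>b\<in>?O. of_real (g a b p) * \<phi> b) = (case p of (i, j) \<Rightarrow> of_real (hop_coeff i j a) * \<phi> (hop i j a))"
        unfolding p by simp
    qed
    finally have hopping: "(\<Sum>b\<in>?O. of_real (\<Sum>p\<in>links Ns. g a b p) * \<phi> b) =
      (\<Sum>(i, j)\<in>links Ns. of_real (hop_coeff i j a) * \<phi> (hop i j a))" .
    have "(\<Sum>b\<in>?O. h a b * \<phi> b) = (\<Sum>b\<in>?O. - of_real t * (of_real (\<Sum>p\<in>links Ns. g a b p) * \<phi> b)
        + (if a = b then of_real (onsite Ns U a) * \<phi> b else 0))"
      unfolding h_def by (intro sum.cong) (auto simp: algebra_simps)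
    also have "\<dots> = - of_real t * (\<Sum>b\<in>?O. of_real (\<Sum>p\<in>links Ns. g a b p) * \<phi> b) + of_real (onsite Ns U a) * \<phi> a"
      unfolding sum.distrib sum_distrib_left[symmetric] using that(2) fin by simp
    finally show ?thesis unfolding hopping bose_hubbard_eq[OF Ns] .
  qed
  have "h ?one ?one = 0"
  proof -
    have "g ?one ?one (i, j) = 0" if "(i, j) \<in> links Ns" for i j
      using links_sites[OF that] Ns unfolding g_def hop_def filled_def
      by (auto simp: fun_eq_iff split: if_splits)
    then have "(\<Sum>p\<in>links Ns. g ?one ?one p) = 0" by (intro sum.neutral) auto
    then show ?thesis unfolding h_def by (simp add: onsite_filled)
  qed
  moreover have "h ?one ?one = (\<Sum>j<card ?O. of_real (d j) * (v j ?one * cnj (v j ?one)))"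
    using v one unfolding eigenbasis_def by (simp add: mult.assoc)
  ultimately have "complex_of_real (\<Sum>j<card ?O. d j * (cmod (v j ?one))\<^sup>2) = of_real 0"
    unfolding complex_norm_square[symmetric] by simp
  then have s0: "(\<Sum>j<card ?O. d j * (cmod (v j ?one))\<^sup>2) = 0" unfolding of_real_eq_iff .
  have "(\<Sum>j<card ?O. v j ?one * cnj (v j ?one)) = 1"
    using v one unfolding eigenbasis_def by simp
  then have "complex_of_real (\<Sum>j<card ?O. (cmod (v j ?one))\<^sup>2) = of_real 1"
    unfolding complex_norm_square[symmetric] by simp
  then have s1: "(\<Sum>j<card ?O. (cmod (v j ?one))\<^sup>2) = 1" unfolding of_real_eq_iff .
  have "\<exists>j<card ?O. d j \<le> 0"
  proof (rule ccontr)
    assume "\<not> ?thesis"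
    then have pos: "0 < d j" if "j < card ?O" for j using that by force
    then have z: "d j * (cmod (v j ?one))\<^sup>2 = 0" if "j < card ?O" for j
      using s0 that sum_nonneg_eq_0_iff[of "{..<card ?O}" "\<lambda>j. d j * (cmod (v j ?one))\<^sup>2"]
      by (auto simp: less_imp_le)
    then have "(cmod (v j ?one))\<^sup>2 = 0" if "j < card ?O" for j
      using z[OF that] pos[OF that] by simp
    then show False using s1 by simp
  qed
  then obtain j where j: "j < card ?O" "d j \<le> 0" by blast
  \<comment> \<open>Extension by zero. Hops preserve the particle number, so the eigenvalue equation
    also holds outside of the sector.\<close>
  define \<phi> where "\<phi> n = (if n \<in> ?O then v j n else 0)" for n
  have \<phi>: "\<phi> \<in> sector (sites Ns) Ns" unfolding sector_def \<phi>_def by auto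
  have "bose_hubbard Ns t U \<phi> n = of_real (d j) * \<phi> n" for n
  proof (cases "n \<in> ?O")
    case True
    have "bose_hubbard Ns t U \<phi> n = (\<Sum>b\<in>?O. h n b * v j b)"
      unfolding happ[OF \<phi> True, symmetric] \<phi>_def by (intro sum.cong) auto
    also have "\<dots> = (\<Sum>k<card ?O. if k = j then of_real (d j) * v j n else 0)"
      unfolding eigenbasis_apply[OF v True] using eigenbasis_orthonormal[OF v] j
      by (intro sum.cong) (auto simp: orthonormal_on_def)
    finally show ?thesis using True j by (simp add: \<phi>_def)
  next
    case False
    have "of_real (hop_coeff i k n) * \<phi> (hop i k n) = 0" if "(i, k) \<in> links Ns" for i k
      using hop_occupations[of i "sites Ns" k n Ns] links_sites[OF that] Ns False
      by (cases "n i = 0") (auto simp: hop_coeff_zero \<phi>_def)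
    then have "(\<Sum>(i, k)\<in>links Ns. of_real (hop_coeff i k n) * \<phi> (hop i k n)) = 0"
      by (intro sum.neutral) auto
    then show ?thesis unfolding bose_hubbard_eq[OF Ns] using False by (simp add: \<phi>_def)
  qed
  moreover have "\<exists>n. \<phi> n \<noteq> 0"
  proof (rule ccontr)
    assume "\<not> ?thesis"
    then have "v j n = 0" if "n \<in> ?O" for n using that unfolding \<phi>_def by meson
    then have "sqnorm ?O (v j) = 0" unfolding sqnorm_def by simp
    then show False using sqnorm_orthonormal[OF eigenbasis_orthonormal[OF v], of j] j by simp
  qed
  ultimately show ?thesis unfolding energy_eigenstate_def using \<phi> j by blast
qed

section \<open>Amplitudes of the ground state\<close>

lemma ground_state_nonpos_energy:
  assumes "3 \<le> Ns" "ground_state Ns Ns t U \<psi>"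
  obtains E where "energy_eigenstate Ns Ns t U E \<psi>" "E \<le> 0"
  using assms(2) ex_nonpos_energy[OF assms(1), of t U] unfolding ground_state_def by force

text \<open>Minimality of the energy is condensed into \<open>E \<le> 0\<close>, which keeps
  \<open>onsite - E\<close> at least U away from the filled state.\<close>

locale bose_hubbard_eigenstate =
  fixes Ns :: nat and t U E \<epsilon> :: real and \<psi> :: fock_vec
  assumes Ns: "4 \<le> Ns" "even Ns" and t: "0 < t" and U: "0 < U" and \<epsilon>_def: "\<epsilon> = sqrt 2 * t / U"
    and eigenstate: "energy_eigenstate Ns Ns t U E \<psi>" and E: "E \<le> 0"
    and norm: "(\<Sum>n\<in>occupations (sites Ns) Ns. (cmod (\<psi> n))\<^sup>2) = 1"
begin

abbreviation "states \<equiv> occupations (sites Ns) Ns"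
abbreviation "mott \<equiv> filled (sites Ns)"

text \<open>At most \<open>2 Ns\<close> oriented links, each with a hop coefficient of at most
  \<open>Ns + 1\<close>: a bound on one application of the hopping operator.\<close>

definition \<kappa> :: real where "\<kappa> = 2 * real Ns * (real Ns + 1)"

definition hopping :: "occ \<Rightarrow> complex" where
  "hopping n = (\<Sum>(i, j)\<in>links Ns. of_real (hop_coeff i j n) * \<psi> (hop i j n))"

lemma \<kappa>: "1 \<le> \<kappa>"
proof -
  have "1 * 1 \<le> (2 * real Ns) * (real Ns + 1)" using Ns by (intro mult_mono) auto
  then show ?thesis unfolding \<kappa>_def by simp
qed

lemma \<epsilon>_pos: "0 < \<epsilon>" unfolding \<epsilon>_def using t U by simp

lemma t_le: "t \<le> U * \<epsilon>"
proof -
  have "U * \<epsilon> = sqrt 2 * t" unfolding \<epsilon>_def using U by simp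
  moreover have "1 * t \<le> sqrt 2 * t" using t by (intro mult_right_mono) auto
  ultimately show ?thesis by simp
qed

lemma finite_states: "finite states" by (rule finite_occupations) simp

lemma mott_state: "mott \<in> states" using filled_occupations[of "sites Ns"] by simp

lemma \<psi>_outside: "n \<notin> states \<Longrightarrow> \<psi> n = 0"
  using eigenstate unfolding energy_eigenstate_def sector_def by blast

lemma \<psi>_le_1: "cmod (\<psi> n) \<le> 1"
proof (cases "n \<in> states")
  case True
  then show ?thesis
    using cmod_le_1_if_sqnorm[OF finite_states, of \<psi> n] norm unfolding sqnorm_def by simp
qed (simp add: \<psi>_outside)

lemma eigen_eq: "of_real (onsite Ns U n - E) * \<psi> n = of_real t * hopping n"
proof -
  have "- of_real t * hopping n + of_real (onsite Ns U n) * \<psi> n = of_real E * \<psi> n"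
    using eigenstate bose_hubbard_eq[of Ns t U \<psi> n] Ns
    unfolding energy_eigenstate_def hopping_def by simp
  then show ?thesis by (simp add: algebra_simps)
qed

lemma hop_sum_le:
  assumes n: "n \<in> states" and P: "P \<subseteq> links Ns" and r: "0 \<le> r"
    and le: "\<And>i j. (i, j) \<in> P \<Longrightarrow> 1 \<le> n i \<Longrightarrow> cmod (\<psi> (hop i j n)) \<le> r"
  shows "cmod (\<Sum>(i, j)\<in>P. of_real (hop_coeff i j n) * \<psi> (hop i j n)) \<le> \<kappa> * r"
proof -
  have "cmod (\<Sum>(i, j)\<in>P. of_real (hop_coeff i j n) * \<psi> (hop i j n)) \<le> card P * ((real Ns + 1) * r)"
  proof (rule sum_cmod_le)
    fix p assume p: "p \<in> P"
    obtain i j where ij: "p = (i, j)" by fastforce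
    have pos: "0 \<le> (real Ns + 1) * r" using r by simp
    show "cmod (case p of (i, j) \<Rightarrow> of_real (hop_coeff i j n) * \<psi> (hop i j n)) \<le> (real Ns + 1) * r"
    proof (cases "n i = 0")
      case False
      have "hop_coeff i j n \<le> sqrt (real Ns + 1) * sqrt (real Ns + 1)"
        unfolding hop_coeff_def using occupations_le[OF n, of i] occupations_le[OF n, of j]
        by (intro mult_mono real_sqrt_le_mono) auto
      then have "hop_coeff i j n \<le> real Ns + 1" by simp
      moreover have "0 \<le> hop_coeff i j n" unfolding hop_coeff_def by simp
      moreover have "cmod (\<psi> (hop i j n)) \<le> r" using le[of i j] p ij False by simp
      ultimately show ?thesis unfolding ij by (simp add: norm_mult mult_mono)
    qed (use pos in \<open>simp add: ij hop_coeff_zero\<close>)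
  qed
  also have "\<dots> \<le> (2 * real Ns) * ((real Ns + 1) * r)"
  proof (intro mult_right_mono)
    have "card P \<le> card (links Ns)" using P by (intro card_mono) auto
    then have "card P \<le> 2 * Ns" using card_links[of Ns] by simp
    then show "real (card P) \<le> 2 * real Ns" by linarith
  qed (use r in simp)
  finally show ?thesis unfolding \<kappa>_def by (simp add: mult.assoc)
qed

text \<open>The eigenvalue equation solved for the amplitude: the denominator is at least U and
  \<open>t \<le> U \<epsilon>\<close>. Each use converts a bound on the neighbours into one that is
  better by a factor \<epsilon>.\<close>

lemma amplitude_le:
  assumes n: "n \<in> states" "n \<noteq> mott" and h: "cmod (hopping n) \<le> r"
  shows "cmod (\<psi> n) \<le> r * \<epsilon>"
proof -
  have "U * cmod (\<psi> n) \<le> (onsite Ns U n - E) * cmod (\<psi> n)"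
    using onsite_ge[OF n, of U] U E by (intro mult_right_mono) auto
  also have "\<dots> = cmod (of_real (onsite Ns U n - E) * \<psi> n)"
    using onsite_ge[OF n, of U] U E by (simp add: norm_mult del: of_real_diff)
  also have "\<dots> = t * cmod (hopping n)" unfolding eigen_eq using t by (simp add: norm_mult)
  also have "\<dots> \<le> (U * \<epsilon>) * r" using h t t_le by (intro mult_mono) (auto intro: order_trans)
  finally have "U * cmod (\<psi> n) \<le> U * (r * \<epsilon>)" by (simp add: mult_ac)
  then show ?thesis using U by simp
qed

lemma first_order:
  assumes "n \<noteq> mott"
  shows "cmod (\<psi> n) \<le> \<kappa> * \<epsilon>"
proof (cases "n \<in> states")
  case True
  have "cmod (hopping n) \<le> \<kappa> * 1"
    unfolding hopping_def using True \<psi>_le_1 by (intro hop_sum_le) auto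
  then show ?thesis using amplitude_le[OF True assms] by simp
qed (use \<kappa> \<epsilon>_pos in \<open>simp add: \<psi>_outside\<close>)

text \<open>None of the neighbours of such a state is the filled one, so they all obey
  \<open>first_order\<close>, and \<open>amplitude_le\<close> gains another factor.\<close>

lemma second_order:
  assumes "n \<noteq> mott" and "\<And>i j. (i, j) \<in> links Ns \<Longrightarrow> n \<noteq> pair_state Ns i j"
  shows "cmod (\<psi> n) \<le> \<kappa>\<^sup>2 * \<epsilon>\<^sup>2"
proof (cases "n \<in> states")
  case True
  have "hop i j n \<noteq> mott" if "(i, j) \<in> links Ns" "1 \<le> n i" for i j
    using hop_filled_iff[of i Ns j n] links_sites[OF that(1)] assms(2)[OF that(1)] that(2) Ns by simp
  then have "cmod (hopping n) \<le> \<kappa> * (\<kappa> * \<epsilon>)"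
    unfolding hopping_def using True first_order \<kappa> \<epsilon>_pos by (intro hop_sum_le) auto
  from amplitude_le[OF True assms(1) this] show ?thesis by (simp add: power2_eq_square mult_ac)
qed (use \<kappa> \<epsilon>_pos in \<open>simp add: \<psi>_outside\<close>)

text \<open>The eigenvalue equation at the filled state, which has no on-site energy and whose
  neighbours all have amplitudes of order \<epsilon>.\<close>

lemma energy_bound: "\<bar>E\<bar> * cmod (\<psi> mott) \<le> t * \<kappa>\<^sup>2 * \<epsilon>"
proof -
  have "hop i j mott \<noteq> mott" if "(i, j) \<in> links Ns" for i j
    using links_sites[OF that] Ns unfolding hop_def filled_def by (auto simp: fun_eq_iff split: if_splits)
  then have "cmod (hopping mott) \<le> \<kappa> * (\<kappa> * \<epsilon>)"
    unfolding hopping_def using mott_state first_order \<kappa> \<epsilon>_pos by (intro hop_sum_le) auto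
  then have "t * cmod (hopping mott) \<le> t * (\<kappa> * (\<kappa> * \<epsilon>))" using t by (intro mult_left_mono) auto
  moreover have "\<bar>E\<bar> * cmod (\<psi> mott) = t * cmod (hopping mott)"
    using arg_cong[OF eigen_eq[of mott], of cmod] t unfolding onsite_filled by (simp add: norm_mult)
  ultimately show ?thesis by (simp add: power2_eq_square mult_ac)
qed

lemma base_weight: "1 - card states * \<kappa>\<^sup>2 * \<epsilon>\<^sup>2 \<le> (cmod (\<psi> mott))\<^sup>2"
proof -
  have "(\<Sum>n\<in>states - {mott}. (cmod (\<psi> n))\<^sup>2) \<le> (\<Sum>n\<in>states - {mott}. (\<kappa> * \<epsilon>)\<^sup>2)"
    using first_order by (intro sum_mono power_mono) auto
  also have "\<dots> \<le> (\<Sum>n\<in>states. (\<kappa> * \<epsilon>)\<^sup>2)"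
    using finite_states by (intro sum_mono2) auto
  also have "\<dots> = card states * \<kappa>\<^sup>2 * \<epsilon>\<^sup>2" by (simp add: power_mult_distrib)
  finally show ?thesis
    using norm sum.remove[OF finite_states mott_state, of "\<lambda>n. (cmod (\<psi> n))\<^sup>2"] by simp
qed

text \<open>In the equation at a pair state the hop back to the filled state gives
  \<open>sqrt 2 t = U \<epsilon>\<close> times its amplitude. The other neighbours are of order
  \<open>\<epsilon>^2\<close> by parity, and the energy term is a product of two factors of order
  \<epsilon>. The 3 is 2 from the energy, whose bound is divided by an amplitude of at least 1/2,
  plus 1 from the neighbours.\<close>

lemma pair_amplitude:
  assumes half: "1 / 2 \<le> cmod (\<psi> mott)" and ij: "(i, j) \<in> links Ns"
  shows "cmod (\<psi> (pair_state Ns i j) - of_real \<epsilon> * \<psi> mott) \<le> 3 * \<kappa> ^ 3 * \<epsilon> ^ 3"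
proof -
  let ?p = "pair_state Ns i j"
  define rest where
    "rest = (\<Sum>(k, l)\<in>links Ns - {(i, j)}. of_real (hop_coeff k l ?p) * \<psi> (hop k l ?p))"
  have Ns': "2 \<le> Ns" using Ns by simp
  note sij = links_sites[OF ij Ns']
  have p: "?p \<in> states" by (rule pair_state_occupations[OF ij Ns'])
  have p1: "1 \<le> ?p i" unfolding pair_state_def using sij by simp
  have pne: "?p \<noteq> mott" using sij unfolding pair_state_def filled_def by (auto simp: fun_eq_iff)
  have "hop_coeff i j ?p = sqrt 2" using sij unfolding hop_coeff_def pair_state_def by simp
  moreover have "hop i j ?p = mott" using hop_filled_iff[OF sij, of ?p] p1 by simp
  ultimately have hopping: "hopping ?p = of_real (sqrt 2) * \<psi> mott + rest"
    unfolding hopping_def rest_def using ij by (simp add: sum.remove)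
  have "cmod rest \<le> \<kappa> * (\<kappa>\<^sup>2 * \<epsilon>\<^sup>2)"
    unfolding rest_def
  proof (rule hop_sum_le[OF p])
    fix k l assume kl: "(k, l) \<in> links Ns - {(i, j)}" and k1: "1 \<le> ?p k"
    note skl = links_sites[of k l Ns]
    have ne: "hop k l ?p \<noteq> mott"
      using hop_filled_iff[of k Ns l ?p] skl kl Ns' k1 pair_state_inj[of Ns i j k l] sij by auto
    have "hop k l ?p \<noteq> pair_state Ns a b" if "(a, b) \<in> links Ns" for a b
      using sublattice_number_hop[of k l Ns ?p] kl Ns' Ns(2) k1
        sublattice_number_pair[OF ij Ns' Ns(2)] sublattice_number_pair[OF that Ns' Ns(2)] by auto
    with ne show "cmod (\<psi> (hop k l ?p)) \<le> \<kappa>\<^sup>2 * \<epsilon>\<^sup>2" by (rule second_order)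
  qed auto
  then have rest: "t * cmod rest \<le> t * (\<kappa> ^ 3 * \<epsilon>\<^sup>2)"
    using t by (intro mult_left_mono) (auto simp: power2_eq_square power3_eq_cube mult_ac)
  have "of_real U * (\<psi> ?p - of_real \<epsilon> * \<psi> mott) = of_real E * \<psi> ?p + of_real t * rest"
  proof -
    have "of_real (U - E) * \<psi> ?p = of_real t * (of_real (sqrt 2) * \<psi> mott + rest)"
      using eigen_eq[of ?p] onsite_pair[OF sij(1,3), of U] unfolding hopping by simp
    moreover have "U * \<epsilon> = t * sqrt 2" unfolding \<epsilon>_def using U by simp
    then have "complex_of_real U * of_real \<epsilon> = of_real t * of_real (sqrt 2)"
      by (simp only: of_real_mult[symmetric])
    ultimately show ?thesis by (simp add: algebra_simps)
  qed
  then have "U * cmod (\<psi> ?p - of_real \<epsilon> * \<psi> mott) = cmod (of_real E * \<psi> ?p + of_real t * rest)"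
    using U by (metis abs_of_pos norm_mult norm_of_real)
  also have "\<dots> \<le> \<bar>E\<bar> * cmod (\<psi> ?p) + t * cmod rest"
    by (rule order_trans[OF norm_triangle_ineq]) (use t in \<open>simp add: norm_mult\<close>)
  also have "\<bar>E\<bar> * cmod (\<psi> ?p) \<le> (2 * (t * \<kappa>\<^sup>2 * \<epsilon>)) * (\<kappa> * \<epsilon>)"
  proof (intro mult_mono)
    have "\<bar>E\<bar> * (1 / 2) \<le> \<bar>E\<bar> * cmod (\<psi> mott)" using half by (intro mult_left_mono) auto
    then show "\<bar>E\<bar> \<le> 2 * (t * \<kappa>\<^sup>2 * \<epsilon>)" using energy_bound by simp
  qed (use first_order[OF pne] t \<epsilon>_pos in auto)
  also have "t * cmod rest \<le> t * (\<kappa> ^ 3 * \<epsilon>\<^sup>2)" by (rule rest)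
  also have "(2 * (t * \<kappa>\<^sup>2 * \<epsilon>)) * (\<kappa> * \<epsilon>) + t * (\<kappa> ^ 3 * \<epsilon>\<^sup>2) = t * (3 * \<kappa> ^ 3 * \<epsilon>\<^sup>2)"
    by (simp add: power2_eq_square power3_eq_cube algebra_simps)
  also have "\<dots> \<le> (U * \<epsilon>) * (3 * \<kappa> ^ 3 * \<epsilon>\<^sup>2)"
    using t_le \<kappa> by (intro mult_right_mono) auto
  also have "\<dots> = U * (3 * \<kappa> ^ 3 * \<epsilon> ^ 3)" by (simp add: power2_eq_square power3_eq_cube)
  finally show ?thesis using U by simp
qed

end

section \<open>Bipartition of the ring\<close>

definition restrict_occ :: "nat set \<Rightarrow> occ \<Rightarrow> occ" where
  "restrict_occ S n = (\<lambda>i. if i \<in> S then n i else 0)"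

lemma subsystem_basis_iff:
  "a \<in> subsystem_basis S N \<longleftrightarrow> (\<forall>i. i \<notin> S \<longrightarrow> a i = 0) \<and> sum a S \<le> N"
  unfolding subsystem_basis_def occupations_def by auto

lemma finite_subsystem_basis: "finite S \<Longrightarrow> finite (subsystem_basis S N)"
  unfolding subsystem_basis_def by (auto intro: finite_occupations)

lemma sum_doublon:
  assumes "finite S" "i \<in> S"
  shows "sum (doublon S i) S = card S + 1"
proof -
  have "sum (doublon S i) S = (\<Sum>k\<in>S. 1 + (if k = i then 1 else 0))"
    unfolding doublon_def by (intro sum.cong) auto
  also have "\<dots> = card S + 1" unfolding sum.distrib using assms by simp
  finally show ?thesis .
qed

lemma sum_hole:
  assumes "finite S" "i \<in> S"
  shows "sum (hole S i) S + 1 = card S"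
proof -
  have "sum (hole S i) S + 1 = (\<Sum>k\<in>S. hole S i k + (if k = i then 1 else 0))"
    using assms by (simp add: sum.distrib)
  also have "\<dots> = (\<Sum>k\<in>S. 1)" unfolding hole_def by (intro sum.cong) auto
  finally show ?thesis by simp
qed

lemma doublon_inj: "i \<in> S \<Longrightarrow> j \<in> S \<Longrightarrow> doublon S i = doublon S j \<Longrightarrow> i = j"
  unfolding doublon_def by (drule fun_cong[of _ _ i]) (auto split: if_splits)

lemma hole_inj: "i \<in> S \<Longrightarrow> j \<in> S \<Longrightarrow> hole S i = hole S j \<Longrightarrow> i = j"
  unfolding hole_def by (drule fun_cong[of _ _ i]) (auto split: if_splits)

lemma doublon_neq_hole: "i \<in> S \<Longrightarrow> doublon S i \<noteq> hole S j"
  unfolding doublon_def hole_def by (auto simp: fun_eq_iff intro!: exI[of _ i])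

definition coupling :: "nat \<Rightarrow> nat set \<Rightarrow> nat set \<Rightarrow> occ \<Rightarrow> occ \<Rightarrow> real" where
  "coupling Ns A B r c =
    (if \<exists>i\<in>A. \<exists>j\<in>B. {i, j} \<in> boundary Ns A B \<and>
          (r = doublon A i \<and> c = hole B j \<or> r = hole A i \<and> c = doublon B j)
     then 1 else 0)"

definition pair_basis :: "nat set \<Rightarrow> occ set" where
  "pair_basis S = doublon S ` S \<union> hole S ` S"

lemma mat_on_gram:
  fixes C :: "'a \<Rightarrow> 'b \<Rightarrow> real"
  assumes X: "finite X" and Y: "finite Y"
  shows "mat_on X Y C * transpose_mat (mat_on X Y C) = mat_on X X (\<lambda>a a'. \<Sum>b\<in>Y. C a b * C a' b)"
proof (rule eq_matI)
  let ?g = "from_nat_into Y"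
  fix p q assume "p < dim_row (mat_on X X (\<lambda>a a'. \<Sum>b\<in>Y. C a b * C a' b))"
    "q < dim_col (mat_on X X (\<lambda>a a'. \<Sum>b\<in>Y. C a b * C a' b))"
  then have pq: "p < card X" "q < card X" by (auto simp: mat_on_def)
  have "(mat_on X Y C * transpose_mat (mat_on X Y C)) $$ (p, q) =
      (\<Sum>k<card Y. C (from_nat_into X p) (?g k) * C (from_nat_into X q) (?g k))"
    using pq by (simp add: mat_on_def scalar_prod_def atLeast0LessThan)
  also have "\<dots> = (\<Sum>b\<in>Y. C (from_nat_into X p) b * C (from_nat_into X q) b)"
    by (rule sum.reindex_bij_betw[OF bij_betw_from_nat_into_finite[OF Y]])
  finally show "(mat_on X Y C * transpose_mat (mat_on X Y C)) $$ (p, q) =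
      mat_on X X (\<lambda>a a'. \<Sum>b\<in>Y. C a b * C a' b) $$ (p, q)"
    using pq by (simp add: mat_on_def)
qed (auto simp: mat_on_def)

text \<open>One diagonalization supplies both the eigenvectors and the multiset of roots, so the
  same c serves the entropy estimate and the boundary eigenvalues.\<close>

lemma gram_eigenvalues:
  fixes C :: "'a \<Rightarrow> 'b \<Rightarrow> real"
  assumes X: "finite X" and Y: "finite Y"
  shows "\<exists>f c. eigenbasis X (\<lambda>a a'. of_real (\<Sum>b\<in>Y. C a b * C a' b)) f c \<and>
    filter_mset (\<lambda>c. c \<noteq> 0) (proots (char_poly (mat_on X Y C * transpose_mat (mat_on X Y C)))) =
      image_mset c (mset_set {k. k < card X \<and> c k \<noteq> 0})"
proof -
  let ?G = "\<lambda>a a'. \<Sum>b\<in>Y. C a b * C a' b"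
  define S where "S = mat_on X Y C * transpose_mat (mat_on X Y C)"
  have S: "S = mat_on X X ?G" unfolding S_def by (rule mat_on_gram[OF X Y])
  have Sc: "S \<in> carrier_mat (card X) (card X)" unfolding S by (simp add: mat_on_def)
  have SC: "map_mat complex_of_real S = mat_on X X (\<lambda>a a'. of_real (?G a a'))"
    unfolding S by (rule eq_matI) (auto simp: mat_on_def)
  have "mat_adjoint (mat_on X X (\<lambda>a a'. complex_of_real (?G a a'))) = mat_on X X (\<lambda>a a'. of_real (?G a a'))"
    by (rule mat_on_hermitian[OF X]) (simp add: mult.commute)
  from hermitian_diagonalization[OF _ this, of "card X"]
  obtain V c where V: "unitary_mat (card X) V" and eq: "mat_on X X (\<lambda>a a'. complex_of_real (?G a a')) =
      V * mat_diag (card X) (\<lambda>i. complex_of_real (c i)) * mat_adjoint V"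
    by (auto simp: mat_on_def)
  have "proots (char_poly S) = image_mset c (mset_set {..<card X})"
    by (rule proots_char_poly_real_diagonalization[OF Sc V]) (simp only: SC eq)
  then have "filter_mset (\<lambda>c. c \<noteq> 0) (proots (char_poly S)) =
      image_mset c (mset_set {k. k < card X \<and> c k \<noteq> 0})"
    by (simp add: filter_mset_image_mset filter_mset_mset_set)
  then show ?thesis
    using eigenbasis_of_diagonalization[OF X V eq] unfolding S_def by blast
qed

locale ring_bipartition =
  fixes Ns :: nat and A B :: "nat set"
  assumes Ns: "4 \<le> Ns" and part: "A \<union> B = sites Ns" "A \<inter> B = {}" and ne: "A \<noteq> {}" "B \<noteq> {}"
begin

abbreviation "\<A> \<equiv> subsystem_basis A Ns"
abbreviation "\<B> \<equiv> subsystem_basis B Ns"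
abbreviation "\<A>1 \<equiv> occupations A (card A)"
abbreviation "\<B>1 \<equiv> occupations B (card B)"
abbreviation "C \<equiv> coupling Ns A B"

section \<open>Splitting and joining occupation numbers\<close>

lemma finite_parts: "finite A" "finite B"
  using part(1) finite_sites(1)[of Ns] by (metis finite_Un)+

lemma finite_bases: "finite \<A>" "finite \<B>"
  using finite_parts finite_subsystem_basis by auto

lemma card_parts: "card A + card B = Ns"
  using card_Un_disjoint[OF finite_parts part(2)] part(1) by simp

lemma card_pos: "0 < card A" "0 < card B"
  using ne finite_parts by (auto simp: card_gt_0_iff)

lemma sum_sites: "sum g (sites Ns) = sum g A + sum g B"
  unfolding part(1)[symmetric] using finite_parts part(2) by (simp add: sum.union_disjoint)

lemma sum_join_A: "b \<in> \<B> \<Longrightarrow> sum (join a b) A = sum a A"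
  using part(2) unfolding subsystem_basis_iff join_def by (intro sum.cong) auto

lemma sum_join_B: "a \<in> \<A> \<Longrightarrow> sum (join a b) B = sum b B"
  using part(2) unfolding subsystem_basis_iff join_def by (intro sum.cong) auto

lemma join_states_iff:
  assumes "a \<in> \<A>" "b \<in> \<B>"
  shows "join a b \<in> occupations (sites Ns) Ns \<longleftrightarrow> sum a A + sum b B = Ns"
proof -
  have "join a b i = 0" if "i \<notin> sites Ns" for i
    using that assms part(1) unfolding subsystem_basis_iff join_def by auto
  then show ?thesis
    unfolding occupations_def using sum_sites[of "join a b"] sum_join_A[OF assms(2)] sum_join_B[OF assms(1)]
    by simp
qed

lemma restrict_join:
  assumes "a \<in> \<A>" "b \<in> \<B>"
  shows "restrict_occ A (join a b) = a" "restrict_occ B (join a b) = b"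
  using assms part(2) unfolding subsystem_basis_iff restrict_occ_def join_def by (auto simp: fun_eq_iff)

lemma join_restrict:
  assumes "n \<in> occupations (sites Ns) Ns"
  shows "join (restrict_occ A n) (restrict_occ B n) = n"
    and "restrict_occ A n \<in> \<A>" "restrict_occ B n \<in> \<B>"
proof -
  show "join (restrict_occ A n) (restrict_occ B n) = n"
    using assms part unfolding occupations_def join_def restrict_occ_def by (auto simp: fun_eq_iff)
  have "sum n A + sum n B = Ns" using assms sum_sites[of n] unfolding occupations_def by simp
  then show "restrict_occ A n \<in> \<A>" "restrict_occ B n \<in> \<B>"
    unfolding subsystem_basis_iff restrict_occ_def by auto
qed

lemma sum_join:
  fixes g :: "occ \<Rightarrow> real"
  assumes "\<And>n. n \<notin> occupations (sites Ns) Ns \<Longrightarrow> g n = 0"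
  shows "(\<Sum>a\<in>\<A>. \<Sum>b\<in>\<B>. g (join a b)) = (\<Sum>n\<in>occupations (sites Ns) Ns. g n)"
proof -
  let ?P = "{p \<in> \<A> \<times> \<B>. join (fst p) (snd p) \<in> occupations (sites Ns) Ns}"
  have "(\<Sum>a\<in>\<A>. \<Sum>b\<in>\<B>. g (join a b)) = (\<Sum>p\<in>\<A> \<times> \<B>. g (join (fst p) (snd p)))"
    by (simp add: sum.cartesian_product case_prod_beta)
  also have "\<dots> = (\<Sum>p\<in>?P. g (join (fst p) (snd p)))"
    using assms finite_bases by (intro sum.mono_neutral_right) auto
  also have "\<dots> = (\<Sum>n\<in>occupations (sites Ns) Ns. g n)"
    by (rule sum.reindex_bij_witness[of _ "\<lambda>n. (restrict_occ A n, restrict_occ B n)"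
          "\<lambda>p. join (fst p) (snd p)"]) (auto simp: restrict_join join_restrict)
  finally show ?thesis .
qed

text \<open>These states hold one particle more or less than the filled state of their part. A
  doublon still fits into the basis with at most Ns particles because the other part is
  nonempty.\<close>

lemma pair_basis_subset: "pair_basis A \<subseteq> \<A> - \<A>1" "pair_basis B \<subseteq> \<B> - \<B>1"
proof -
  have *: "pair_basis S \<subseteq> subsystem_basis S Ns - occupations S (card S)"
    if "finite S" "card S < Ns" for S
  proof -
    have "doublon S i \<in> subsystem_basis S Ns - occupations S (card S)" if "i \<in> S" for i
    proof -
      have "\<forall>k. k \<notin> S \<longrightarrow> doublon S i k = 0" by (simp add: doublon_def)
      then show ?thesis
        using sum_doublon[OF \<open>finite S\<close> that] \<open>card S < Ns\<close>
        by (simp add: subsystem_basis_iff occupations_def)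
    qed
    moreover have "hole S i \<in> subsystem_basis S Ns - occupations S (card S)" if "i \<in> S" for i
    proof -
      have "\<forall>k. k \<notin> S \<longrightarrow> hole S i k = 0" by (simp add: hole_def)
      then show ?thesis
        using sum_hole[OF \<open>finite S\<close> that] \<open>card S < Ns\<close>
        by (simp add: subsystem_basis_iff occupations_def)
    qed
    ultimately show ?thesis unfolding pair_basis_def by auto
  qed
  show "pair_basis A \<subseteq> \<A> - \<A>1" "pair_basis B \<subseteq> \<B> - \<B>1"
    using *[OF finite_parts(1)] *[OF finite_parts(2)] card_parts card_pos by auto
qed

lemma coupling_support:
  assumes "C a b \<noteq> 0"
  shows "a \<in> pair_basis A \<and> b \<in> pair_basis B"
  using assms unfolding coupling_def pair_basis_def by (auto split: if_splits)

lemma sectors_subset: "\<A>1 \<subseteq> \<A>" "\<B>1 \<subseteq> \<B>"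
  using card_parts unfolding subsystem_basis_iff occupations_def subset_iff by auto

lemma filled_sectors: "filled A \<in> \<A>1" "filled B \<in> \<B>1"
  using filled_occupations finite_parts by auto

lemma boundary_eigen:
  obtains f c where
    "first_order_coupling \<A> \<A>1 (pair_basis A) \<B> \<B>1 (filled A) (filled B) C f c"
    "boundary_eigenvalues Ns A B = image_mset c (mset_set {k. k < card (pair_basis A) \<and> c k \<noteq> 0})"
proof -
  have fin: "finite (pair_basis A)" "finite (pair_basis B)"
    unfolding pair_basis_def using finite_parts by auto
  obtain f c where f: "eigenbasis (pair_basis A)
      (\<lambda>a a'. of_real (\<Sum>b\<in>pair_basis B. C a b * C a' b)) f c"
    and c: "filter_mset (\<lambda>c. c \<noteq> 0) (proots (char_poly (mat_on (pair_basis A) (pair_basis B) C *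
        transpose_mat (mat_on (pair_basis A) (pair_basis B) C)))) =
      image_mset c (mset_set {k. k < card (pair_basis A) \<and> c k \<noteq> 0})"
    using gram_eigenvalues[OF fin, of C] by blast
  have "boundary_matrix Ns A B = mat_on (pair_basis A) (pair_basis B) C"
    unfolding boundary_matrix_def pair_basis_def coupling_def[abs_def] ..
  then have "boundary_eigenvalues Ns A B = image_mset c (mset_set {k. k < card (pair_basis A) \<and> c k \<noteq> 0})"
    unfolding boundary_eigenvalues_def Let_def using c by simp
  moreover have "first_order_coupling \<A> \<A>1 (pair_basis A) \<B> \<B>1 (filled A) (filled B) C f c"
  proof -
    have supp: "a \<in> pair_basis A" "b \<notin> \<B>1" if "C a b \<noteq> 0" for a b
      using coupling_support[OF that] pair_basis_subset(2) by blast+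
    have le: "\<bar>C a b\<bar> \<le> 1" for a b by (simp add: coupling_def)
    \<comment> \<open>The Gram matrix is unchanged when the columns are extended by zero to the
      whole basis of B.\<close>
    have "(\<Sum>b\<in>pair_basis B. C a b * C a' b) = (\<Sum>b\<in>\<B>. C a b * C a' b)" for a a'
    proof (rule sum.mono_neutral_left)
      show "\<forall>b\<in>\<B> - pair_basis B. C a b * C a' b = 0"
        using coupling_support[of a] by (metis DiffD2 mult_zero_left)
    qed (use finite_bases pair_basis_subset in auto)
    then have eig: "eigenbasis (pair_basis A) (\<lambda>a a'. of_real (\<Sum>b\<in>\<B>. C a b * C a' b)) f c"
      using f by simp
    show ?thesis
      by (intro first_order_coupling.intro conjI finite_bases sectors_subset pair_basis_subset
          filled_sectors supp le eig)
  qed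
  ultimately show ?thesis using that by blast
qed

text \<open>The entries are 0 or 1, so the sum counts the support. A boundary bond has exactly one
  orientation from A to B and yields one entry in each of the disjoint sets S1 and S2.\<close>

lemma coupling_weight: "(\<Sum>a\<in>\<A>. \<Sum>b\<in>\<B>. (C a b)\<^sup>2) = 2 * real (card (boundary Ns A B))"
proof -
  define Z where "Z = {(i, j). i \<in> A \<and> j \<in> B \<and> {i, j} \<in> boundary Ns A B}"
  define S1 where "S1 = (\<lambda>(i, j). (doublon A i, hole B j)) ` Z"
  define S2 where "S2 = (\<lambda>(i, j). (hole A i, doublon B j)) ` Z"
  have "Z \<subseteq> A \<times> B" unfolding Z_def by auto
  then have finZ: "finite Z" using finite_parts finite_subset by blast
  have inj: "inj_on (\<lambda>(i, j). {i, j}) Z"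
    using part(2) unfolding Z_def by (auto simp: inj_on_def doubleton_eq_iff)
  moreover have "(\<lambda>(i, j). {i, j}) ` Z = boundary Ns A B"
    unfolding Z_def boundary_def by (auto simp: image_iff)
  ultimately have cZ: "card Z = card (boundary Ns A B)" by (metis card_image)
  have c1: "card S1 = card Z"
    unfolding S1_def by (rule card_image) (auto simp: inj_on_def Z_def dest: doublon_inj hole_inj)
  have c2: "card S2 = card Z"
    unfolding S2_def by (rule card_image) (auto simp: inj_on_def Z_def dest: doublon_inj hole_inj)
  have disj: "S1 \<inter> S2 = {}"
    unfolding S1_def S2_def Z_def using doublon_neq_hole by fastforce
  have supp: "C a b = (if (a, b) \<in> S1 \<union> S2 then 1 else 0)" for a b
    unfolding coupling_def S1_def S2_def Z_def by (auto simp: image_iff)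
  have sub: "S1 \<union> S2 \<subseteq> \<A> \<times> \<B>"
    using pair_basis_subset unfolding S1_def S2_def Z_def pair_basis_def by auto
  have "(\<Sum>a\<in>\<A>. \<Sum>b\<in>\<B>. (C a b)\<^sup>2) = (\<Sum>p\<in>\<A> \<times> \<B>. if p \<in> S1 \<union> S2 then 1 else 0)"
    unfolding sum.cartesian_product by (intro sum.cong) (auto simp: supp)
  also have "\<dots> = real (card (\<A> \<times> \<B> \<inter> {p. p \<in> S1 \<union> S2}))"
    using finite_bases by (simp add: sum.If_cases)
  also have "\<A> \<times> \<B> \<inter> {p. p \<in> S1 \<union> S2} = S1 \<union> S2" using sub by blast
  also have "card (S1 \<union> S2) = 2 * card (boundary Ns A B)"
    using disj finZ c1 c2 cZ by (subst card_Un_disjoint) (auto simp: S1_def S2_def)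
  finally show ?thesis by simp
qed

section \<open>Pair states seen from the two subsystems\<close>

lemma restrict_pair:
  shows "i \<notin> A \<Longrightarrow> j \<notin> A \<Longrightarrow> restrict_occ A (pair_state Ns i j) = filled A"
    and "i \<notin> B \<Longrightarrow> j \<notin> B \<Longrightarrow> restrict_occ B (pair_state Ns i j) = filled B"
    and "i \<in> A \<Longrightarrow> j \<in> B \<Longrightarrow> restrict_occ A (pair_state Ns i j) = doublon A i"
    and "i \<in> A \<Longrightarrow> j \<in> B \<Longrightarrow> restrict_occ B (pair_state Ns i j) = hole B j"
    and "i \<in> B \<Longrightarrow> j \<in> A \<Longrightarrow> restrict_occ A (pair_state Ns i j) = hole A j"
    and "i \<in> B \<Longrightarrow> j \<in> A \<Longrightarrow> restrict_occ B (pair_state Ns i j) = doublon B i"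
  using part unfolding restrict_occ_def pair_state_def filled_def doublon_def hole_def
  by (auto simp: fun_eq_iff)

lemma join_filled: "join (filled A) (filled B) = filled (sites Ns)"
  using part unfolding join_def filled_def by (auto simp: fun_eq_iff)

lemma join_pair:
  assumes "i \<in> A" "j \<in> B"
  shows "join (doublon A i) (hole B j) = pair_state Ns i j"
    and "join (hole A i) (doublon B j) = pair_state Ns j i"
  using assms part unfolding join_def pair_state_def filled_def doublon_def hole_def
  by (auto simp: fun_eq_iff)

lemma links_iff: "(i, j) \<in> links Ns \<longleftrightarrow> {i, j} \<in> bonds Ns"
  unfolding links_def bonds_def by (auto simp: image_iff doubleton_eq_iff)

text \<open>A link inside of one part leaves the other part filled; a link across gives an entry of
  C. So C records every first-order amplitude away from the row and column of the filled
  states.\<close>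

lemma join_eq_pair:
  assumes a: "a \<in> \<A>" and b: "b \<in> \<B>" and ij: "(i, j) \<in> links Ns" and eq: "join a b = pair_state Ns i j"
  shows "a = filled A \<or> b = filled B \<or> C a b = 1"
proof -
  have ab: "a = restrict_occ A (pair_state Ns i j)" "b = restrict_occ B (pair_state Ns i j)"
    using restrict_join[OF a b] eq by simp_all
  have "i \<in> A \<union> B" "j \<in> A \<union> B" using links_sites[OF ij] Ns part(1) by auto
  then consider "i \<in> A" "j \<in> A" | "i \<in> B" "j \<in> B" | "i \<in> A" "j \<in> B" | "i \<in> B" "j \<in> A" by blast
  then show ?thesis
  proof cases
    case 1
    then show ?thesis using restrict_pair(2) part(2) ab by blast
  next
    case 2
    then show ?thesis using restrict_pair(1) part(2) ab by blast
  next
    case 3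
    then have "{i, j} \<in> boundary Ns A B" using ij unfolding links_iff boundary_def by blast
    then show ?thesis
      using 3 unfolding ab restrict_pair(3)[OF 3] restrict_pair(4)[OF 3] coupling_def by auto
  next
    case 4
    then have "{j, i} \<in> boundary Ns A B" using ij unfolding links_iff boundary_def by (auto simp: insert_commute)
    then show ?thesis
      using 4 unfolding ab restrict_pair(5)[OF 4] restrict_pair(6)[OF 4] coupling_def by auto
  qed
qed

lemma coupling_pair:
  assumes "C a b \<noteq> 0"
  obtains i j where "(i, j) \<in> links Ns" "join a b = pair_state Ns i j" "C a b = 1"
proof -
  obtain i j where ij: "i \<in> A" "j \<in> B" "{i, j} \<in> boundary Ns A B"
    and ab: "a = doublon A i \<and> b = hole B j \<or> a = hole A i \<and> b = doublon B j"
    using assms unfolding coupling_def by (auto split: if_splits)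
  have C: "C a b = 1" using assms unfolding coupling_def by (auto split: if_splits)
  have l: "(i, j) \<in> links Ns" "(j, i) \<in> links Ns"
    using ij(3) unfolding links_iff boundary_def by (auto simp: insert_commute)
  show ?thesis
    using ab
  proof (elim disjE conjE)
    assume "a = doublon A i" "b = hole B j"
    then show thesis using that l(1) C join_pair(1)[OF ij(1,2)] by blast
  next
    assume "a = hole A i" "b = doublon B j"
    then show thesis using that l(2) C join_pair(2)[OF ij(1,2)] by blast
  qed
qed

text \<open>The global phase is removed so that the amplitude of the filled state becomes positive.\<close>

lemma perturbed_ground_state:
  fixes t U E \<epsilon> :: real and \<psi> :: fock_vec
  assumes fc: "first_order_coupling \<A> \<A>1 (pair_basis A) \<B> \<B>1 (filled A) (filled B) C f c"
    and bh: "bose_hubbard_eigenstate Ns t U E \<epsilon> \<psi>"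
  defines "\<kappa> \<equiv> 2 * real Ns * (real Ns + 1)" and "D \<equiv> real (card (occupations (sites Ns) Ns))"
  assumes small: "2 * D * \<kappa>\<^sup>2 * \<epsilon> < 1"
  shows "perturbed_product_state \<A> \<A>1 (pair_basis A) \<B> \<B>1 (filled A) (filled B) C f c
    (\<kappa>\<^sup>2 + 3 * \<kappa> ^ 3 + D * \<kappa>\<^sup>2) \<epsilon> (\<lambda>a b. cnj (sgn (\<psi> (filled (sites Ns)))) * \<psi> (join a b))"
proof -
  interpret bh: bose_hubbard_eigenstate Ns t U E \<epsilon> \<psi> by (rule bh)
  have \<kappa>: "bh.\<kappa> = \<kappa>" unfolding bh.\<kappa>_def \<kappa>_def ..
  let ?one = "filled (sites Ns)"
  let ?\<omega> = "sgn (\<psi> ?one)"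
  let ?M = "\<lambda>a b. cnj ?\<omega> * \<psi> (join a b)"
  \<comment> \<open>The summands come from the second-order amplitudes, from the pair amplitudes,
    and from replacing the modulus of the filled amplitude by 1.\<close>
  let ?K = "\<kappa>\<^sup>2 + 3 * \<kappa> ^ 3 + D * \<kappa>\<^sup>2"
  have \<kappa>1: "1 \<le> \<kappa>" using bh.\<kappa> unfolding \<kappa> .
  have \<epsilon>0: "0 < \<epsilon>" by (rule bh.\<epsilon>_pos)
  have D1: "1 \<le> D"
    using bh.finite_states bh.mott_state card_gt_0_iff[of bh.states] unfolding D_def by fastforce
  have \<kappa>2: "1 \<le> \<kappa>\<^sup>2" "\<kappa> \<le> \<kappa>\<^sup>2" 
    using power_increasing[of 0 2 \<kappa>] power_increasing[of 1 2 \<kappa>] \<kappa>1 by auto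
  \<comment> \<open>Since \<open>D \<kappa>^2 \<ge> 1\<close>, the smallness assumption yields both
    \<open>\<epsilon> < 1/2\<close> and \<open>D \<kappa>^2 \<epsilon>^2 \<le> 1/4\<close>. The
    filled state then keeps weight 3/4, enough for an amplitude of at least 1/2.\<close>
  have Q1: "1 \<le> D * \<kappa>\<^sup>2" using mult_mono[OF D1 \<kappa>2(1)] D1 by simp
  have Q\<epsilon>: "D * \<kappa>\<^sup>2 * \<epsilon> < 1 / 2" using small by simp
  have "1 * \<epsilon> \<le> D * \<kappa>\<^sup>2 * \<epsilon>" using Q1 \<epsilon>0 by (intro mult_right_mono) auto
  then have \<epsilon>1: "\<epsilon> < 1 / 2" using Q\<epsilon> by simp
  have "(D * \<kappa>\<^sup>2 * \<epsilon>) * \<epsilon> \<le> (1 / 2) * (1 / 2)"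
    using Q\<epsilon> \<epsilon>1 \<epsilon>0 D1 by (intro mult_mono) auto
  then have Q2: "D * \<kappa>\<^sup>2 * \<epsilon>\<^sup>2 \<le> 1 / 4" by (simp add: power2_eq_square mult.assoc)
  have weight: "1 - D * \<kappa>\<^sup>2 * \<epsilon>\<^sup>2 \<le> (cmod (\<psi> ?one))\<^sup>2" using bh.base_weight unfolding \<kappa> D_def .
  have half: "1 / 2 \<le> cmod (\<psi> ?one)"
  proof (rule ccontr)
    assume "\<not> ?thesis"
    then have "(cmod (\<psi> ?one))\<^sup>2 < (1 / 2)\<^sup>2" by (intro power_strict_mono) auto
    then show False using weight Q2 by (simp add: power2_eq_square)
  qed
  then have nz: "\<psi> ?one \<noteq> 0" by auto
  then have \<omega>: "cmod ?\<omega> = 1" by (simp add: norm_sgn)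
  have \<omega>\<psi>: "cnj ?\<omega> * \<psi> ?one = of_real (cmod (\<psi> ?one))"
  proof -
    have "\<psi> ?one = of_real (cmod (\<psi> ?one)) * ?\<omega>" using nz by (simp add: sgn_eq)
    then have "cnj ?\<omega> * \<psi> ?one = of_real (cmod (\<psi> ?one)) * (?\<omega> * cnj ?\<omega>)"
      by (metis mult.assoc mult.commute)
    also have "?\<omega> * cnj ?\<omega> = 1" using \<omega> complex_norm_square[of ?\<omega>] by simp
    finally show ?thesis by simp
  qed
  have cM: "cmod (?M a b) = cmod (\<psi> (join a b))" for a b using \<omega> by (simp add: norm_mult)
  have join_one: "a = filled A \<and> b = filled B" if "a \<in> \<A>" "b \<in> \<B>" "join a b = ?one" for a b
    using that restrict_join[OF that(1,2)] restrict_join[of "filled A" "filled B"]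
      filled_sectors sectors_subset join_filled by (metis subsetD)
  have Kge: "\<kappa> \<le> ?K" "\<kappa>\<^sup>2 \<le> ?K" "3 * \<kappa> ^ 3 + D * \<kappa>\<^sup>2 \<le> ?K" "1 \<le> ?K"
  proof -
    have "0 \<le> 3 * \<kappa> ^ 3" using \<kappa>1 by simp
    then show "\<kappa> \<le> ?K" "\<kappa>\<^sup>2 \<le> ?K" "3 * \<kappa> ^ 3 + D * \<kappa>\<^sup>2 \<le> ?K" "1 \<le> ?K"
      using \<kappa>2 Q1 by linarith+
  qed
  have first: "cmod (?M a b - of_real (\<epsilon> * C a b)) \<le> ?K * \<epsilon> ^ 3" if C: "C a b \<noteq> 0" for a b
  proof -
    obtain i j where ij: "(i, j) \<in> links Ns" "join a b = pair_state Ns i j" and C1: "C a b = 1"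
      by (rule coupling_pair[OF C])
    let ?p = "pair_state Ns i j"
    have "?M a b - of_real (\<epsilon> * C a b) =
        cnj ?\<omega> * (\<psi> ?p - of_real \<epsilon> * \<psi> ?one) + of_real (\<epsilon> * (cmod (\<psi> ?one) - 1))"
      unfolding ij(2) C1 using \<omega>\<psi> by (simp add: algebra_simps)
    also have "cmod \<dots> \<le> cmod (\<psi> ?p - of_real \<epsilon> * \<psi> ?one) + \<epsilon> * (1 - cmod (\<psi> ?one))"
      using bh.\<psi>_le_1[of ?one] \<epsilon>0 \<omega>
      by (intro order_trans[OF norm_triangle_ineq]) (simp add: norm_mult abs_mult del: of_real_mult of_real_diff)
    also have "cmod (\<psi> ?p - of_real \<epsilon> * \<psi> ?one) \<le> 3 * \<kappa> ^ 3 * \<epsilon> ^ 3"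
      using bh.pair_amplitude[OF half ij(1)] unfolding \<kappa> .
    also have "\<epsilon> * (1 - cmod (\<psi> ?one)) \<le> \<epsilon> * (D * \<kappa>\<^sup>2 * \<epsilon>\<^sup>2)"
    proof (intro mult_left_mono)
      have "(cmod (\<psi> ?one))\<^sup>2 \<le> cmod (\<psi> ?one)"
        using bh.\<psi>_le_1[of ?one] by (simp add: power2_eq_square mult_left_le)
      then show "1 - cmod (\<psi> ?one) \<le> D * \<kappa>\<^sup>2 * \<epsilon>\<^sup>2" using weight by simp
    qed (use \<epsilon>0 in simp)
    also have "3 * \<kappa> ^ 3 * \<epsilon> ^ 3 + \<epsilon> * (D * \<kappa>\<^sup>2 * \<epsilon>\<^sup>2) = (3 * \<kappa> ^ 3 + D * \<kappa>\<^sup>2) * \<epsilon> ^ 3"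
      by (simp add: power2_eq_square power3_eq_cube algebra_simps)
    also have "\<dots> \<le> ?K * \<epsilon> ^ 3" using Kge(3) \<epsilon>0 by (intro mult_right_mono) auto
    finally show ?thesis by simp
  qed
  have second: "cmod (?M a b) \<le> ?K * \<epsilon>\<^sup>2"
    if "a \<in> \<A>" "b \<in> \<B>" "a \<noteq> filled A" "b \<noteq> filled B" "C a b = 0" for a b
  proof -
    have "cmod (\<psi> (join a b)) \<le> \<kappa>\<^sup>2 * \<epsilon>\<^sup>2"
      unfolding \<kappa>[symmetric]
    proof (rule bh.second_order)
      show "join a b \<noteq> ?one" using join_one that by blast
      show "join a b \<noteq> pair_state Ns i j" if "(i, j) \<in> links Ns" for i j
        using join_eq_pair[OF \<open>a \<in> \<A>\<close> \<open>b \<in> \<B>\<close> that] \<open>a \<noteq> _\<close> \<open>b \<noteq> _\<close> \<open>C a b = 0\<close> by auto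
    qed
    also have "\<dots> \<le> ?K * \<epsilon>\<^sup>2" using Kge by (intro mult_right_mono) auto
    finally show ?thesis unfolding cM .
  qed
  show ?thesis
  proof (intro perturbed_product_state.intro fc perturbed_product_state_axioms.intro)
    show "1 \<le> ?K" "0 < \<epsilon>" by (fact Kge \<epsilon>0)+
    show "\<epsilon> < 1" using \<epsilon>1 by simp
    show "(\<Sum>a\<in>\<A>. \<Sum>b\<in>\<B>. (cmod (?M a b))\<^sup>2) = 1"
      unfolding cM using sum_join[of "\<lambda>n. (cmod (\<psi> n))\<^sup>2"] bh.\<psi>_outside bh.norm by simp
    \<comment> \<open>Particle conservation: together the parts hold
      \<open>Ns = card A + card B\<close> particles, so one is in its filled sector exactly when the
      other is.\<close>
    show "?M a b = 0" if "a \<in> \<A>" "b \<in> \<B>" "(a \<in> \<A>1) \<noteq> (b \<in> \<B>1)" for a b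
    proof -
      have "a \<in> \<A>1 \<longleftrightarrow> sum a A = card A" "b \<in> \<B>1 \<longleftrightarrow> sum b B = card B"
        using that(1,2) unfolding subsystem_basis_iff occupations_def by auto
      then have "join a b \<notin> occupations (sites Ns) Ns"
        using that card_parts unfolding join_states_iff[OF that(1,2)] by linarith
      then show ?thesis by (simp add: bh.\<psi>_outside)
    qed
    show "1 / 2 \<le> cmod (?M (filled A) (filled B))" unfolding cM unfolding join_filled by (rule half)
    show "cmod (?M a b) \<le> ?K * \<epsilon>" if "a \<in> \<A>" "b \<in> \<B>" "(a, b) \<noteq> (filled A, filled B)" for a b
    proof -
      have "cmod (?M a b) \<le> \<kappa> * \<epsilon>"
        unfolding cM \<kappa>[symmetric] using join_one that by (intro bh.first_order) auto
      also have "\<dots> \<le> ?K * \<epsilon>" using Kge \<epsilon>0 by (intro mult_right_mono) auto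
      finally show ?thesis .
    qed
    show "cmod (?M a b) \<le> ?K * \<epsilon>\<^sup>2"
      if "a \<in> \<A>1" "b \<in> \<B>1" "a \<noteq> filled A" "b \<noteq> filled B" for a b
      using that sectors_subset coupling_support[of a b] pair_basis_subset by (intro second) auto
    show "cmod (?M a b - of_real (\<epsilon> * C a b)) \<le> ?K * \<epsilon>\<^sup>2" if "a \<in> \<A> - \<A>1" "b \<in> \<B> - \<B>1" for a b
    proof (cases "C a b = 0")
      case True
      then show ?thesis using second[of a b] that filled_sectors by auto
    next
      case False
      have "cmod (?M a b - of_real (\<epsilon> * C a b)) \<le> ?K * \<epsilon> ^ 3" by (rule first[OF False])
      also have "\<dots> \<le> ?K * \<epsilon>\<^sup>2"
        using Kge(4) \<epsilon>0 \<epsilon>1 by (intro mult_left_mono power_decreasing) auto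
      finally show ?thesis .
    qed
    show "cmod (?M a b - of_real (\<epsilon> * C a b)) \<le> ?K * \<epsilon> ^ 3" if "C a b \<noteq> 0" for a b
      by (rule first[OF that])
  qed
qed

text \<open>The bounds K and \<epsilon>0 are chosen before t, U and the state, from dimensions and
  the \<open>c k\<close>; the threshold \<open>1 / (2 D \<kappa>^2)\<close> is the smallness
  required by \<open>perturbed_ground_state\<close>.\<close>

lemma entropy_ground_state:
  assumes ev: "even Ns"
    and fc: "first_order_coupling \<A> \<A>1 (pair_basis A) \<B> \<B>1 (filled A) (filled B) C f c"
  defines "ks \<equiv> {k. k < card (pair_basis A) \<and> c k \<noteq> 0}"
  shows "\<exists>K \<epsilon>0. 0 < \<epsilon>0 \<and> (\<forall>t U \<epsilon> \<psi>. t > 0 \<and> U > 0 \<and> \<epsilon> = sqrt 2 * t / U \<and> \<epsilon> < \<epsilon>0 \<and>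
      ground_state Ns Ns t U \<psi> \<longrightarrow>
    \<bar>entanglement_entropy A B Ns \<psi> -
      \<epsilon>\<^sup>2 * ((\<Sum>a\<in>\<A>. \<Sum>b\<in>\<B>. (C a b)\<^sup>2) * (1 + ln (1 / \<epsilon>\<^sup>2)) - (\<Sum>k\<in>ks. c k * ln (c k)))\<bar> \<le> K * \<epsilon> ^ 3)"
proof -
  interpret fo: first_order_coupling \<A> \<A>1 "pair_basis A" \<B> \<B>1 "filled A" "filled B" C f c
    by (rule fc)
  define \<kappa> where "\<kappa> = 2 * real Ns * (real Ns + 1)"
  define D where "D = real (card (occupations (sites Ns) Ns))"
  define K where "K = \<kappa>\<^sup>2 + 3 * \<kappa> ^ 3 + D * \<kappa>\<^sup>2"
  define n m where "n = real (card \<A>)" and "m = real (card \<B>)"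
  have "0 < \<kappa>" unfolding \<kappa>_def using Ns by (intro mult_pos_pos) auto
  then have "0 < \<kappa>\<^sup>2" by simp
  moreover have "0 < D"
    using finite_occupations[of "sites Ns" Ns] filled_occupations[of "sites Ns"]
    unfolding D_def by (auto simp: card_gt_0_iff)
  ultimately have pos: "0 < 2 * D * \<kappa>\<^sup>2" by simp
  show ?thesis
  proof (intro exI conjI allI impI; (elim conjE)?)
    show "0 < 1 / (2 * D * \<kappa>\<^sup>2)" using pos by simp
    fix t U \<epsilon> :: real and \<psi> :: fock_vec
    assume t: "0 < t" and U: "0 < U" and \<epsilon>: "\<epsilon> = sqrt 2 * t / U" "\<epsilon> < 1 / (2 * D * \<kappa>\<^sup>2)"
      and gs: "ground_state Ns Ns t U \<psi>"
    have small: "2 * D * \<kappa>\<^sup>2 * \<epsilon> < 1" using \<epsilon>(2) pos by (simp add: field_simps)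
    obtain E where E: "energy_eigenstate Ns Ns t U E \<psi>" "E \<le> 0"
      using ground_state_nonpos_energy[OF _ gs] Ns by auto
    have bh: "bose_hubbard_eigenstate Ns t U E \<epsilon> \<psi>"
      using Ns ev t U \<epsilon>(1) E gs by unfold_locales (auto simp: ground_state_def)
    let ?M = "\<lambda>a b. cnj (sgn (\<psi> (filled (sites Ns)))) * \<psi> (join a b)"
    have pp: "perturbed_product_state \<A> \<A>1 (pair_basis A) \<B> \<B>1 (filled A) (filled B) C f c K \<epsilon> ?M"
      using perturbed_ground_state[OF fc bh] small unfolding K_def \<kappa>_def D_def by blast
    interpret pp: perturbed_product_state \<A> \<A>1 "pair_basis A" \<B> \<B>1 "filled A" "filled B" C f c K \<epsilon> ?M
      by (rule pp)
    \<comment> \<open>The removed phase has modulus 1 and cancels in \<open>M M^*\<close>, so the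
      reduced density matrix of the original state is recovered.\<close>
    have nz: "\<psi> (filled (sites Ns)) \<noteq> 0" using pp.M_base by auto
    then have "cnj (sgn (\<psi> (filled (sites Ns)))) * sgn (\<psi> (filled (sites Ns))) = 1"
      using complex_norm_square[of "sgn (\<psi> (filled (sites Ns)))"] by (simp add: norm_sgn mult.commute)
    then have "?M a b * cnj (?M a' b) = ket_bra \<psi> (join a b) (join a' b)" for a a' b
      unfolding ket_bra_def by (simp add: mult_ac)
    then have H: "pp.H = (\<lambda>a a'. \<Sum>b\<in>\<B>. ket_bra \<psi> (join a b) (join a' b))"
      unfolding pp.H_def[abs_def] by simp
    obtain v d where v: "eigenbasis \<A> pp.H v d"
      and S: "entanglement_entropy A B Ns \<psi> = - (\<Sum>j<card \<A>. d j * ln (d j))"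
      using entanglement_entropy_eigenbasis[OF finite_bases(1), of \<psi> B] unfolding H by blast
    show "\<bar>entanglement_entropy A B Ns \<psi> -
      \<epsilon>\<^sup>2 * ((\<Sum>a\<in>\<A>. \<Sum>b\<in>\<B>. (C a b)\<^sup>2) * (1 + ln (1 / \<epsilon>\<^sup>2)) - (\<Sum>k\<in>ks. c k * ln (c k)))\<bar> \<le>
      (49 * n * m * K ^ 4 + n + 2 * n\<^sup>2 * m * K\<^sup>2 * (\<Sum>k\<in>ks. \<bar>ln (c k)\<bar>)
        + 4 * n ^ 3 * m\<^sup>2 * K ^ 4 * (1 + (\<Sum>k\<in>ks. 1 / c k))) * \<epsilon> ^ 3"
      using pp.entropy_bound[OF v] unfolding S fo.\<beta>_def fo.kset_def ks_def n_def m_def .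
  qed
qed

end

theorem mainTheorem3:
  fixes Ns :: nat and A B :: "nat set"
  assumes "Ns \<ge> 4" and "even Ns"
    and "A \<union> B = sites Ns" and "A \<inter> B = {}" and "A \<noteq> {}" and "B \<noteq> {}"
  shows "(\<Sum>c\<in>#boundary_eigenvalues Ns A B. c) = 2 * real (card (boundary Ns A B)) \<and>
    (\<exists>K \<epsilon>0. \<epsilon>0 > 0 \<and>
      (\<forall>t U \<epsilon> \<psi>. t > 0 \<and> U > 0 \<and> \<epsilon> = sqrt 2 * t / U \<and> \<epsilon> < \<epsilon>0 \<and> ground_state Ns Ns t U \<psi> \<longrightarrow>
        \<bar>entanglement_entropy A B Ns \<psi> -
          \<epsilon>\<^sup>2 * (2 * real (card (boundary Ns A B)) * (1 + ln (1 / \<epsilon>\<^sup>2))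
                - (\<Sum>c\<in>#boundary_eigenvalues Ns A B. c * ln c))\<bar> \<le> K * \<epsilon> ^ 3))"
proof -
  interpret ring_bipartition Ns A B using assms by unfold_locales
  obtain f c where
    fc: "first_order_coupling \<A> \<A>1 (pair_basis A) \<B> \<B>1 (filled A) (filled B) C f c"
    and c: "boundary_eigenvalues Ns A B = image_mset c (mset_set {k. k < card (pair_basis A) \<and> c k \<noteq> 0})"
    by (rule boundary_eigen)
  interpret fo: first_order_coupling \<A> \<A>1 "pair_basis A" \<B> \<B>1 "filled A" "filled B" C f c
    by (rule fc)
  have eig: "(\<Sum>c\<in>#boundary_eigenvalues Ns A B. g c) = (\<Sum>k\<in>{k. k < card (pair_basis A) \<and> c k \<noteq> 0}. g (c k))"
    for g :: "real \<Rightarrow> real"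
    unfolding c by (simp add: sum_unfold_sum_mset image_mset.compositionality comp_def)
  have "(\<Sum>c\<in>#boundary_eigenvalues Ns A B. c) = 2 * real (card (boundary Ns A B))"
    unfolding eig coupling_weight[symmetric] using fo.c_sum unfolding fo.kset_def fo.\<beta>_def .
  then show ?thesis
    using entropy_ground_state[OF assms(2) fc] unfolding eig coupling_weight by blast
qed

end
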